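(* Let $1<p<n$, and let $\Omega\subset\mathbb{R}^n$ be a bounded and star-shaped domain with smooth boundary. If $\lambda\le0$, then there do not exist regular weak solutions $u\in C^1(\overline\Omega)$ of the problem $$-\Delta_p^H u = u^{p^\star-1}+\lambda u^{p-1}\ \text{ in }\Omega,\qquad u>0\ \text{ in }\Omega,\qquad u=0\ \text{ on }\partial\Omega.$$
   Context: $H:\mathbb{R}^n\to\mathbb{R}$ is a fixed function (called a norm, though not assumed symmetric) such that: (i) $H$ is convex; (ii) $H(t\xi)=tH(\xi)$ for all $\xi\in\mathbb{R}^n$, $t>0$; (iii) $H(\xi)>0$ for all $\xi\neq0$; (iv) $H\in C^2(\mathbb{R}^n\setminus\{0\})$; (v) the set $\{x\in\mathbb{R}^n: H(x)<1\}$ is uniformly convex, i.e. all principal curvatures of its boundary are bounded away from $0$. $p^\star=np/(n-p)$. The anisotropic $p$-Laplacian is $-\Delta_p^H u=-\mathrm{div}\big(H(\nabla u)^{p-1}\nabla H(\nabla u)\big)$, where $H(\xi)^{p-1}\nabla H(\xi)$ is understood as $0$ at $\xi=0$. A weak solution of the problem is a function $u\in W^{1,p}_0(\Omega)$ with $u>0$ a.e. in $\Omega$ and, for every $v\in W_0^{1,p}(\Omega)$, $$\int_\Omega H(\nabla u)^{p-1}\langle\nabla H(\nabla u),\nabla v\rangle\,dx-\lambda\int_\Omega u^{p-1}v\,dx-\int_\Omega u^{p^\star-1}v\,dx=0.$$ *)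

theory Defs
  imports "HOL-Analysis.Analysis"
begin

section \<open>Classical differentiability\<close>

definition gradient :: "(real^'n \<Rightarrow> real) \<Rightarrow> real^'n \<Rightarrow> real^'n" where
  "gradient f x = (THE D. GDERIV f x :> D)"

lemma gradient_eq:
  assumes "GDERIV f x :> D"
  shows "gradient f x = D"
  unfolding gradient_def
proof (rule the_equality)
  show "GDERIV f x :> D" by (rule assms)
next
  fix E assume "GDERIV f x :> E"
  then have "(\<lambda>h. h \<bullet> E) = (\<lambda>h. h \<bullet> D)"
    using assms has_derivative_unique unfolding gderiv_def by blast
  then have "\<forall>h. h \<bullet> E = h \<bullet> D"
    by (rule fun_cong[THEN allI])
  then show "E = D"
    by (simp only: vector_eq_ldot)
qed

text \<open>The class \<open>C^k(S)\<close>; meant for open \<open>S\<close> only.\<close>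

fun Ck_on :: "nat \<Rightarrow> (real^'n \<Rightarrow> real) \<Rightarrow> (real^'n) set \<Rightarrow> bool" where
  "Ck_on 0 f S = continuous_on S f"
| "Ck_on (Suc k) f S =
    (\<exists>g. (\<forall>x\<in>S. GDERIV f x :> g x) \<and> (\<forall>i. Ck_on k (\<lambda>x. g x $ i) S))"

definition smooth_on :: "(real^'n \<Rightarrow> real) \<Rightarrow> (real^'n) set \<Rightarrow> bool" where
  "smooth_on f S \<longleftrightarrow> (\<forall>k. Ck_on k f S)"

text \<open>\<open>u \<in> C^1\<close> up to the boundary: \<open>u\<close> is continuous on the closure, and its gradient in \<open>\<Omega>\<close>
  extends continuously to the closure.\<close>

definition C1_closure :: "(real^'n) set \<Rightarrow> (real^'n \<Rightarrow> real) \<Rightarrow> bool" where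
  "C1_closure \<Omega> u \<longleftrightarrow> continuous_on (closure \<Omega>) u \<and>
    (\<exists>g. continuous_on (closure \<Omega>) g \<and> (\<forall>x\<in>\<Omega>. GDERIV u x :> g x))"

section \<open>Boundary regularity and curvature\<close>

text \<open>Near \<open>x\<close>, the set \<open>S\<close> is the sublevel set \<open>{\<phi> < 0}\<close> of a function without critical points.
  It follows that the frontier of \<open>S\<close> is \<open>{\<phi> = 0}\<close> there, that \<open>S\<close> lies on one side of it, and that
  \<open>gradient \<phi>\<close> is an outer normal.\<close>

definition local_defining_function ::
    "(real^'n) set \<Rightarrow> real^'n \<Rightarrow> (real^'n) set \<Rightarrow> (real^'n \<Rightarrow> real) \<Rightarrow> bool" where
  "local_defining_function S x U \<phi> \<longleftrightarrow> open U \<and> x \<in> U \<and>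
    (\<forall>y\<in>U. gradient \<phi> y \<noteq> 0) \<and> S \<inter> U = {y\<in>U. \<phi> y < 0}"

definition smooth_boundary :: "(real^'n) set \<Rightarrow> bool" where
  "smooth_boundary S \<longleftrightarrow>
    (\<forall>x\<in>frontier S. \<exists>U \<phi>. local_defining_function S x U \<phi> \<and> smooth_on \<phi> U)"

text \<open>Principal curvatures are the eigenvalues, on the tangent space, of the derivative of the outer
  unit normal field. They do not depend on the choice of \<open>\<phi>\<close>.\<close>

definition principal_curvature :: "(real^'n) set \<Rightarrow> real^'n \<Rightarrow> real \<Rightarrow> bool" where
  "principal_curvature S x \<kappa> \<longleftrightarrow>
    (\<exists>U \<phi> D v. local_defining_function S x U \<phi> \<and> Ck_on 2 \<phi> U \<and>
      ((\<lambda>y. gradient \<phi> y /\<^sub>R norm (gradient \<phi> y)) has_derivative D) (at x) \<and>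
      v \<noteq> 0 \<and> v \<bullet> gradient \<phi> x = 0 \<and> D v = \<kappa> *\<^sub>R v)"

definition uniformly_convex_set :: "(real^'n) set \<Rightarrow> bool" where
  "uniformly_convex_set S \<longleftrightarrow> convex S \<and>
    (\<exists>c>0. \<forall>x\<in>frontier S. \<forall>\<kappa>. principal_curvature S x \<kappa> \<longrightarrow> c \<le> \<bar>\<kappa>\<bar>)"

section \<open>The anisotropic norm\<close>

definition anisotropic_norm :: "(real^'n \<Rightarrow> real) \<Rightarrow> bool" where
  "anisotropic_norm H \<longleftrightarrow> convex_on UNIV H \<and>
    (\<forall>\<xi> t. t > 0 \<longrightarrow> H (t *\<^sub>R \<xi>) = t * H \<xi>) \<and>
    (\<forall>\<xi>. \<xi> \<noteq> 0 \<longrightarrow> H \<xi> > 0) \<and>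
    Ck_on 2 H (- {0}) \<and>
    uniformly_convex_set {x. H x < 1}"

definition aniso_flux :: "(real^'n \<Rightarrow> real) \<Rightarrow> real \<Rightarrow> real^'n \<Rightarrow> real^'n" where
  "aniso_flux H p \<xi> = (if \<xi> = 0 then 0 else H \<xi> powr (p - 1) *\<^sub>R gradient H \<xi>)"

section \<open>Sobolev spaces\<close>

text \<open>Functions on \<open>\<Omega>\<close> are represented by total functions, whose values outside \<open>\<Omega>\<close> are irrelevant.\<close>

definition Lp_on ::
    "(real^'n) set \<Rightarrow> real \<Rightarrow> (real^'n \<Rightarrow> 'b::real_normed_vector) \<Rightarrow> bool" where
  "Lp_on \<Omega> p f \<longleftrightarrow> f \<in> borel_measurable (lebesgue_on \<Omega>) \<and>
    integrable (lebesgue_on \<Omega>) (\<lambda>x. norm (f x) powr p)"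

definition test_function :: "(real^'n) set \<Rightarrow> (real^'n \<Rightarrow> real) \<Rightarrow> bool" where
  "test_function \<Omega> \<phi> \<longleftrightarrow> smooth_on \<phi> UNIV \<and>
    compact (closure {x. \<phi> x \<noteq> 0}) \<and> closure {x. \<phi> x \<noteq> 0} \<subseteq> \<Omega>"

definition weak_gradient ::
    "(real^'n) set \<Rightarrow> (real^'n \<Rightarrow> real) \<Rightarrow> (real^'n \<Rightarrow> real^'n) \<Rightarrow> bool" where
  "weak_gradient \<Omega> u g \<longleftrightarrow> (\<forall>\<phi>. test_function \<Omega> \<phi> \<longrightarrow>
    (\<forall>i. (\<integral>x. u x * gradient \<phi> x $ i \<partial>lebesgue_on \<Omega>) = - (\<integral>x. g x $ i * \<phi> x \<partial>lebesgue_on \<Omega>)))"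

text \<open>\<open>W1p \<Omega> p u g\<close>: \<open>u \<in> W^{1,p}(\<Omega>)\<close> and \<open>g\<close> represents its weak gradient, which is unique up to
  null sets.\<close>

definition W1p ::
    "(real^'n) set \<Rightarrow> real \<Rightarrow> (real^'n \<Rightarrow> real) \<Rightarrow> (real^'n \<Rightarrow> real^'n) \<Rightarrow> bool" where
  "W1p \<Omega> p u g \<longleftrightarrow> Lp_on \<Omega> p u \<and> Lp_on \<Omega> p g \<and> weak_gradient \<Omega> u g"

text \<open>\<open>W1p0 \<Omega> p u g\<close>: moreover \<open>u\<close> belongs to the \<open>W^{1,p}\<close>-closure of the test functions.\<close>

definition W1p0 ::
    "(real^'n) set \<Rightarrow> real \<Rightarrow> (real^'n \<Rightarrow> real) \<Rightarrow> (real^'n \<Rightarrow> real^'n) \<Rightarrow> bool" where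
  "W1p0 \<Omega> p u g \<longleftrightarrow> W1p \<Omega> p u g \<and>
    (\<exists>\<phi>. (\<forall>k::nat. test_function \<Omega> (\<phi> k)) \<and>
      (\<lambda>k. \<integral>x. \<bar>u x - \<phi> k x\<bar> powr p \<partial>lebesgue_on \<Omega>) \<longlonglongrightarrow> 0 \<and>
      (\<lambda>k. \<integral>x. norm (g x - gradient (\<phi> k) x) powr p \<partial>lebesgue_on \<Omega>) \<longlonglongrightarrow> 0)"

section \<open>Weak solutions\<close>

definition sobolev_conjugate :: "nat \<Rightarrow> real \<Rightarrow> real" where
  "sobolev_conjugate n p = real n * p / (real n - p)"

text \<open>Weak solutions of \<open>- div (H(\<nabla>u)^{p-1} \<nabla>H(\<nabla>u)) = u^{p*-1} + \<mu> u^{p-1}\<close>, \<open>u > 0\<close> in \<open>\<Omega>\<close>,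
  \<open>u = 0\<close> on the boundary. The boundary condition is the membership in \<open>W1p0\<close>. All integrands are
  integrable when \<open>1 < p < n\<close>, by Hoelder's inequality and the Sobolev embedding.\<close>

definition weak_solution ::
    "(real^'n \<Rightarrow> real) \<Rightarrow> real \<Rightarrow> real \<Rightarrow> (real^'n) set \<Rightarrow> (real^'n \<Rightarrow> real) \<Rightarrow> bool" where
  "weak_solution H p \<mu> \<Omega> u \<longleftrightarrow>
    (\<exists>Du. W1p0 \<Omega> p u Du \<and>
      (AE x in lebesgue_on \<Omega>. u x > 0) \<and>
      (\<forall>v Dv. W1p0 \<Omega> p v Dv \<longrightarrow>
        (\<integral>x. aniso_flux H p (Du x) \<bullet> Dv x \<partial>lebesgue_on \<Omega>)
        - \<mu> * (\<integral>x. u x powr (p - 1) * v x \<partial>lebesgue_on \<Omega>)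
        - (\<integral>x. u x powr (sobolev_conjugate CARD('n) p - 1) * v x \<partial>lebesgue_on \<Omega>) = 0))"

end

theory Submission
  imports Defs
begin

text \<open>
  The proof compares a solution \<open>u\<close> with its dilations \<open>u_t(x) = u(a + (x - a) / t)\<close>, \<open>t < 1\<close>, about the star
  centre \<open>a\<close>, extended by zero. Since \<open>\<Omega>\<close> is star-shaped, \<open>u_t\<close> belongs to \<open>W^{1,p}_0(\<Omega>)\<close>, so the
  equation can be tested with \<open>u_t - u\<close>. The energy \<open>\<integral> H(\<nabla>u)^p / p\<close> is convex and scales by
  \<open>t^{n-p}\<close>; hence \<open>(t^{n-p} - 1) \<integral> H(\<nabla>u)^p / p - \<integral> f(u) (u_t - u) \<ge> 0\<close>, where
  \<open>f(u) = \<mu> u^{p-1} + u^{q-1}\<close> and \<open>q\<close> is the critical exponent. Dividing by \<open>1 - t\<close> and letting \<open>t\<close> tend to \<open>1\<close>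
  gives Pohozaev's inequality in the form \<open>\<mu> \<integral> u^p \<ge> 0\<close> (\<open>Pohozaev_inequality\<close>), with only
  first derivatives of \<open>u\<close> inside \<open>\<Omega>\<close>. This excludes \<open>\<mu> < 0\<close>.

  If \<open>\<mu> = 0\<close>, the inequality is an equality in the limit. On the layer \<open>\<Omega> - (t \<Omega>)\<close> the gradient of \<open>u_t\<close> vanishes,
  and what the convexity inequality loses there is \<open>(1 - 1/p) H(\<nabla>u)^p\<close>; so the energy of the layer
  is \<open>o(1 - t)\<close> (\<open>layer_energy\<close>). Near a point of the boundary farthest from \<open>a\<close> the rays from \<open>a\<close> are transversal
  to the boundary (\<open>boundary_cap\<close>), the layer has thickness comparable with \<open>1 - t\<close>, and therefore \<open>u\<close> has
  no flux through the boundary there (\<open>layer_flux\<close>): extended by zero, \<open>u\<close> is a supersolution across the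
  boundary that vanishes on an open set. The strong maximum principle forbids this. It is proved by testing with
  \<open>\<zeta> (u + \<epsilon>)^{1-p}\<close>, which bounds the gradient of \<open>ln (u + \<epsilon>)\<close> in \<open>L^p\<close> uniformly in \<open>\<epsilon>\<close>
  (\<open>log_gradient_estimate\<close>). As \<open>ln ((u + \<epsilon>) / \<epsilon>)\<close> has zero boundary values, its integral is bounded as
  well (\<open>log_integral_estimate\<close>), whereas it tends to infinity as \<open>\<epsilon> \<rightarrow> 0\<close> because \<open>u > 0\<close>.

  In the passage to the limit the boundary condition enters through the divergence theorem for \<open>u(x) (x - a)\<close>
  (\<open>W1p0_divergence\<close>). It implies that \<open>u\<close> has integral \<open>o(1 - t)\<close> over the layer (\<open>layer_integral_u\<close>), and from this follows the divergence theorem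
  for every \<open>Q(x) (x - a)\<close> with \<open>Q\<close> dominated by \<open>u\<close> (\<open>Euler_identity\<close>). The approximation of
  \<open>u\<close> by test functions shows that \<open>u_t\<close> and \<open>\<eta> G(u)\<close>, for a test function \<open>\<eta>\<close> and smooth \<open>G\<close>, are admissible
  (\<open>W1p0_shrink\<close>, \<open>W1p0_composition\<close>); and the weak gradient of \<open>u\<close> is its classical gradient
  (\<open>weak_gradient_eq_classical\<close>).
\<close>

section \<open>Functions of class \<open>C^k\<close>\<close>

lemma Ck_on_cong:
  assumes "open S" "\<And>x. x \<in> S \<Longrightarrow> f x = h x" "Ck_on k f S"
  shows "Ck_on k h S"
proof (cases k)
  case 0
  then show ?thesis using assms by (auto cong: continuous_on_cong)
next
  case (Suc j)
  then obtain g where g: "\<forall>x\<in>S. GDERIV f x :> g x" "\<forall>i. Ck_on j (\<lambda>x. g x $ i) S"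
    using assms(3) by auto
  have "GDERIV h x :> g x" if "x \<in> S" for x
    using g(1) that assms(1,2) unfolding gderiv_def
    by (blast intro: has_derivative_transform_within_open)
  then show ?thesis using Suc g by auto
qed

lemma GDERIV_gradient:
  assumes "GDERIV f x :> D" shows "GDERIV f x :> gradient f x"
  using assms gradient_eq by metis

lemma Ck_on_Suc_iff:
  assumes "open S"
  shows "Ck_on (Suc k) f S \<longleftrightarrow>
    (\<forall>x\<in>S. GDERIV f x :> gradient f x) \<and> (\<forall>i. Ck_on k (\<lambda>x. gradient f x $ i) S)"
proof
  assume "Ck_on (Suc k) f S"
  then obtain g where g: "\<forall>x\<in>S. GDERIV f x :> g x" "\<forall>i. Ck_on k (\<lambda>x. g x $ i) S"
    by auto
  have "Ck_on k (\<lambda>x. gradient f x $ i) S" for i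
    by (rule Ck_on_cong[OF assms _ g(2)[rule_format, of i]]) (use g(1) gradient_eq in metis)
  then show "(\<forall>x\<in>S. GDERIV f x :> gradient f x) \<and> (\<forall>i. Ck_on k (\<lambda>x. gradient f x $ i) S)"
    using g(1) GDERIV_gradient by blast
qed auto

lemma GDERIV_isCont: "GDERIV f x :> D \<Longrightarrow> isCont f x"
  unfolding gderiv_def by (rule has_derivative_continuous)

lemma Ck_on_SucD: "Ck_on (Suc k) f S \<Longrightarrow> Ck_on k f S"
proof (induction k arbitrary: f)
  case 0
  then obtain g where "\<forall>x\<in>S. GDERIV f x :> g x" by auto
  then have "\<forall>x\<in>S. isCont f x" using GDERIV_isCont by blast
  then show ?case by (simp add: continuous_at_imp_continuous_on)
next
  case (Suc k)
  then obtain g where g: "\<forall>x\<in>S. GDERIV f x :> g x" "\<And>i. Ck_on (Suc k) (\<lambda>x. g x $ i) S"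
    by (metis Ck_on.simps(2))
  have "\<And>i. Ck_on k (\<lambda>x. g x $ i) S" using Suc.IH g(2) by blast
  then show ?case using g(1) by auto
qed

lemma Ck_on_subset: "Ck_on k f S \<Longrightarrow> T \<subseteq> S \<Longrightarrow> Ck_on k f T"
proof (induction k arbitrary: f)
  case 0 then show ?case by (auto intro: continuous_on_subset)
next
  case (Suc k)
  then obtain g where g: "\<forall>x\<in>S. GDERIV f x :> g x" "\<And>i. Ck_on k (\<lambda>x. g x $ i) S"
    by (metis Ck_on.simps(2))
  have "\<And>i. Ck_on k (\<lambda>x. g x $ i) T" using Suc g(2) by blast
  then show ?case using g(1) Suc.prems(2) by auto
qed

lemma Ck_on_Un:
  assumes "open S" "open T"
  shows "Ck_on k f S \<Longrightarrow> Ck_on k f T \<Longrightarrow> Ck_on k f (S \<union> T)"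
proof (induction k arbitrary: f)
  case 0 then show ?case using assms by (auto intro: continuous_on_open_Un)
next
  case (Suc k)
  then show ?case
    unfolding Ck_on_Suc_iff[OF assms(1)] Ck_on_Suc_iff[OF assms(2)] Ck_on_Suc_iff[OF open_Un[OF assms]]
    by blast
qed

lemma Ck_on_const: "Ck_on k (\<lambda>x. c) S"
proof (induction k arbitrary: c)
  case (Suc k)
  have "\<forall>x\<in>S. GDERIV (\<lambda>x. c) x :> 0" by (simp add: GDERIV_const)
  moreover have "\<forall>i. Ck_on k (\<lambda>x. (0::real^'n) $ i) S" using Suc by simp
  ultimately show ?case unfolding Ck_on.simps by (intro exI[of _ "\<lambda>x. 0"]) blast
qed simp

lemma Ck_on_add: "Ck_on k f S \<Longrightarrow> Ck_on k h S \<Longrightarrow> Ck_on k (\<lambda>x. f x + h x) S"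
proof (induction k arbitrary: f h)
  case 0 then show ?case by (auto intro: continuous_intros)
next
  case (Suc k)
  obtain g1 g2 where g: "\<forall>x\<in>S. GDERIV f x :> g1 x" "\<And>i. Ck_on k (\<lambda>x. g1 x $ i) S"
     "\<forall>x\<in>S. GDERIV h x :> g2 x" "\<And>i. Ck_on k (\<lambda>x. g2 x $ i) S"
    using Suc.prems by (metis Ck_on.simps(2))
  have "\<forall>x\<in>S. GDERIV (\<lambda>x. f x + h x) x :> g1 x + g2 x" using g by (simp add: GDERIV_add)
  moreover have "\<And>i. Ck_on k (\<lambda>x. (g1 x + g2 x) $ i) S"
    using Suc.IH[OF g(2,4)] by simp
  ultimately show ?case by auto
qed

lemma Ck_on_mult: "Ck_on k f S \<Longrightarrow> Ck_on k h S \<Longrightarrow> Ck_on k (\<lambda>x. f x * h x) S"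
proof (induction k arbitrary: f h)
  case 0 then show ?case by (auto intro: continuous_intros)
next
  case (Suc k)
  obtain g1 g2 where g: "\<forall>x\<in>S. GDERIV f x :> g1 x" "\<And>i. Ck_on k (\<lambda>x. g1 x $ i) S"
     "\<forall>x\<in>S. GDERIV h x :> g2 x" "\<And>i. Ck_on k (\<lambda>x. g2 x $ i) S"
    using Suc.prems by (metis Ck_on.simps(2))
  have "\<forall>x\<in>S. GDERIV (\<lambda>x. f x * h x) x :> f x *\<^sub>R g2 x + h x *\<^sub>R g1 x"
    using g by (simp add: GDERIV_mult)
  moreover have "\<And>i. Ck_on k (\<lambda>x. (f x *\<^sub>R g2 x + h x *\<^sub>R g1 x) $ i) S"
    using Ck_on_add[OF Suc.IH[OF Ck_on_SucD[OF Suc.prems(1)] g(4)]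
        Suc.IH[OF Ck_on_SucD[OF Suc.prems(2)] g(2)]] by simp
  ultimately show ?case
    unfolding Ck_on.simps by (intro exI[of _ "\<lambda>x. f x *\<^sub>R g2 x + h x *\<^sub>R g1 x"]) blast
qed

lemma Ck_on_prod:
  assumes "finite I" "\<And>i. i \<in> I \<Longrightarrow> Ck_on k (f i) S"
  shows "Ck_on k (\<lambda>x. \<Prod>i\<in>I. f i x) S"
  using assms by (induction I rule: finite_induct) (auto intro: Ck_on_const Ck_on_mult)

lemma Ck_on_inner: "Ck_on k (\<lambda>x. x \<bullet> b) S"
proof (cases k)
  case 0 then show ?thesis by (auto intro: continuous_intros)
next
  case (Suc j)
  have "\<forall>x\<in>S. GDERIV (\<lambda>x. x \<bullet> b) x :> b"
    unfolding gderiv_def by (auto intro!: derivative_eq_intros)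
  moreover have "\<forall>i. Ck_on j (\<lambda>x. b $ i) S" by (simp add: Ck_on_const)
  ultimately show ?thesis unfolding Suc Ck_on.simps by (intro exI[of _ "\<lambda>x. b"]) blast
qed

text \<open>The derivatives form a sequence, because the inductive proof of the chain rule needs all of them
  at once.\<close>

definition infinitely_differentiable_on :: "real set \<Rightarrow> (real \<Rightarrow> real) \<Rightarrow> bool" where
  "infinitely_differentiable_on T h \<longleftrightarrow>
    (\<exists>D. D 0 = h \<and> (\<forall>j. \<forall>s\<in>T. (D j has_real_derivative D (Suc j) s) (at s)))"

lemma Ck_on_compose:
  assumes h: "infinitely_differentiable_on T h" and f: "Ck_on k f S" and T: "f ` S \<subseteq> T"
  shows "Ck_on k (\<lambda>x. h (f x)) S"
proof -
  obtain D where D: "D 0 = h" "\<And>j s. s \<in> T \<Longrightarrow> (D j has_real_derivative D (Suc j) s) (at s)"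
    using h unfolding infinitely_differentiable_on_def by blast
  have "Ck_on k (\<lambda>x. D j (f x)) S" for j
    using f
  proof (induction k arbitrary: j)
    case 0
    have "continuous_on T (D j)"
      by (intro continuous_at_imp_continuous_on ballI) (use D(2) DERIV_isCont in blast)
    then show ?case using 0 T by (auto intro: continuous_on_compose2)
  next
    case (Suc k)
    obtain g where g: "\<forall>x\<in>S. GDERIV f x :> g x" "\<And>i. Ck_on k (\<lambda>x. g x $ i) S"
      using Suc.prems by (metis Ck_on.simps(2))
    have "\<forall>x\<in>S. GDERIV (\<lambda>x. D j (f x)) x :> D (Suc j) (f x) *\<^sub>R g x"
      using GDERIV_DERIV_compose[OF bspec[OF g(1)] D(2)] T by blast
    moreover have "\<And>i. Ck_on k (\<lambda>x. (D (Suc j) (f x) *\<^sub>R g x) $ i) S"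
      using Ck_on_mult[OF Suc.IH[OF Ck_on_SucD[OF Suc.prems]] g(2)] by simp
    ultimately show ?case unfolding Ck_on.simps
      by (intro exI[of _ "\<lambda>x. D (Suc j) (f x) *\<^sub>R g x"]) blast
  qed
  from this[of 0] show ?thesis using D(1) by simp
qed

lemma GDERIV_affine:
  assumes "GDERIV f (c + s *\<^sub>R x) :> D"
  shows "GDERIV (\<lambda>x. f (c + s *\<^sub>R x)) x :> s *\<^sub>R D"
proof -
  have "((\<lambda>x. c + s *\<^sub>R x) has_derivative (\<lambda>h. s *\<^sub>R h)) (at x)"
    by (auto intro!: derivative_eq_intros)
  from has_derivative_compose[OF this assms[unfolded gderiv_def]]
  show ?thesis unfolding gderiv_def by (simp add: inner_commute)
qed

lemma Ck_on_affine: "Ck_on k f UNIV \<Longrightarrow> Ck_on k (\<lambda>x. f (c + s *\<^sub>R x)) UNIV"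
proof (induction k arbitrary: f)
  case 0 then show ?case by (auto intro!: continuous_intros intro: continuous_on_compose2)
next
  case (Suc k)
  obtain g where g: "\<forall>x. GDERIV f x :> g x" "\<And>i. Ck_on k (\<lambda>x. g x $ i) UNIV"
    using Suc.prems by (metis Ck_on.simps(2) UNIV_I)
  have "\<forall>x\<in>UNIV. GDERIV (\<lambda>x. f (c + s *\<^sub>R x)) x :> s *\<^sub>R g (c + s *\<^sub>R x)"
    using g(1) GDERIV_affine by blast
  moreover have "\<And>i. Ck_on k (\<lambda>x. (s *\<^sub>R g (c + s *\<^sub>R x)) $ i) UNIV"
    using Ck_on_mult[OF Ck_on_const Suc.IH[OF g(2)]] by simp
  ultimately show ?case unfolding Ck_on.simps
    by (intro exI[of _ "\<lambda>x. s *\<^sub>R g (c + s *\<^sub>R x)"]) blast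
qed

lemma infinitely_differentiable_powr: "infinitely_differentiable_on {0<..} (\<lambda>s. s powr r)"
proof -
  define D where "D j s = (\<Prod>i<j. r - real i) * s powr (r - real j)" for j and s :: real
  have "D 0 = (\<lambda>s. s powr r)" by (auto simp: D_def)
  moreover have "(D j has_real_derivative D (Suc j) s) (at s)" if "s \<in> {0<..}" for j s
    unfolding D_def using that
    by (auto intro!: derivative_eq_intros simp: algebra_simps)
  ultimately show ?thesis unfolding infinitely_differentiable_on_def by blast
qed

section \<open>A smooth bump and a smooth step\<close>

text \<open>The derivatives of \<open>exp (- 1 / s)\<close> all have this form, and the form is stable under
  differentiation.\<close>

definition flat :: "real poly \<Rightarrow> real \<Rightarrow> real" where
  "flat P s = (if s > 0 then poly P (1 / s) * exp (- 1 / s) else 0)"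

lemma flat_quotient_tendsto: "((\<lambda>s. flat P s / s) \<longlongrightarrow> 0) (at_right 0)"
proof -
  have *: "((\<lambda>y. poly Q y / exp y) \<longlongrightarrow> 0) at_top" for Q :: "real poly"
    unfolding poly_altdef sum_divide_distrib
    by (rule tendsto_null_sum) (use tendsto_mult_right_zero[OF tendsto_power_div_exp_0] in simp)
  have "((\<lambda>s. poly (pCons 0 P) (inverse s) / exp (inverse s)) \<longlongrightarrow> 0) (at_right (0::real))"
    by (rule filterlim_compose[OF * filterlim_inverse_at_top_right])
  then show ?thesis
  proof (rule Lim_transform_eventually)
    show "\<forall>\<^sub>F s in at_right 0. poly (pCons 0 P) (inverse s) / exp (inverse s) = flat P s / s"
      using eventually_at_right_less[of 0]
      by eventually_elim (simp add: flat_def exp_minus divide_simps)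
  qed
qed

lemma DERIV_flat: "(flat P has_real_derivative flat ([:0, 0, 1:] * (P - pderiv P)) s) (at s)"
proof -
  consider "s > 0" | "s < 0" | "s = 0" by linarith
  then show ?thesis
  proof cases
    case 1
    have "((\<lambda>s. poly P (1 / s) * exp (- 1 / s)) has_real_derivative
        flat ([:0, 0, 1:] * (P - pderiv P)) s) (at s)"
      using 1 by (auto intro!: derivative_eq_intros DERIV_chain2[OF poly_DERIV]
          simp: flat_def field_simps power2_eq_square)
    then show ?thesis
      by (rule has_field_derivative_transform_within_open[of _ _ _ "{0<..}"]) (use 1 in \<open>auto simp: flat_def\<close>)
  next
    case 2
    have "((\<lambda>s. 0) has_real_derivative flat ([:0, 0, 1:] * (P - pderiv P)) s) (at s)"
      using 2 by (simp add: flat_def)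
    then show ?thesis
      by (rule has_field_derivative_transform_within_open[of _ _ _ "{..<0}"]) (use 2 in \<open>auto simp: flat_def\<close>)
  next
    case 3
    have "((\<lambda>s. flat P s / s) \<longlongrightarrow> 0) (at_left 0)"
      by (rule Lim_transform_eventually[OF tendsto_const])
        (auto simp: eventually_at_filter flat_def)
    then have "((\<lambda>s. flat P s / s) \<longlongrightarrow> 0) (at 0)"
      using flat_quotient_tendsto filterlim_split_at by blast
    then show ?thesis using 3 by (simp add: DERIV_def flat_def)
  qed
qed

definition bump :: "real \<Rightarrow> real" where
  "bump s = (if s > 0 then exp (- 1 / s) else 0)"

definition bump_deriv :: "real \<Rightarrow> real" where
  "bump_deriv s = (if s > 0 then exp (- 1 / s) / s\<^sup>2 else 0)"

lemma infinitely_differentiable_bump: "infinitely_differentiable_on UNIV bump"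
proof -
  define D where "D j = flat (((\<lambda>P. [:0, 0, 1:] * (P - pderiv P)) ^^ j) 1)" for j
  have "D 0 = bump" by (auto simp: D_def flat_def bump_def)
  moreover have "(D j has_real_derivative D (Suc j) s) (at s)" for j s
    unfolding D_def using DERIV_flat by simp
  ultimately show ?thesis unfolding infinitely_differentiable_on_def by blast
qed

lemma DERIV_bump: "(bump has_real_derivative bump_deriv s) (at s)"
proof -
  have "bump = flat 1" by (auto simp: bump_def flat_def)
  moreover have "bump_deriv s = flat ([:0, 0, 1:] * (1 - pderiv 1)) s"
    by (auto simp: bump_deriv_def flat_def power2_eq_square divide_simps)
  ultimately show ?thesis using DERIV_flat[of 1 s] by (simp only:)
qed

lemma bump_bounds: "0 \<le> bump s" "bump s \<le> 1" "0 \<le> bump_deriv s"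
  and bump_pos_iff: "0 < bump s \<longleftrightarrow> 0 < s"
  by (auto simp: bump_def bump_deriv_def)

text \<open>A cutoff of this kind can be absorbed by Young's inequality with exponent \<open>p\<close>, like the \<open>p\<close>-th
  power of a Lipschitz function. With \<open>y = 1 / s\<close> the claim reads \<open>y\<^sup>2 exp (- y / p) \<le> 2 p\<^sup>2\<close>.\<close>

lemma bump_deriv_le:
  assumes "p \<ge> 1"
  shows "bump_deriv s \<le> 2 * p\<^sup>2 * bump s powr (1 - 1 / p)"
proof (cases "s > 0")
  case True
  define y where "y = 1 / s"
  have y: "y > 0" using True by (simp add: y_def)
  have "1 + y / p + (y / p)\<^sup>2 / 2 \<le> exp (y / p)"
    using exp_lower_Taylor_quadratic[of "y / p"] y assms by simp
  moreover have "0 \<le> y / p" using y assms by simp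
  ultimately have "(y / p)\<^sup>2 / 2 \<le> exp (y / p)" by linarith
  then have "y\<^sup>2 \<le> 2 * p\<^sup>2 * exp (y / p)"
    using assms by (simp add: power_divide field_simps)
  then have "y\<^sup>2 * exp (- y) \<le> 2 * p\<^sup>2 * (exp (y / p) * exp (- y))"
    using mult_right_mono[of "y\<^sup>2" _ "exp (- y)"] by (simp add: mult.assoc)
  also have "exp (y / p) * exp (- y) = bump s powr (1 - 1 / p)"
    using True by (simp add: bump_def powr_def y_def exp_add[symmetric] algebra_simps)
  finally show ?thesis using True by (simp add: bump_deriv_def y_def power_divide)
qed (simp add: bump_def bump_deriv_def)

lemma bump_deriv_le_2: "bump_deriv s \<le> 2"
  using bump_deriv_le[of 1 s] by (auto split: if_splits)

text \<open>A smooth transition from \<open>0\<close> on \<open>(-\<infinity>, 1]\<close> to \<open>1\<close> on \<open>[2, \<infinity>)\<close>: the inner bump is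
  \<open>0\<close> for \<open>s \<ge> 2\<close> and at least \<open>exp (- 1)\<close> for \<open>s \<le> 1\<close>, which the outer one turns into
  \<open>exp (- 1)\<close> and \<open>0\<close>.\<close>

definition step :: "real \<Rightarrow> real" where
  "step s = exp 1 * bump (1 - exp 1 * bump (2 - s))"

definition step_deriv :: "real \<Rightarrow> real" where
  "step_deriv s = exp 1 * exp 1 * bump_deriv (1 - exp 1 * bump (2 - s)) * bump_deriv (2 - s)"

lemma DERIV_step: "(step has_real_derivative step_deriv s) (at s)"
  unfolding step_def[abs_def] step_deriv_def
  by (auto intro!: derivative_eq_intros DERIV_chain2[OF DERIV_bump])

lemma step_deriv_bounds: "\<bar>step_deriv s\<bar> \<le> 4 * exp 2" and step_deriv_zero: "s \<ge> 2 \<Longrightarrow> step_deriv s = 0"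
proof -
  let ?a = "bump_deriv (1 - exp 1 * bump (2 - s))" and ?b = "bump_deriv (2 - s)"
  have "?a * ?b \<le> 2 * 2"
    by (intro mult_mono bump_deriv_le_2 bump_bounds) auto
  moreover have "0 \<le> ?a * ?b" by (simp add: bump_bounds)
  moreover have "step_deriv s = exp 2 * (?a * ?b)"
    by (simp add: step_deriv_def exp_add[symmetric])
  ultimately show "\<bar>step_deriv s\<bar> \<le> 4 * exp 2" by (simp add: abs_mult)
qed (simp add: step_deriv_def bump_deriv_def)

lemma step_eq_0: "s \<le> 1 \<Longrightarrow> step s = 0"
proof -
  assume "s \<le> 1"
  then have "exp (-1) \<le> bump (2 - s)" by (auto simp: bump_def field_simps)
  then have "exp 1 * exp (-1) \<le> exp 1 * bump (2 - s)" by (intro mult_left_mono) auto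
  then have "1 \<le> exp 1 * bump (2 - s)" by (simp add: exp_minus)
  then show ?thesis by (simp add: step_def bump_def)
qed

lemma step_eq_1: "s \<ge> 2 \<Longrightarrow> step s = 1"
  by (simp add: step_def bump_def exp_minus)

lemma step_bounds: "0 \<le> step s" "step s \<le> 1"
proof -
  have "bump (1 - exp 1 * bump (2 - s)) \<le> exp (-1)"
  proof -
    let ?r = "1 - exp 1 * bump (2 - s)"
    have "?r \<le> 1" using bump_bounds[of "2 - s"] by simp
    then show ?thesis by (auto simp: bump_def field_simps)
  qed
  then have "exp 1 * bump (1 - exp 1 * bump (2 - s)) \<le> exp 1 * exp (-1)" by (intro mult_left_mono) auto
  then show "step s \<le> 1" by (simp add: step_def exp_minus)
qed (simp add: step_def bump_bounds)

lemma Ck_on_step: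
  assumes "Ck_on k f S" shows "Ck_on k (\<lambda>x. step (f x)) S"
proof -
  have 1: "Ck_on k (\<lambda>x. bump (2 + (-1) * f x)) S"
    by (rule Ck_on_compose[OF infinitely_differentiable_bump Ck_on_add[OF Ck_on_const Ck_on_mult[OF Ck_on_const assms]]]) auto
  have 2: "Ck_on k (\<lambda>x. bump (1 + (- exp 1) * bump (2 + (-1) * f x))) S"
    by (rule Ck_on_compose[OF infinitely_differentiable_bump Ck_on_add[OF Ck_on_const Ck_on_mult[OF Ck_on_const 1]]]) auto
  show ?thesis using Ck_on_mult[OF Ck_on_const[of k "exp 1"] 2] by (simp add: step_def)
qed

section \<open>Lebesgue integrals and test functions\<close>

lemma measurable_lebesgue_homothety:
  fixes c :: "'a::euclidean_space"
  assumes "s \<noteq> 0"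
  shows "(\<lambda>x. c + s *\<^sub>R x) \<in> lebesgue \<rightarrow>\<^sub>M lebesgue"
  using lebesgue_affine_measurable[of "\<lambda>_. s" c] assms
  unfolding scaleR_scaleR[symmetric] scaleR_sum_right[symmetric] euclidean_representation by simp

lemma lebesgue_homothety:
  fixes c :: "'a::euclidean_space"
  assumes "s \<noteq> 0"
  shows "lebesgue = density (distr lebesgue lebesgue (\<lambda>x. c + s *\<^sub>R x)) (\<lambda>_. ennreal (\<bar>s\<bar> ^ DIM('a)))"
  using lebesgue_affine_euclidean[of "\<lambda>_. s" c] assms
  unfolding scaleR_scaleR[symmetric] scaleR_sum_right[symmetric] euclidean_representation prod_constant by simp

lemma integral_lebesgue_homothety:
  fixes c :: "'a::euclidean_space" and f :: "'a \<Rightarrow> real"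
  assumes "s > 0" and f: "f \<in> borel_measurable lebesgue"
  shows "(\<integral>x. f (c + s *\<^sub>R x) \<partial>lebesgue) = (\<integral>x. f x \<partial>lebesgue) / s ^ DIM('a)"
proof -
  have m: "(\<lambda>x. c + s *\<^sub>R x) \<in> lebesgue \<rightarrow>\<^sub>M lebesgue"
    using measurable_lebesgue_homothety[of s c] assms by simp
  have "(\<integral>x. f x \<partial>lebesgue) =
      (\<integral>x. f x \<partial>density (distr lebesgue lebesgue (\<lambda>x. c + s *\<^sub>R x)) (\<lambda>_. ennreal (\<bar>s\<bar> ^ DIM('a))))"
    using lebesgue_homothety[of s c] assms by simp
  also have "\<dots> = (\<integral>x. \<bar>s\<bar> ^ DIM('a) * f x \<partial>distr lebesgue lebesgue (\<lambda>x. c + s *\<^sub>R x))"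
    by (subst integral_density) (use f in auto)
  also have "\<dots> = (\<integral>x. \<bar>s\<bar> ^ DIM('a) * f (c + s *\<^sub>R x) \<partial>lebesgue)"
    using m f by (subst integral_distr) auto
  finally show ?thesis using assms by (simp add: field_simps)
qed

lemma integrable_lebesgue_homothety:
  fixes c :: "'a::euclidean_space" and f :: "'a \<Rightarrow> real"
  assumes "s > 0" and f: "integrable lebesgue f"
  shows "integrable lebesgue (\<lambda>x. f (c + s *\<^sub>R x))"
proof -
  have m: "(\<lambda>x. c + s *\<^sub>R x) \<in> lebesgue \<rightarrow>\<^sub>M lebesgue"
    using measurable_lebesgue_homothety[of s c] assms by simp
  have fm: "f \<in> borel_measurable lebesgue" using f by auto
  have "integrable (density (distr lebesgue lebesgue (\<lambda>x. c + s *\<^sub>R x)) (\<lambda>_. ennreal (\<bar>s\<bar> ^ DIM('a)))) f"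
    using lebesgue_homothety[of s c] assms by simp
  then have "integrable (distr lebesgue lebesgue (\<lambda>x. c + s *\<^sub>R x)) (\<lambda>x. \<bar>s\<bar> ^ DIM('a) * f x)"
    by (subst (asm) integrable_density) (use fm in auto)
  then have "integrable lebesgue (\<lambda>x. \<bar>s\<bar> ^ DIM('a) * f (c + s *\<^sub>R x))"
    using m fm by (subst (asm) integrable_distr_eq) auto
  then show ?thesis using assms by simp
qed

lemma GDERIV_zero_outside:
  assumes "closed K" "\<And>x. x \<notin> K \<Longrightarrow> f x = 0" "x \<notin> K"
  shows "GDERIV f x :> 0"
proof -
  have "GDERIV (\<lambda>x. 0) x :> 0" by (simp add: GDERIV_const)
  then show ?thesis unfolding gderiv_def
    by (rule has_derivative_transform_within_open[OF _ open_Compl[OF assms(1)]]) (use assms in auto)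
qed

lemma GDERIV_transform:
  assumes "GDERIV f x :> D" "open S" "x \<in> S" "\<And>y. y \<in> S \<Longrightarrow> f y = h y"
  shows "GDERIV h x :> D"
  using assms unfolding gderiv_def by (rule has_derivative_transform_within_open)

lemma GDERIV_Lipschitz:
  fixes f :: "'a::real_inner \<Rightarrow> real"
  assumes "convex S" "\<And>x. x \<in> S \<Longrightarrow> GDERIV f x :> g x" "\<And>x. x \<in> S \<Longrightarrow> norm (g x) \<le> B" "x \<in> S" "y \<in> S"
  shows "\<bar>f x - f y\<bar> \<le> B * norm (x - y)"
proof -
  have d: "(f has_derivative (\<lambda>h. h \<bullet> g x)) (at x within S)" if "x \<in> S" for x
    using assms(2)[OF that] unfolding gderiv_def by (rule has_derivative_at_withinI)
  have "onorm (\<lambda>h. h \<bullet> g x) \<le> B" if "x \<in> S" for x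
  proof (rule onorm_bound)
    show "0 \<le> B" using assms(3)[OF that] norm_ge_zero order_trans by blast
    fix h show "norm (h \<bullet> g x) \<le> B * norm h"
      using Cauchy_Schwarz_ineq2[of h "g x"] mult_left_mono[OF assms(3)[OF that] norm_ge_zero[of h]]
      by (simp add: mult.commute)
  qed
  from differentiable_bound[OF assms(1) d this assms(4,5)] show ?thesis by simp
qed

lemma bounded_continuous_vanishing:
  fixes f :: "'a::topological_space \<Rightarrow> 'b::real_normed_vector"
  assumes "continuous_on K f" "compact K" "\<And>x. x \<notin> K \<Longrightarrow> f x = 0"
  obtains B where "B \<ge> 0" "\<And>x. norm (f x) \<le> B"
proof -
  have "bounded (f ` K)" using assms compact_continuous_image compact_imp_bounded by blast
  then obtain B where "B > 0" "\<And>x. x \<in> K \<Longrightarrow> norm (f x) \<le> B" by (auto simp: bounded_pos)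
  then have "norm (f x) \<le> B" for x using assms(3) by (cases "x \<in> K") auto
  then show ?thesis using \<open>B > 0\<close> that[of B] by auto
qed

lemma GDERIV_directional_limit:
  assumes "GDERIV v x :> D"
  shows "(\<lambda>k. real (Suc k) * (v (x + (1 / real (Suc k)) *\<^sub>R e) - v x)) \<longlonglongrightarrow> e \<bullet> D"
proof -
  have "((\<lambda>t. x + t *\<^sub>R e) has_derivative (\<lambda>t. t *\<^sub>R e)) (at 0)"
    by (auto intro!: derivative_eq_intros)
  then have "((\<lambda>t. v (x + t *\<^sub>R e)) has_derivative (\<lambda>t. (t *\<^sub>R e) \<bullet> D)) (at 0)"
    using has_derivative_compose[of "\<lambda>t. x + t *\<^sub>R e" "\<lambda>t. t *\<^sub>R e" 0 UNIV v "\<lambda>h. h \<bullet> D"] assms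
    unfolding gderiv_def by simp
  then have "((\<lambda>t. v (x + t *\<^sub>R e)) has_real_derivative (e \<bullet> D)) (at 0)"
    by (simp add: has_field_derivative_def mult.commute[of _ "e \<bullet> D"])
  then have "((\<lambda>h. (v (x + h *\<^sub>R e) - v x) / h) \<longlongrightarrow> e \<bullet> D) (at 0)"
    by (simp add: DERIV_def)
  moreover have "filterlim (\<lambda>k. 1 / real (Suc k)) (at 0) sequentially"
    unfolding filterlim_at
    using LIMSEQ_inverse_real_of_nat by (auto simp: divide_inverse simp del: of_nat_Suc)
  ultimately have "(\<lambda>k. (v (x + (1 / real (Suc k)) *\<^sub>R e) - v x) / (1 / real (Suc k))) \<longlonglongrightarrow> e \<bullet> D"
    by (rule filterlim_compose)
  then show ?thesis by (simp add: mult.commute)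
qed

lemma borel_measurable_lebesgue_continuous:
  "continuous_on UNIV f \<Longrightarrow> f \<in> borel_measurable lebesgue"
  by (intro measurable_completion) (simp add: borel_measurable_continuous_onI)

text \<open>The integral of a translate does not depend on the translation; the difference quotients of
  \<open>v\<close> are dominated because \<open>v\<close> is Lipschitz with compact support.\<close>

lemma integral_partial_derivative_eq_0:
  fixes v :: "real^'n \<Rightarrow> real"
  assumes v: "\<And>x. GDERIV v x :> w x" and w: "continuous_on UNIV w"
    and K: "compact K" "\<And>x. x \<notin> K \<Longrightarrow> v x = 0"
  shows "(\<integral>x. w x $ i \<partial>lebesgue) = 0"
proof -
  define e :: "real^'n" where "e = axis i 1"
  have w0: "w x = 0" if "x \<notin> K" for x
    using gradient_eq[OF GDERIV_zero_outside[OF compact_imp_closed[OF K(1)] K(2) that]] gradient_eq[OF v[of x]]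
    by simp
  obtain B where B: "B \<ge> 0" "\<And>x. norm (w x) \<le> B"
    using bounded_continuous_vanishing[OF continuous_on_subset[OF w subset_UNIV] K(1) w0] by blast
  have lip: "\<bar>v x - v y\<bar> \<le> B * norm (x - y)" for x y
    using GDERIV_Lipschitz[of UNIV v w B] v B by simp
  have vc: "continuous_on UNIV v"
    using v GDERIV_isCont continuous_at_imp_continuous_on by blast
  then have vm: "v \<in> borel_measurable lborel" by (simp add: borel_measurable_continuous_onI)
  define K' where "K' = {x - y | x y. x \<in> K \<and> y \<in> cball 0 1}"
  have K': "compact K'" unfolding K'_def by (rule compact_differences[OF K(1)]) simp
  have KK': "K \<subseteq> K'" unfolding K'_def by force
  define q where "q k x = real (Suc k) * (v (x + (1 / real (Suc k)) *\<^sub>R e) - v x)" for k x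
  have vi: "integrable lebesgue v"
  proof -
    have "integrable lborel (\<lambda>x. indicator K x *\<^sub>R v x)"
      by (rule borel_integrable_compact[OF K(1) continuous_on_subset[OF vc subset_UNIV]])
    also have "(\<lambda>x. indicator K x *\<^sub>R v x) = v" using K(2) by (intro ext) (auto simp: indicator_def)
    finally show ?thesis using vm by (subst integrable_completion) auto
  qed
  have q0: "(\<integral>x. q k x \<partial>lebesgue) = 0" for k
  proof -
    let ?c = "(1 / real (Suc k)) *\<^sub>R e"
    have "integrable lebesgue (\<lambda>x. v (?c + 1 *\<^sub>R x))" "(\<integral>x. v (?c + 1 *\<^sub>R x) \<partial>lebesgue) = (\<integral>x. v x \<partial>lebesgue)"
      using integrable_lebesgue_homothety[OF _ vi, of 1 ?c] integral_lebesgue_homothety[of 1 v ?c] vi by auto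
    then show ?thesis using vi unfolding q_def by (simp add: add.commute)
  qed
  have "(\<lambda>k. \<integral>x. q k x \<partial>lebesgue) \<longlonglongrightarrow> (\<integral>x. w x $ i \<partial>lebesgue)"
  proof (rule integral_dominated_convergence[where w="\<lambda>x. B * indicator K' x"])
    have "w x $ i = w x \<bullet> e" for x by (simp add: e_def inner_axis)
    then have "continuous_on UNIV (\<lambda>x. w x $ i)" using w by (auto intro!: continuous_intros)
    then show "(\<lambda>x. w x $ i) \<in> borel_measurable lebesgue"
      by (rule borel_measurable_lebesgue_continuous)
    have "continuous_on UNIV (q k)" for k
      unfolding q_def by (intro continuous_intros continuous_on_compose2[OF vc]) auto
    then show "q k \<in> borel_measurable lebesgue" for k
      by (rule borel_measurable_lebesgue_continuous)
    have "emeasure lebesgue K' < \<infinity>" using fmeasurableD2[OF lmeasurable_compact[OF K']] by (auto simp: top.not_eq_extremum)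
    then show "integrable lebesgue (\<lambda>x. B * indicator K' x)"
      using K' by (intro integrable_mult_right integrable_real_indicator) (auto simp: compact_imp_closed)
    show "AE x in lebesgue. (\<lambda>k. q k x) \<longlonglongrightarrow> w x $ i"
      using GDERIV_directional_limit[OF v, of _ e] unfolding q_def
      by (auto simp: e_def inner_axis inner_commute)
    show "AE x in lebesgue. norm (q k x) \<le> B * indicator K' x" for k
    proof (intro AE_I2)
      fix x
      show "norm (q k x) \<le> B * indicator K' x"
      proof (cases "x \<in> K'")
        case True
        have "\<bar>v (x + (1 / real (Suc k)) *\<^sub>R e) - v x\<bar> \<le> B * norm ((1 / real (Suc k)) *\<^sub>R e)"
          using lip[of "x + (1 / real (Suc k)) *\<^sub>R e" x] by simp
        also have "norm ((1 / real (Suc k)) *\<^sub>R e) = 1 / real (Suc k)" by (simp add: e_def)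
        finally have "real (Suc k) * \<bar>v (x + (1 / real (Suc k)) *\<^sub>R e) - v x\<bar>
            \<le> real (Suc k) * (B * (1 / real (Suc k)))" by (intro mult_left_mono) auto
        then show ?thesis using True by (simp add: q_def abs_mult)
      next
        case False
        then have "v x = 0" using KK' K(2) by blast
        moreover have "x + (1 / real (Suc k)) *\<^sub>R e \<notin> K"
        proof
          assume *: "x + (1 / real (Suc k)) *\<^sub>R e \<in> K"
          have "x = (x + (1 / real (Suc k)) *\<^sub>R e) - (1 / real (Suc k)) *\<^sub>R e" by simp
          moreover have "(1 / real (Suc k)) *\<^sub>R e \<in> cball 0 1" by (simp add: e_def)
          ultimately show False using * False unfolding K'_def by blast
        qed
        ultimately show ?thesis using K(2) False by (simp add: q_def)
      qed
    qed
  qed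
  then have "(\<lambda>k::nat. 0::real) \<longlonglongrightarrow> (\<integral>x. w x $ i \<partial>lebesgue)" by (simp only: q0)
  then show ?thesis using LIMSEQ_unique[OF tendsto_const[of 0]] by metis
qed

lemma smooth_on_D: "smooth_on f S \<Longrightarrow> Ck_on k f S"
  by (simp add: smooth_on_def)

lemma smooth_on_GDERIV:
  assumes "smooth_on f S" "x \<in> S" shows "GDERIV f x :> gradient f x"
  using smooth_on_D[OF assms(1), of 1] assms(2) GDERIV_gradient by auto

lemma continuous_on_gradient:
  assumes "open S" "Ck_on (Suc k) f S" shows "continuous_on S (gradient f)"
proof -
  have "Ck_on 0 (\<lambda>x. gradient f x $ i) S" for i
  proof -
    have "Ck_on k (\<lambda>x. gradient f x $ i) S" using assms Ck_on_Suc_iff by blast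
    then show ?thesis by (induction k) (blast dest: Ck_on_SucD)+
  qed
  then have "continuous_on S (\<lambda>x. \<chi> i. gradient f x $ i)"
    by (intro continuous_on_vec_lambda) auto
  then show ?thesis by simp
qed

lemma test_functionE:
  assumes "test_function \<Omega> \<phi>"
  obtains K where "compact K" "K \<subseteq> \<Omega>" "\<And>x. x \<notin> K \<Longrightarrow> \<phi> x = 0"
    "\<And>x. x \<notin> K \<Longrightarrow> gradient \<phi> x = 0" "\<And>x. GDERIV \<phi> x :> gradient \<phi> x"
    "continuous_on UNIV \<phi>" "continuous_on UNIV (gradient \<phi>)"
proof
  let ?K = "closure {x. \<phi> x \<noteq> 0}"
  show "compact ?K" "?K \<subseteq> \<Omega>" using assms by (auto simp: test_function_def)
  show z: "\<phi> x = 0" if "x \<notin> ?K" for x using that closure_subset[of "{x. \<phi> x \<noteq> 0}"] by blast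
  show g: "GDERIV \<phi> x :> gradient \<phi> x" for x
    using assms smooth_on_GDERIV unfolding test_function_def by blast
  show "gradient \<phi> x = 0" if "x \<notin> ?K" for x
    by (rule gradient_eq) (rule GDERIV_zero_outside[of ?K, OF _ z that], simp_all)
  show "continuous_on UNIV \<phi>"
    using GDERIV_isCont[OF g] by (simp add: continuous_at_imp_continuous_on)
  show "continuous_on UNIV (gradient \<phi>)"
    using continuous_on_gradient[OF open_UNIV smooth_on_D] assms unfolding test_function_def by blast
qed

lemma test_function_bounded:
  assumes "test_function \<Omega> \<phi>"
  obtains B where "B \<ge> 0" "\<And>x. \<bar>\<phi> x\<bar> \<le> B" "\<And>x. norm (gradient \<phi> x) \<le> B"
proof -
  obtain K where K: "compact K" "K \<subseteq> \<Omega>" "\<And>x. x \<notin> K \<Longrightarrow> \<phi> x = 0"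
    "\<And>x. x \<notin> K \<Longrightarrow> gradient \<phi> x = 0" "\<And>x. GDERIV \<phi> x :> gradient \<phi> x"
    "continuous_on UNIV \<phi>" "continuous_on UNIV (gradient \<phi>)"
    by (rule test_functionE[OF assms]) (rule that)
  obtain B1 where "B1 \<ge> 0" "\<And>x. norm (\<phi> x) \<le> B1"
    using bounded_continuous_vanishing[OF continuous_on_subset[OF K(6) subset_UNIV] K(1,3)] by blast
  moreover obtain B2 where "B2 \<ge> 0" "\<And>x. norm (gradient \<phi> x) \<le> B2"
    using bounded_continuous_vanishing[OF continuous_on_subset[OF K(7) subset_UNIV] K(1,4)] by blast
  ultimately show ?thesis using that[of "max B1 B2"] by (simp add: le_max_iff_disj)
qed

lemma test_functionI:
  assumes "smooth_on \<phi> UNIV" "compact K" "K \<subseteq> \<Omega>" "\<And>x. x \<notin> K \<Longrightarrow> \<phi> x = 0"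
  shows "test_function \<Omega> \<phi>"
proof -
  have "closure {x. \<phi> x \<noteq> 0} \<subseteq> K"
    using assms(4) by (intro closure_minimal compact_imp_closed[OF assms(2)]) blast
  moreover from this have "compact (closure {x. \<phi> x \<noteq> 0})"
    using bounded_subset[OF compact_imp_bounded[OF assms(2)]] by (simp add: compact_eq_bounded_closed)
  ultimately show ?thesis using assms unfolding test_function_def by auto
qed

lemma test_function_mult_smooth:
  assumes "test_function \<Omega> \<phi>" "smooth_on h UNIV"
  shows "test_function \<Omega> (\<lambda>x. \<phi> x * h x)"
proof -
  obtain K where K: "compact K" "K \<subseteq> \<Omega>" "\<And>x. x \<notin> K \<Longrightarrow> \<phi> x = 0"
    "\<And>x. x \<notin> K \<Longrightarrow> gradient \<phi> x = 0" "\<And>x. GDERIV \<phi> x :> gradient \<phi> x"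
    "continuous_on UNIV \<phi>" "continuous_on UNIV (gradient \<phi>)"
    by (rule test_functionE[OF assms(1)]) (rule that)
  show ?thesis
  proof (rule test_functionI[OF _ K(1,2)])
    show "smooth_on (\<lambda>x. \<phi> x * h x) UNIV"
      using assms unfolding smooth_on_def test_function_def by (blast intro: Ck_on_mult)
  qed (simp add: K(3))
qed

lemma continuous_on_Un_compl:
  assumes "open \<Omega>" "closed K" "K \<subseteq> \<Omega>" "continuous_on \<Omega> f" "\<And>x. x \<notin> K \<Longrightarrow> f x = c"
  shows "continuous_on UNIV f"
proof -
  have "continuous_on (- K) f" 
    by (rule continuous_on_eq[OF continuous_on_const[of _ c]]) (use assms(5) in auto)
  then have "continuous_on (\<Omega> \<union> - K) f" using assms by (intro continuous_on_open_Un) auto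
  moreover have "\<Omega> \<union> - K = UNIV" using assms(3) by auto
  ultimately show ?thesis by simp
qed

lemma integral_lebesgue_on:
  fixes f :: "'a::euclidean_space \<Rightarrow> real"
  assumes "\<Omega> \<in> sets lebesgue"
  shows "(\<integral>x. f x \<partial>lebesgue_on \<Omega>) = (\<integral>x. indicator \<Omega> x * f x \<partial>lebesgue)"
  using integral_restrict_space[of \<Omega> lebesgue f] assms by simp

lemma integrable_lebesgue_on:
  fixes f :: "'a::euclidean_space \<Rightarrow> real"
  assumes "\<Omega> \<in> sets lebesgue"
  shows "integrable (lebesgue_on \<Omega>) f \<longleftrightarrow> integrable lebesgue (\<lambda>x. indicator \<Omega> x * f x)"
  using integrable_restrict_space[of \<Omega> lebesgue f] assms by simp

text \<open>The product \<open>u \<psi>\<close>, extended by zero, is continuously differentiable with compact support, so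
  its partial derivatives have integral zero.\<close>

lemma integral_product_test_function:
  fixes u :: "real^'n \<Rightarrow> real"
  assumes "open \<Omega>" and u: "\<And>x. x \<in> \<Omega> \<Longrightarrow> GDERIV u x :> g x" "continuous_on \<Omega> g"
    and "test_function \<Omega> \<psi>"
  shows "(\<integral>x. u x * gradient \<psi> x $ i + g x $ i * \<psi> x \<partial>lebesgue_on \<Omega>) = 0"
proof -
  obtain K where K: "compact K" "K \<subseteq> \<Omega>" "\<And>x. x \<notin> K \<Longrightarrow> \<psi> x = 0"
    "\<And>x. x \<notin> K \<Longrightarrow> gradient \<psi> x = 0" "\<And>x. GDERIV \<psi> x :> gradient \<psi> x"
    "continuous_on UNIV \<psi>" "continuous_on UNIV (gradient \<psi>)"
    by (rule test_functionE[OF assms(4)]) (rule that)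
  define v where "v x = (if x \<in> \<Omega> then u x * \<psi> x else 0)" for x
  define w where "w x = (if x \<in> \<Omega> then u x *\<^sub>R gradient \<psi> x + \<psi> x *\<^sub>R g x else 0)" for x
  have vw: "GDERIV v x :> w x" for x
  proof (cases "x \<in> \<Omega>")
    case True
    have "GDERIV (\<lambda>x. u x * \<psi> x) x :> w x"
      using GDERIV_mult[OF u(1)[OF True] K(5)] True by (simp add: w_def)
    then show ?thesis by (rule GDERIV_transform[OF _ assms(1) True]) (simp add: v_def)
  next
    case False
    then have "x \<notin> K" using K(2) by blast
    then have "GDERIV v x :> 0"
      by (intro GDERIV_zero_outside[OF compact_imp_closed[OF K(1)]]) (auto simp: v_def K(3))
    then show ?thesis using False by (simp add: w_def)
  qed
  have "continuous_on \<Omega> u"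
    using u(1) GDERIV_isCont continuous_at_imp_continuous_on by blast
  then have "continuous_on \<Omega> (\<lambda>x. u x *\<^sub>R gradient \<psi> x + \<psi> x *\<^sub>R g x)"
    using u(2) continuous_on_subset[OF K(6)] continuous_on_subset[OF K(7)]
    by (intro continuous_intros) auto
  then have "continuous_on \<Omega> w" by (rule continuous_on_eq) (auto simp: w_def)
  then have wc: "continuous_on UNIV w"
    by (rule continuous_on_Un_compl[OF assms(1) compact_imp_closed[OF K(1)] K(2)]) (use K in \<open>auto simp: w_def\<close>)
  have "(\<integral>x. w x $ i \<partial>lebesgue) = 0"
    by (rule integral_partial_derivative_eq_0[OF vw wc K(1)]) (auto simp: v_def K(3))
  also have "(\<integral>x. w x $ i \<partial>lebesgue) =
      (\<integral>x. u x * gradient \<psi> x $ i + g x $ i * \<psi> x \<partial>lebesgue_on \<Omega>)"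
    using assms(1) by (subst integral_lebesgue_on)
      (auto simp: w_def indicator_def mult.commute if_distrib[of "\<lambda>x. x $ i"] if_distrib[of "\<lambda>b. b * _"] cong: if_cong intro!: Bochner_Integration.integral_cong)
  finally show ?thesis .
qed

section \<open>Uniqueness of weak gradients\<close>

text \<open>A product of one-dimensional bumps is a function \<open>\<beta>\<close> that is positive exactly inside the box;
  then \<open>\<beta> / (\<beta> + 1 / k)\<close> tends to \<open>1\<close> there.\<close>

lemma test_functions_approximating_box:
  assumes "cbox c d \<subseteq> (\<Omega> :: (real^'n) set)"
  obtains \<theta> :: "nat \<Rightarrow> real^'n \<Rightarrow> real" where "\<And>k. test_function \<Omega> (\<theta> k)"
    "\<And>k x. \<bar>\<theta> k x\<bar> \<le> 1" "\<And>x. (\<lambda>k. \<theta> k x) \<longlonglongrightarrow> indicator (box c d) x"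
proof
  define \<beta> :: "real^'n \<Rightarrow> real" where
    "\<beta> x = (\<Prod>i\<in>UNIV. bump (x \<bullet> axis i 1 + - c $ i) * bump (d $ i + (-1) * (x \<bullet> axis i 1)))" for x
  define \<theta> where "\<theta> k x = \<beta> x * (\<beta> x + 1 / real (Suc k)) powr (- 1)" for k x
  have \<beta>_nonneg: "\<beta> x \<ge> 0" for x
    unfolding \<beta>_def by (intro prod_nonneg mult_nonneg_nonneg bump_bounds ballI)
  have \<beta>_zero: "\<beta> x = 0 \<longleftrightarrow> x \<notin> box c d" for x
  proof -
    have "bump s = 0 \<longleftrightarrow> s \<le> 0" for s by (simp add: bump_def)
    then show ?thesis by (auto simp: \<beta>_def mem_box_cart inner_axis not_less)
  qed
  have \<theta>_eq: "\<theta> k x = \<beta> x / (\<beta> x + 1 / real (Suc k))" for k x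
    using \<beta>_nonneg[of x] by (simp add: \<theta>_def powr_minus_divide add_nonneg_pos)
  have "smooth_on \<beta> UNIV"
    unfolding smooth_on_def \<beta>_def
    by (intro allI Ck_on_prod finite_UNIV Ck_on_mult Ck_on_compose[OF infinitely_differentiable_bump]
        Ck_on_add Ck_on_const Ck_on_inner) auto
  then have "smooth_on (\<theta> k) UNIV" for k
    unfolding smooth_on_def \<theta>_def
    by (intro allI Ck_on_mult Ck_on_compose[OF infinitely_differentiable_powr] Ck_on_add Ck_on_const)
      (auto intro: add_nonneg_pos \<beta>_nonneg)
  then show "test_function \<Omega> (\<theta> k)" for k
    by (rule test_functionI[OF _ compact_cbox assms])
      (use \<beta>_zero box_subset_cbox in \<open>auto simp: \<theta>_def\<close>)
  show "\<bar>\<theta> k x\<bar> \<le> 1" for k x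
    unfolding \<theta>_eq using \<beta>_nonneg[of x] by (simp add: divide_simps add_nonneg_pos)
  show "(\<lambda>k. \<theta> k x) \<longlonglongrightarrow> indicator (box c d) x" for x
  proof (cases "x \<in> box c d")
    case True
    then have b: "\<beta> x \<noteq> 0" using \<beta>_zero by blast
    have "(\<lambda>k. \<beta> x / (\<beta> x + inverse (real (Suc k)))) \<longlonglongrightarrow> \<beta> x / (\<beta> x + 0)"
      by (intro tendsto_intros LIMSEQ_inverse_real_of_nat) (use b in auto)
    then show ?thesis using True b by (simp add: \<theta>_eq[abs_def] divide_inverse)
  next
    case False
    then have "\<theta> k x = 0" for k using \<beta>_zero by (simp add: \<theta>_def)
    then show ?thesis using False by simp
  qed
qed

lemma sigma_finite_lebesgue: "sigma_finite_measure (lebesgue :: 'a::euclidean_space measure)"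
proof -
  obtain A :: "'a set set" where A: "countable A" "A \<subseteq> sets lborel" "\<Union>A = space lborel"
    "\<forall>a\<in>A. emeasure lborel a \<noteq> \<infinity>"
    using lborel.sigma_finite_countable by blast
  show ?thesis
    by standard (use A in \<open>auto intro!: exI[of _ A]\<close>)
qed

text \<open>Boxes are an intersection-stable generator of the Borel sets, so the integral vanishes over every
  Borel set, and then over every Lebesgue set.\<close>

lemma integral_zero_on_boxes_imp_AE_zero:
  fixes h :: "'a::euclidean_space \<Rightarrow> real"
  assumes h: "integrable lebesgue h" and z: "\<And>c d. (\<integral>x. indicator (box c d) x * h x \<partial>lebesgue) = 0"
    and UNIV0: "(\<integral>x. h x \<partial>lebesgue) = 0"
  shows "AE x in lebesgue. h x = 0"
proof (rule sigma_finite_measure.density_zero[OF sigma_finite_lebesgue h])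
  have ih: "set_integrable lebesgue B h" if "B \<in> sets lebesgue" for B
    using integrable_mult_indicator[OF that h] by (simp add: set_integrable_def)
  have borel: "set_lebesgue_integral lebesgue B h = 0" if "B \<in> sets borel" for B
  proof -
    let ?G = "range (\<lambda>(a, b). box a b) :: 'a set set"
    have "Int_stable ?G" by (auto simp: Int_stable_def box_Int_box)
    moreover have "?G \<subseteq> Pow UNIV" by auto
    moreover have "B \<in> sigma_sets UNIV ?G" using that by (simp add: borel_eq_box)
    ultimately show ?thesis
    proof (induction rule: sigma_sets_induct_disjoint)
      case (basic B) then show ?case using z by (auto simp: set_lebesgue_integral_def)
    next
      case empty show ?case by (simp add: set_lebesgue_integral_def)
    next
      case (compl B)
      then have B: "B \<in> sets lebesgue" 
        by (intro sets_completionI_sets) (simp add: borel_eq_box)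
      have "set_lebesgue_integral lebesgue (UNIV - B) h = (\<integral>x. h x - indicator B x *\<^sub>R h x \<partial>lebesgue)"
        unfolding set_lebesgue_integral_def by (intro Bochner_Integration.integral_cong) (auto simp: indicator_def)
      also have "\<dots> = (\<integral>x. h x \<partial>lebesgue) - (\<integral>x. indicator B x *\<^sub>R h x \<partial>lebesgue)"
        by (rule Bochner_Integration.integral_diff[OF h ih[OF B, unfolded set_integrable_def]])
      finally show ?case using compl(2) UNIV0 by (simp add: set_lebesgue_integral_def)
    next
      case (union f)
      then have "f i \<in> sets lborel" for i by (simp add: borel_eq_box subset_eq)
      then have fb: "f i \<in> sets lebesgue" for i by (rule sets_completionI_sets)
      have "set_lebesgue_integral lebesgue (\<Union>i. f i) h = (\<Sum>i. set_lebesgue_integral lebesgue (f i) h)"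
        using union(1) fb by (intro lebesgue_integral_countable_add ih) (auto simp: disjoint_family_on_def)
      then show ?case using union(3) by simp
    qed
  qed
  fix A :: "'a set" assume A: "A \<in> sets lebesgue"
  then obtain S N N' where S: "A = S \<union> N" "N \<subseteq> N'" "N' \<in> null_sets lborel" "S \<in> sets lborel"
    by (rule sets_completionE)
  have "AE x in lebesgue. x \<notin> N'" using S(3) by (intro AE_not_in null_sets_completionI)
  then have "AE x in lebesgue. indicator A x *\<^sub>R h x = indicator S x *\<^sub>R h x"
    by eventually_elim (use S in \<open>auto simp: indicator_def\<close>)
  moreover have "(\<lambda>x. indicator A x *\<^sub>R h x) \<in> borel_measurable lebesgue"
    using ih[OF A] unfolding set_integrable_def by (rule borel_measurable_integrable)
  moreover have "S \<in> sets lebesgue" using S(4) by (rule sets_completionI_sets)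
  then have "(\<lambda>x. indicator S x *\<^sub>R h x) \<in> borel_measurable lebesgue"
    using ih[of S] borel_measurable_integrable unfolding set_integrable_def by blast
  ultimately have "set_lebesgue_integral lebesgue A h = set_lebesgue_integral lebesgue S h"
    unfolding set_lebesgue_integral_def by (rule integral_cong_AE[rotated 2])
  then show "set_lebesgue_integral lebesgue A h = 0" using borel S(4) by simp
qed

text \<open>This is the fundamental lemma of the calculus of variations with boxes in place of test functions.
  An open set is a countable union of closed boxes, and within each of them the previous lemma applies
  because the intersection of two boxes is a box.\<close>

lemma AE_zero_of_integral_zero_on_inner_boxes:
  fixes r :: "'a::euclidean_space \<Rightarrow> real"
  assumes "open \<Omega>" and r: "integrable (lebesgue_on \<Omega>) r"
    and z: "\<And>c d. cbox c d \<subseteq> \<Omega> \<Longrightarrow> (\<integral>x. indicator (box c d) x * r x \<partial>lebesgue_on \<Omega>) = 0"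
  shows "AE x in lebesgue_on \<Omega>. r x = 0"
proof -
  have \<Omega>: "\<Omega> \<in> sets lebesgue" using assms(1) by simp
  have inner: "AE x in lebesgue. x \<in> cbox c d \<longrightarrow> r x = 0" if cd: "cbox c d \<subseteq> \<Omega>" for c d
  proof -
    define h where "h x = indicator (box c d) x * r x" for x
    have sub: "box c d \<subseteq> \<Omega>" using cd box_subset_cbox by blast
    have h_eq: "h x = indicator (box c d) x *\<^sub>R (indicator \<Omega> x * r x)" for x
      using sub by (auto simp: h_def indicator_def)
    have hi: "integrable lebesgue h"
      unfolding h_eq[abs_def] using r \<Omega>
      by (intro integrable_mult_indicator) (auto simp: integrable_lebesgue_on)
    have hz: "(\<integral>x. indicator (box c' d') x * h x \<partial>lebesgue) = 0" for c' d'
    proof -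
      obtain e f where ef: "box c d \<inter> box c' d' = box e f" by (simp add: box_Int_box)
      show ?thesis
      proof (cases "box e f = {}")
        case True
        then have "indicator (box c' d') x * h x = 0" for x
          using ef by (auto simp: h_def indicator_def)
        then show ?thesis by (simp only: Bochner_Integration.integral_zero)
      next
        case False
        then have "cbox e f \<subseteq> cbox c d"
          using ef closure_box[OF False] closure_minimal[of "box e f" "cbox c d"] box_subset_cbox[of c d]
          by auto
        then have "(\<integral>x. indicator (box e f) x * r x \<partial>lebesgue_on \<Omega>) = 0" using z cd by blast
        also have "(\<integral>x. indicator (box e f) x * r x \<partial>lebesgue_on \<Omega>) =
            (\<integral>x. indicator (box c' d') x * h x \<partial>lebesgue)"
          unfolding integral_lebesgue_on[OF \<Omega>] using ef sub
          by (intro Bochner_Integration.integral_cong) (auto simp: h_def indicator_def)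
        finally show ?thesis by simp
      qed
    qed
    have hz0: "(\<integral>x. h x \<partial>lebesgue) = 0"
    proof -
      have "(\<lambda>x. indicator (box c d) x * h x) = h" by (intro ext) (simp add: h_def indicator_def)
      then show ?thesis using hz[of c d] by (simp only:)
    qed
    have "AE x in lebesgue. h x = 0"
      by (rule integral_zero_on_boxes_imp_AE_zero[OF hi hz hz0])
    moreover have "AE x in lebesgue. x \<notin> cbox c d - box c d"
      by (rule AE_not_in) (simp add: negligible_iff_null_sets[symmetric] negligible_frontier_interval)
    ultimately show ?thesis by eventually_elim (auto simp: h_def indicator_def)
  qed
  obtain D where D: "countable D" "D \<subseteq> Pow \<Omega>" "\<And>X. X \<in> D \<Longrightarrow> \<exists>a b. X = cbox a b" "\<Union>D = \<Omega>"
    using open_countable_Union_open_cbox[OF assms(1)] by metis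
  have "AE x in lebesgue. \<forall>X\<in>D. x \<in> X \<longrightarrow> r x = 0"
    unfolding AE_ball_countable[OF D(1)]
  proof
    fix X assume X: "X \<in> D"
    then obtain c d where "X = cbox c d" using D(3) by blast
    then show "AE x in lebesgue. x \<in> X \<longrightarrow> r x = 0" using inner X D(2) by blast
  qed
  then have "AE x in lebesgue. x \<in> \<Omega> \<longrightarrow> r x = 0"
    by eventually_elim (use D(4) in blast)
  then show ?thesis using \<Omega> by (simp add: AE_restrict_space_iff)
qed

lemma integrable_mult_bounded:
  fixes f h :: "'a \<Rightarrow> real"
  assumes "integrable M f" "h \<in> borel_measurable M" "\<And>x. x \<in> space M \<Longrightarrow> \<bar>h x\<bar> \<le> B"
  shows "integrable M (\<lambda>x. f x * h x)"
proof (rule Bochner_Integration.integrable_bound)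
  show "integrable M (\<lambda>x. B * f x)" using assms(1) by simp
  show "(\<lambda>x. f x * h x) \<in> borel_measurable M" using assms(1,2) by simp
  show "AE x in M. norm (f x * h x) \<le> norm (B * f x)"
  proof (rule AE_I2)
    fix x assume x: "x \<in> space M"
    then have "\<bar>f x\<bar> * \<bar>h x\<bar> \<le> \<bar>f x\<bar> * \<bar>B\<bar>"
      using assms(3)[OF x] by (intro mult_left_mono) auto
    then show "norm (f x * h x) \<le> norm (B * f x)" by (simp add: abs_mult mult.commute)
  qed
qed

lemma borel_measurable_lebesgue_on_continuous:
  "continuous_on UNIV f \<Longrightarrow> f \<in> borel_measurable (lebesgue_on \<Omega>)"
  by (rule measurable_restrict_space1[OF borel_measurable_lebesgue_continuous])

lemma test_function_measurable:
  assumes "test_function \<Omega> \<phi>"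
  shows "\<phi> \<in> borel_measurable (lebesgue_on S)" "gradient \<phi> \<in> borel_measurable (lebesgue_on S)"
    "(\<lambda>x. gradient \<phi> x $ i) \<in> borel_measurable (lebesgue_on S)"
proof -
  obtain K where K: "compact K" "K \<subseteq> \<Omega>" "\<And>x. x \<notin> K \<Longrightarrow> \<phi> x = 0"
    "\<And>x. x \<notin> K \<Longrightarrow> gradient \<phi> x = 0" "\<And>x. GDERIV \<phi> x :> gradient \<phi> x"
    "continuous_on UNIV \<phi>" "continuous_on UNIV (gradient \<phi>)"
    by (rule test_functionE[OF assms]) (rule that)
  show "\<phi> \<in> borel_measurable (lebesgue_on S)" "gradient \<phi> \<in> borel_measurable (lebesgue_on S)"
    using K by (simp_all add: borel_measurable_lebesgue_on_continuous)
  have "continuous_on UNIV (\<lambda>x. gradient \<phi> x $ i)"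
    using K(7) by (intro continuous_intros)
  then show "(\<lambda>x. gradient \<phi> x $ i) \<in> borel_measurable (lebesgue_on S)"
    by (rule borel_measurable_lebesgue_on_continuous)
qed

text \<open>Both gradients satisfy the same integration by parts against test functions, and test functions
  approximate the indicators of boxes boundedly.\<close>

lemma weak_gradient_eq_classical:
  fixes u :: "real^'n \<Rightarrow> real"
  assumes "open \<Omega>" and wg: "weak_gradient \<Omega> u Du"
    and u: "\<And>x. x \<in> \<Omega> \<Longrightarrow> GDERIV u x :> g x" "continuous_on \<Omega> g"
    and int: "integrable (lebesgue_on \<Omega>) u" "\<And>i. integrable (lebesgue_on \<Omega>) (\<lambda>x. Du x $ i)"
      "\<And>i. integrable (lebesgue_on \<Omega>) (\<lambda>x. g x $ i)"
  shows "AE x in lebesgue_on \<Omega>. Du x = g x"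
proof -
  let ?N = "lebesgue_on \<Omega>"
  have comp: "AE x in ?N. Du x $ i - g x $ i = 0" for i
  proof (rule AE_zero_of_integral_zero_on_inner_boxes[OF assms(1)])
    show ri: "integrable ?N (\<lambda>x. Du x $ i - g x $ i)" using int by simp
    have tz: "(\<integral>x. (Du x $ i - g x $ i) * \<psi> x \<partial>?N) = 0" if t: "test_function \<Omega> \<psi>" for \<psi>
    proof -
      note m = test_function_measurable[OF t]
      obtain B where B: "B \<ge> 0" "\<And>x. \<bar>\<psi> x\<bar> \<le> B" "\<And>x. norm (gradient \<psi> x) \<le> B"
        by (rule test_function_bounded[OF t]) (rule that)
      have Bi: "\<bar>gradient \<psi> x $ i\<bar> \<le> B" for x
        using component_le_norm_cart[of "gradient \<psi> x" i] B(3)[of x] by linarith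
      have i1: "integrable ?N (\<lambda>x. u x * gradient \<psi> x $ i)"
        by (rule integrable_mult_bounded[OF int(1) m(3) Bi])
      have i2: "integrable ?N (\<lambda>x. g x $ i * \<psi> x)" "integrable ?N (\<lambda>x. Du x $ i * \<psi> x)"
        by (rule integrable_mult_bounded[OF int(3) m(1) B(2)])
           (rule integrable_mult_bounded[OF int(2) m(1) B(2)])
      have "(\<integral>x. u x * gradient \<psi> x $ i \<partial>?N) + (\<integral>x. g x $ i * \<psi> x \<partial>?N) = 0"
        using integral_product_test_function[OF assms(1) u t, of i]
        unfolding Bochner_Integration.integral_add[OF i1 i2(1)] by simp
      moreover have "(\<integral>x. u x * gradient \<psi> x $ i \<partial>?N) = - (\<integral>x. Du x $ i * \<psi> x \<partial>?N)"
        using wg t unfolding weak_gradient_def by blast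
      ultimately show ?thesis using i2 by (simp add: left_diff_distrib)
    qed
    fix c d :: "real^'n" assume "cbox c d \<subseteq> \<Omega>"
    then obtain \<theta> :: "nat \<Rightarrow> real^'n \<Rightarrow> real" where \<theta>: "\<And>k. test_function \<Omega> (\<theta> k)"
      "\<And>k x. \<bar>\<theta> k x\<bar> \<le> 1" "\<And>x. (\<lambda>k. \<theta> k x) \<longlonglongrightarrow> indicator (box c d) x"
      by (rule test_functions_approximating_box) (rule that)
    define r where "r x = Du x $ i - g x $ i" for x
    have r: "integrable ?N r" using ri by (simp add: r_def[abs_def])
    have "(\<lambda>k. \<integral>x. r x * \<theta> k x \<partial>?N) \<longlonglongrightarrow> (\<integral>x. r x * indicator (box c d) x \<partial>?N)"
    proof (rule integral_dominated_convergence[where w="\<lambda>x. \<bar>r x\<bar>"])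
      show "(\<lambda>x. r x * \<theta> k x) \<in> borel_measurable ?N" for k
        using test_function_measurable[OF \<theta>(1)] r by (intro borel_measurable_times) auto
      have "box c d \<inter> \<Omega> \<in> sets ?N" using assms(1) by (intro sets_restrict_space_iff[THEN iffD2]) auto
      then have "indicator (box c d \<inter> \<Omega>) \<in> borel_measurable ?N" by (rule borel_measurable_indicator)
      then have "(indicator (box c d) :: _ \<Rightarrow> real) \<in> borel_measurable ?N"
        by (rule measurable_cong[THEN iffD1, rotated]) (auto simp: indicator_def)
      then show "(\<lambda>x. r x * indicator (box c d) x) \<in> borel_measurable ?N"
        using r by (intro borel_measurable_times) auto
      show "integrable ?N (\<lambda>x. \<bar>r x\<bar>)" using r by simp
      show "AE x in ?N. (\<lambda>k. r x * \<theta> k x) \<longlonglongrightarrow> r x * indicator (box c d) x"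
        by (intro AE_I2 tendsto_mult_left \<theta>(3))
      show "AE x in ?N. norm (r x * \<theta> k x) \<le> \<bar>r x\<bar>" for k
        using \<theta>(2) by (auto simp: abs_mult mult_left_le)
    qed
    moreover have "(\<integral>x. r x * \<theta> k x \<partial>?N) = 0" for k using tz[OF \<theta>(1)] by (simp add: r_def)
    ultimately have "(\<lambda>k::nat. 0::real) \<longlonglongrightarrow> (\<integral>x. r x * indicator (box c d) x \<partial>?N)" by simp
    then have "(\<integral>x. r x * indicator (box c d) x \<partial>?N) = 0"
      using LIMSEQ_unique[OF tendsto_const] by metis
    then show "(\<integral>x. indicator (box c d) x * (Du x $ i - g x $ i) \<partial>?N) = 0"
      by (simp add: r_def mult.commute)
  qed
  have "AE x in ?N. \<forall>i. Du x $ i - g x $ i = 0"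
    using comp by (simp add: AE_all_countable)
  then show ?thesis by eventually_elim (simp add: vec_eq_iff)
qed

section \<open>Sobolev functions with zero boundary values\<close>

text \<open>On a space of finite measure this replaces Hoelder's inequality: it shows that \<open>L^p\<close> convergence
  implies \<open>L^1\<close> convergence.\<close>

lemma le_eps_plus_powr:
  fixes x \<delta> p :: real
  assumes "x \<ge> 0" "\<delta> > 0" "p \<ge> 1"
  shows "x \<le> \<delta> + \<delta> powr (1 - p) * x powr p"
proof (cases "x \<le> \<delta>")
  case True then show ?thesis by (simp add: add_increasing2)
next
  case False
  then have "1 \<le> x / \<delta>" using assms by simp
  then have "(x / \<delta>) powr 1 \<le> (x / \<delta>) powr p" using assms by (intro powr_mono) auto
  then have "x / \<delta> \<le> x powr p / \<delta> powr p" using assms False by (simp add: powr_divide)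
  then have "x \<le> \<delta> * (x powr p / \<delta> powr p)" using assms by (simp add: field_simps)
  also have "\<dots> = \<delta> powr (1 - p) * x powr p" using assms by (simp add: powr_diff)
  finally show ?thesis using assms by linarith
qed

lemma norm_diff_powr_le:
  assumes "p > 0"
  shows "norm (a - b) powr p \<le> 2 powr p * (norm a powr p + norm b powr p)"
proof -
  have "norm (a - b) \<le> 2 * max (norm a) (norm b)" using norm_triangle_ineq4[of a b] by linarith
  then have "norm (a - b) powr p \<le> (2 * max (norm a) (norm b)) powr p"
    using assms by (intro powr_mono2) auto
  also have "\<dots> = 2 powr p * max (norm a) (norm b) powr p" by (simp add: powr_mult)
  also have "max (norm a) (norm b) powr p \<le> norm a powr p + norm b powr p"
    by (simp add: max_def)
  finally show ?thesis by simp
qed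

lemma tendsto_integral_mult_bounded:
  fixes f :: "'a \<Rightarrow> real"
  assumes f: "\<And>k. integrable M (f' k)" "integrable M f"
    and lim: "(\<lambda>k. \<integral>x. \<bar>f x - f' k x\<bar> \<partial>M) \<longlonglongrightarrow> 0"
    and h: "h \<in> borel_measurable M" "\<And>x. x \<in> space M \<Longrightarrow> \<bar>h x\<bar> \<le> B"
  shows "(\<lambda>k. \<integral>x. f' k x * h x \<partial>M) \<longlonglongrightarrow> (\<integral>x. f x * h x \<partial>M)"
proof -
  have "(\<lambda>k. (\<integral>x. f' k x * h x \<partial>M) - (\<integral>x. f x * h x \<partial>M)) \<longlonglongrightarrow> 0"
  proof (rule Lim_null_comparison)
    show "\<forall>\<^sub>F k in sequentially. norm ((\<integral>x. f' k x * h x \<partial>M) - (\<integral>x. f x * h x \<partial>M))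
        \<le> B * (\<integral>x. \<bar>f x - f' k x\<bar> \<partial>M)"
    proof (intro always_eventually allI)
      fix k
      have i: "integrable M (\<lambda>x. f' k x * h x)" "integrable M (\<lambda>x. f x * h x)"
        using integrable_mult_bounded[OF f(1) h] integrable_mult_bounded[OF f(2) h] by auto
      have d: "integrable M (\<lambda>x. \<bar>f x - f' k x\<bar>)" using f by simp
      have "norm ((\<integral>x. f' k x * h x \<partial>M) - (\<integral>x. f x * h x \<partial>M)) = norm (\<integral>x. f' k x * h x - f x * h x \<partial>M)"
        using i by simp
      also have "\<dots> \<le> (\<integral>x. norm (f' k x * h x - f x * h x) \<partial>M)" by (rule integral_norm_bound)
      also have "\<dots> \<le> (\<integral>x. B * \<bar>f x - f' k x\<bar> \<partial>M)"
      proof (rule integral_mono)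
        show "integrable M (\<lambda>x. norm (f' k x * h x - f x * h x))" using i by simp
        show "integrable M (\<lambda>x. B * \<bar>f x - f' k x\<bar>)" using d by simp
        fix x assume x: "x \<in> space M"
        have "norm (f' k x * h x - f x * h x) = \<bar>h x\<bar> * \<bar>f x - f' k x\<bar>"
        proof -
          have "f' k x * h x - f x * h x = - (h x * (f x - f' k x))" by (simp add: algebra_simps)
          then show ?thesis by (simp only: real_norm_def abs_minus_cancel abs_mult)
        qed
        also have "\<dots> \<le> B * \<bar>f x - f' k x\<bar>" using h(2)[OF x] by (rule mult_right_mono) simp
        finally show "norm (f' k x * h x - f x * h x) \<le> B * \<bar>f x - f' k x\<bar>" .
      qed
      finally show "norm ((\<integral>x. f' k x * h x \<partial>M) - (\<integral>x. f x * h x \<partial>M)) \<le> B * (\<integral>x. \<bar>f x - f' k x\<bar> \<partial>M)"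
        by simp
    qed
    show "(\<lambda>k. B * (\<integral>x. \<bar>f x - f' k x\<bar> \<partial>M)) \<longlonglongrightarrow> 0"
      using tendsto_mult_left[OF lim, of B] by simp
  qed
  then show ?thesis by (simp add: LIM_zero_iff)
qed

locale bounded_open_set =
  fixes \<Omega> :: "(real^'n) set"
  assumes open_\<Omega>: "open \<Omega>" and bounded_\<Omega>: "bounded \<Omega>"
begin

abbreviation N :: "(real^'n) measure" where "N \<equiv> lebesgue_on \<Omega>"

lemma \<Omega>_sets: "\<Omega> \<in> sets lebesgue" using open_\<Omega> by simp

sublocale N: finite_measure N
  by (intro finite_measure_lebesgue_on lmeasurable_open bounded_\<Omega> open_\<Omega>)

lemma integrable_bounded:
  fixes f :: "real^'n \<Rightarrow> real"
  assumes "f \<in> borel_measurable N" "AE x in N. \<bar>f x\<bar> \<le> B"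
  shows "integrable N f"
  using N.integrable_const_bound[of f B] assms by simp

lemma Lp_on_bounded:
  assumes "f \<in> borel_measurable N" "AE x in N. norm (f x) \<le> B" "p > 0"
  shows "Lp_on \<Omega> p f"
proof -
  have "AE x in N. \<bar>norm (f x) powr p\<bar> \<le> B powr p"
    using assms(2) by eventually_elim (use assms(3) in \<open>auto intro: powr_mono2\<close>)
  then have "integrable N (\<lambda>x. norm (f x) powr p)"
    using assms(1) by (intro integrable_bounded) auto
  then show ?thesis using assms(1) by (simp add: Lp_on_def)
qed

lemma Lp_on_integrable_norm:
  assumes "Lp_on \<Omega> p f" "p \<ge> 1"
  shows "integrable N (\<lambda>x. norm (f x))"
proof (rule Bochner_Integration.integrable_bound)
  show "integrable N (\<lambda>x. 1 + norm (f x) powr p)"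
    using assms(1) by (simp add: Lp_on_def)
  show "(\<lambda>x. norm (f x)) \<in> borel_measurable N"
    using assms(1) by (auto simp: Lp_on_def)
  show "AE x in N. norm (norm (f x)) \<le> norm (1 + norm (f x) powr p)"
    using le_eps_plus_powr[of _ 1 p] assms(2) by (intro AE_I2) (simp add: abs_of_nonneg)
qed

lemma Lp_on_diff_integrable:
  fixes f g :: "real^'n \<Rightarrow> 'b::{real_normed_vector, second_countable_topology}"
  assumes "Lp_on \<Omega> p f" "Lp_on \<Omega> p g" "p > 0"
  shows "integrable N (\<lambda>x. norm (f x - g x) powr p)"
proof (rule Bochner_Integration.integrable_bound)
  show "integrable N (\<lambda>x. 2 powr p * (norm (f x) powr p + norm (g x) powr p))"
    using assms by (simp add: Lp_on_def)
  show "(\<lambda>x. norm (f x - g x) powr p) \<in> borel_measurable N"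
    using assms by (auto simp: Lp_on_def)
  show "AE x in N. norm (norm (f x - g x) powr p) \<le> norm (2 powr p * (norm (f x) powr p + norm (g x) powr p))"
    using norm_diff_powr_le[OF assms(3)] by (intro AE_I2) simp
qed

lemma Lp_tendsto_imp_L1_tendsto:
  fixes f :: "real^'n \<Rightarrow> 'b::{real_normed_vector, second_countable_topology}"
  assumes "Lp_on \<Omega> p f" "\<And>k. Lp_on \<Omega> p (f' k)" "p \<ge> 1"
    and lim: "(\<lambda>k::nat. \<integral>x. norm (f x - f' k x) powr p \<partial>N) \<longlonglongrightarrow> 0"
  shows "(\<lambda>k. \<integral>x. norm (f x - f' k x) \<partial>N) \<longlonglongrightarrow> 0"
proof (rule LIMSEQ_I)
  fix e :: real assume e: "e > 0"
  define m where "m = measure N (space N)"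
  define \<delta> where "\<delta> = e / (2 * (m + 1))"
  have m: "m \<ge> 0" by (simp add: m_def)
  then have \<delta>: "\<delta> > 0" using e by (simp add: \<delta>_def)
  have \<delta>m: "\<delta> * m \<le> e / 2"
    using m e by (simp add: \<delta>_def divide_simps) 
  have "(\<lambda>k. \<delta> powr (1 - p) * (\<integral>x. norm (f x - f' k x) powr p \<partial>N)) \<longlonglongrightarrow> \<delta> powr (1 - p) * 0"
    by (intro tendsto_mult_left lim)
  then have "\<forall>\<^sub>F k in sequentially. \<delta> powr (1 - p) * (\<integral>x. norm (f x - f' k x) powr p \<partial>N) < e / 2"
    by (rule order_tendstoD) (use e in simp)
  then obtain k0 where k0: "\<And>k. k \<ge> k0 \<Longrightarrow> \<delta> powr (1 - p) * (\<integral>x. norm (f x - f' k x) powr p \<partial>N) < e / 2"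
    by (auto simp: eventually_sequentially)
  have "norm ((\<integral>x. norm (f x - f' k x) \<partial>N) - 0) < e" if "k \<ge> k0" for k
  proof -
    have pi: "integrable N (\<lambda>x. norm (f x - f' k x) powr p)"
      using Lp_on_diff_integrable[OF assms(1) assms(2)[of k]] assms(3) by auto
    have "(\<integral>x. norm (f x - f' k x) \<partial>N) \<le> (\<integral>x. \<delta> + \<delta> powr (1 - p) * norm (f x - f' k x) powr p \<partial>N)"
    proof (rule integral_mono_AE)
      show "integrable N (\<lambda>x. \<delta> + \<delta> powr (1 - p) * norm (f x - f' k x) powr p)" using pi by simp
      have "Lp_on \<Omega> p (\<lambda>x. f x - f' k x)"
        using pi assms(1) assms(2)[of k] by (auto simp: Lp_on_def)
      then show "integrable N (\<lambda>x. norm (f x - f' k x))" using assms(3) by (rule Lp_on_integrable_norm)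
      show "AE x in N. norm (f x - f' k x) \<le> \<delta> + \<delta> powr (1 - p) * norm (f x - f' k x) powr p"
        using le_eps_plus_powr \<delta> assms(3) by (intro AE_I2) simp
    qed
    also have "\<dots> = \<delta> * m + \<delta> powr (1 - p) * (\<integral>x. norm (f x - f' k x) powr p \<partial>N)"
      using pi by (simp add: m_def)
    finally have "(\<integral>x. norm (f x - f' k x) \<partial>N) < e" using k0[OF that] \<delta>m by linarith
    then show ?thesis by simp
  qed
  then show "\<exists>k0. \<forall>k\<ge>k0. norm ((\<integral>x. norm (f x - f' k x) \<partial>N) - 0) < e" by blast
qed

lemma test_function_Lp:
  assumes "test_function \<Omega> \<phi>" "p > 0"
  shows "Lp_on \<Omega> p \<phi>" "Lp_on \<Omega> p (gradient \<phi>)"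
proof -
  obtain B where B: "B \<ge> 0" "\<And>x. \<bar>\<phi> x\<bar> \<le> B" "\<And>x. norm (gradient \<phi> x) \<le> B"
    by (rule test_function_bounded[OF assms(1)]) (rule that)
  show "Lp_on \<Omega> p \<phi>" using B assms(2)
    by (intro Lp_on_bounded[of _ B] test_function_measurable[OF assms(1)]) auto
  show "Lp_on \<Omega> p (gradient \<phi>)" using B assms(2)
    by (intro Lp_on_bounded[of _ B] test_function_measurable[OF assms(1)]) auto
qed

lemma Lp_component_integrable:
  fixes f :: "real^'n \<Rightarrow> real^'n"
  assumes "Lp_on \<Omega> p f" "p \<ge> 1"
  shows "integrable N (\<lambda>x. f x $ i)"
proof (rule Bochner_Integration.integrable_bound[OF Lp_on_integrable_norm[OF assms]])
  have "(\<lambda>x. f x \<bullet> axis i 1) \<in> borel_measurable N" using assms(1) by (auto simp: Lp_on_def)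
  then show "(\<lambda>x. f x $ i) \<in> borel_measurable N" by (simp add: inner_axis)
  show "AE x in N. norm (f x $ i) \<le> norm (norm (f x))"
    by (simp add: component_le_norm_cart)
qed

lemma Lp_integrable:
  fixes f :: "real^'n \<Rightarrow> real"
  assumes "Lp_on \<Omega> p f" "p \<ge> 1"
  shows "integrable N f"
  by (rule integrable_norm_cancel[OF Lp_on_integrable_norm[OF assms]]) (use assms(1) in \<open>simp add: Lp_on_def\<close>)

lemma L1_tendsto_components:
  fixes f :: "real^'n \<Rightarrow> real^'n"
  assumes "Lp_on \<Omega> p f" "\<And>k. Lp_on \<Omega> p (f' k)" "p \<ge> 1"
    and lim: "(\<lambda>k::nat. \<integral>x. norm (f x - f' k x) powr p \<partial>N) \<longlonglongrightarrow> 0"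
  shows "(\<lambda>k. \<integral>x. \<bar>f x $ i - f' k x $ i\<bar> \<partial>N) \<longlonglongrightarrow> 0"
proof (rule Lim_null_comparison[OF _ Lp_tendsto_imp_L1_tendsto[OF assms]])
  show "\<forall>\<^sub>F k in sequentially. norm (\<integral>x. \<bar>f x $ i - f' k x $ i\<bar> \<partial>N) \<le> (\<integral>x. norm (f x - f' k x) \<partial>N)"
  proof (intro always_eventually allI)
    fix k
    have L: "Lp_on \<Omega> p (\<lambda>x. f x - f' k x)"
      using Lp_on_diff_integrable[OF assms(1) assms(2)[of k]] assms(1) assms(2)[of k] assms(3)
      by (auto simp: Lp_on_def)
    have "(\<integral>x. \<bar>f x $ i - f' k x $ i\<bar> \<partial>N) \<le> (\<integral>x. norm (f x - f' k x) \<partial>N)"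
    proof (rule integral_mono)
      show "integrable N (\<lambda>x. \<bar>f x $ i - f' k x $ i\<bar>)"
        using Lp_component_integrable[OF L assms(3), of i] by simp
      show "integrable N (\<lambda>x. norm (f x - f' k x))" by (rule Lp_on_integrable_norm[OF L assms(3)])
      show "\<bar>f x $ i - f' k x $ i\<bar> \<le> norm (f x - f' k x)" for x
        using component_le_norm_cart[of "f x - f' k x" i] by simp
    qed
    then show "norm (\<integral>x. \<bar>f x $ i - f' k x $ i\<bar> \<partial>N) \<le> (\<integral>x. norm (f x - f' k x) \<partial>N)" by simp
  qed
qed

text \<open>An \<open>L^p\<close> limit of test functions and of their gradients is in \<open>W^{1,p}_0\<close>: the weak gradient
  comes for free, because integration by parts passes to the limit.\<close>

lemma W1p0I:
  assumes p: "p \<ge> 1" and v: "Lp_on \<Omega> p v" "Lp_on \<Omega> p Dv"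
    and \<phi>: "\<And>k::nat. test_function \<Omega> (\<phi> k)"
    and lim: "(\<lambda>k. \<integral>x. \<bar>v x - \<phi> k x\<bar> powr p \<partial>N) \<longlonglongrightarrow> 0"
      "(\<lambda>k. \<integral>x. norm (Dv x - gradient (\<phi> k) x) powr p \<partial>N) \<longlonglongrightarrow> 0"
  shows "W1p0 \<Omega> p v Dv"
proof -
  have L: "Lp_on \<Omega> p (\<phi> k)" "Lp_on \<Omega> p (gradient (\<phi> k))" for k
    using test_function_Lp[OF \<phi>] p by auto
  have "weak_gradient \<Omega> v Dv"
    unfolding weak_gradient_def
  proof (intro allI impI)
    fix \<psi> i assume \<psi>: "test_function \<Omega> \<psi>"
    note m = test_function_measurable[OF \<psi>]
    obtain B where B: "B \<ge> 0" "\<And>x. \<bar>\<psi> x\<bar> \<le> B" "\<And>x. norm (gradient \<psi> x) \<le> B"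
      by (rule test_function_bounded[OF \<psi>]) (rule that)
    have Bi: "\<bar>gradient \<psi> x $ i\<bar> \<le> B" for x
      using component_le_norm_cart[of "gradient \<psi> x" i] B(3)[of x] by linarith
    have "(\<lambda>k. \<integral>x. \<phi> k x * gradient \<psi> x $ i \<partial>N) \<longlonglongrightarrow> (\<integral>x. v x * gradient \<psi> x $ i \<partial>N)"
      by (rule tendsto_integral_mult_bounded[OF Lp_integrable[OF L(1) p] Lp_integrable[OF v(1) p] _ m(3) Bi])
        (use Lp_tendsto_imp_L1_tendsto[OF v(1) L(1) p] lim(1) in simp)
    moreover have "(\<lambda>k. \<integral>x. gradient (\<phi> k) x $ i * \<psi> x \<partial>N) \<longlonglongrightarrow> (\<integral>x. Dv x $ i * \<psi> x \<partial>N)"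
      by (rule tendsto_integral_mult_bounded[OF Lp_component_integrable[OF L(2) p]
            Lp_component_integrable[OF v(2) p] L1_tendsto_components[OF v(2) L(2) p lim(2)] m(1) B(2)])
    moreover have "(\<integral>x. \<phi> k x * gradient \<psi> x $ i \<partial>N) = - (\<integral>x. gradient (\<phi> k) x $ i * \<psi> x \<partial>N)" for k
    proof -
      obtain K where K: "compact K" "K \<subseteq> \<Omega>" "\<And>x. x \<notin> K \<Longrightarrow> \<phi> k x = 0"
        "\<And>x. x \<notin> K \<Longrightarrow> gradient (\<phi> k) x = 0" "\<And>x. GDERIV (\<phi> k) x :> gradient (\<phi> k) x"
        "continuous_on UNIV (\<phi> k)" "continuous_on UNIV (gradient (\<phi> k))"
        by (rule test_functionE[OF \<phi>]) (rule that)
      have i: "integrable N (\<lambda>x. \<phi> k x * gradient \<psi> x $ i)"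
        "integrable N (\<lambda>x. gradient (\<phi> k) x $ i * \<psi> x)"
        by (rule integrable_mult_bounded[OF Lp_integrable[OF L(1) p] m(3) Bi])
          (rule integrable_mult_bounded[OF Lp_component_integrable[OF L(2) p] m(1) B(2)])
      have "(\<integral>x. \<phi> k x * gradient \<psi> x $ i + gradient (\<phi> k) x $ i * \<psi> x \<partial>N) = 0"
        by (rule integral_product_test_function[OF open_\<Omega> K(5) continuous_on_subset[OF K(7) subset_UNIV] \<psi>])
      then show ?thesis unfolding Bochner_Integration.integral_add[OF i] by simp
    qed
    ultimately have "(\<lambda>k. \<integral>x. \<phi> k x * gradient \<psi> x $ i \<partial>N) \<longlonglongrightarrow> (\<integral>x. v x * gradient \<psi> x $ i \<partial>N)"
      "(\<lambda>k. \<integral>x. \<phi> k x * gradient \<psi> x $ i \<partial>N) \<longlonglongrightarrow> - (\<integral>x. Dv x $ i * \<psi> x \<partial>N)"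
      by (simp_all add: tendsto_minus)
    then show "(\<integral>x. v x * gradient \<psi> x $ i \<partial>N) = - (\<integral>x. Dv x $ i * \<psi> x \<partial>N)"
      by (rule LIMSEQ_unique)
  qed
  then show ?thesis using v \<phi> lim unfolding W1p0_def W1p_def by blast
qed

lemma W1p0E:
  assumes "W1p0 \<Omega> p v Dv"
  obtains \<phi> where "Lp_on \<Omega> p v" "Lp_on \<Omega> p Dv" "weak_gradient \<Omega> v Dv" "\<And>k::nat. test_function \<Omega> (\<phi> k)"
    "(\<lambda>k. \<integral>x. \<bar>v x - \<phi> k x\<bar> powr p \<partial>N) \<longlonglongrightarrow> 0"
    "(\<lambda>k. \<integral>x. norm (Dv x - gradient (\<phi> k) x) powr p \<partial>N) \<longlonglongrightarrow> 0"
  using assms unfolding W1p0_def W1p_def by blast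

lemma W1p0_cong_gradient:
  assumes W: "W1p0 \<Omega> p v Dv" and p: "p \<ge> 1"
    and ae: "AE x in N. Dv x = g x" and g: "g \<in> borel_measurable N"
  shows "W1p0 \<Omega> p v g"
proof -
  obtain \<phi> where \<phi>: "Lp_on \<Omega> p v" "Lp_on \<Omega> p Dv" "weak_gradient \<Omega> v Dv" "\<And>k::nat. test_function \<Omega> (\<phi> k)"
    "(\<lambda>k. \<integral>x. \<bar>v x - \<phi> k x\<bar> powr p \<partial>N) \<longlonglongrightarrow> 0"
    "(\<lambda>k. \<integral>x. norm (Dv x - gradient (\<phi> k) x) powr p \<partial>N) \<longlonglongrightarrow> 0"
    by (rule W1p0E[OF W]) (rule that)
  have D: "Dv \<in> borel_measurable N" "integrable N (\<lambda>x. norm (Dv x) powr p)"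
    using \<phi>(2) by (auto simp: Lp_on_def)
  have "AE x in N. norm (Dv x) powr p = norm (g x) powr p"
    using ae by eventually_elim simp
  then have "integrable N (\<lambda>x. norm (g x) powr p)"
    using D g by (subst integrable_cong_AE[symmetric]) auto
  then have Lg: "Lp_on \<Omega> p g" using g by (simp add: Lp_on_def)
  have "(\<integral>x. norm (Dv x - gradient (\<phi> k) x) powr p \<partial>N) = (\<integral>x. norm (g x - gradient (\<phi> k) x) powr p \<partial>N)" for k
  proof (rule integral_cong_AE)
    show "(\<lambda>x. norm (Dv x - gradient (\<phi> k) x) powr p) \<in> borel_measurable N"
      "(\<lambda>x. norm (g x - gradient (\<phi> k) x) powr p) \<in> borel_measurable N"
      using D g test_function_measurable[OF \<phi>(4)] by auto
    show "AE x in N. norm (Dv x - gradient (\<phi> k) x) powr p = norm (g x - gradient (\<phi> k) x) powr p"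
      using ae by eventually_elim simp
  qed
  then show ?thesis using W1p0I[OF p \<phi>(1) Lg \<phi>(4,5)] \<phi>(6) by simp
qed

end

context bounded_open_set
begin

text \<open>The approximating test functions are \<open>\<eta> G(\<phi> k)\<close>, where \<open>\<phi> k\<close> approximates \<open>u\<close>. Since
  \<open>Du\<close> is bounded and \<open>G'\<close> is Lipschitz, \<open>G'(u) Du - G'(\<phi> k) \<nabla>\<phi> k\<close> is
  controlled pointwise by \<open>u - \<phi> k\<close> and \<open>Du - \<nabla>\<phi> k\<close>, without passing to
  subsequences. The smoothness of \<open>G\<close> is stated through its effect on \<open>C^k\<close> functions.\<close>

lemma W1p0_composition:
  assumes W: "W1p0 \<Omega> p u Du" and p: "p \<ge> 1" and M: "AE x in N. norm (Du x) \<le> M"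
    and \<eta>: "test_function \<Omega> \<eta>"
    and G: "\<And>k \<phi>. Ck_on k \<phi> UNIV \<Longrightarrow> Ck_on k (\<lambda>x::real^'n. G (\<phi> x)) UNIV" "\<And>s. (G has_real_derivative G' s) (at s)"
      "\<And>s. \<bar>G s\<bar> \<le> B" "\<And>s. \<bar>G' s\<bar> \<le> B" "\<And>s r. \<bar>G' s - G' r\<bar> \<le> B * \<bar>s - r\<bar>"
  shows "W1p0 \<Omega> p (\<lambda>x. \<eta> x * G (u x)) (\<lambda>x. G (u x) *\<^sub>R gradient \<eta> x + (\<eta> x * G' (u x)) *\<^sub>R Du x)"
proof -
  let ?v = "\<lambda>x. \<eta> x * G (u x)"
  let ?Dv = "\<lambda>x. G (u x) *\<^sub>R gradient \<eta> x + (\<eta> x * G' (u x)) *\<^sub>R Du x"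
  obtain \<phi> where \<phi>: "Lp_on \<Omega> p u" "Lp_on \<Omega> p Du" "weak_gradient \<Omega> u Du" "\<And>k::nat. test_function \<Omega> (\<phi> k)"
    "(\<lambda>k. \<integral>x. \<bar>u x - \<phi> k x\<bar> powr p \<partial>N) \<longlonglongrightarrow> 0"
    "(\<lambda>k. \<integral>x. norm (Du x - gradient (\<phi> k) x) powr p \<partial>N) \<longlonglongrightarrow> 0"
    by (rule W1p0E[OF W]) (rule that)
  obtain K where K: "compact K" "K \<subseteq> \<Omega>" "\<And>x. x \<notin> K \<Longrightarrow> \<eta> x = 0"
    "\<And>x. x \<notin> K \<Longrightarrow> gradient \<eta> x = 0" "\<And>x. GDERIV \<eta> x :> gradient \<eta> x"
    "continuous_on UNIV \<eta>" "continuous_on UNIV (gradient \<eta>)"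
    by (rule test_functionE[OF \<eta>]) (rule that)
  obtain A where A: "A \<ge> 0" "\<And>x. \<bar>\<eta> x\<bar> \<le> A" "\<And>x. norm (gradient \<eta> x) \<le> A"
    by (rule test_function_bounded[OF \<eta>]) (rule that)
  have B: "B \<ge> 0" using G(3)[of 0] by linarith
  have L: "Lp_on \<Omega> p (\<phi> k)" "Lp_on \<Omega> p (gradient (\<phi> k))" for k
    using test_function_Lp[OF \<phi>(4)] p by auto
  have [measurable]: "u \<in> borel_measurable N" "Du \<in> borel_measurable N" "\<eta> \<in> borel_measurable N"
    "gradient \<eta> \<in> borel_measurable N"
    using \<phi>(1,2) test_function_measurable[OF \<eta>] by (auto simp: Lp_on_def)
  have [measurable]: "\<phi> k \<in> borel_measurable N" "gradient (\<phi> k) \<in> borel_measurable N" for k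
    using test_function_measurable[OF \<phi>(4)] by auto
  have "continuous_on UNIV G" "continuous_on UNIV G'"
  proof -
    show "continuous_on UNIV G"
      by (intro continuous_at_imp_continuous_on ballI DERIV_isCont[OF G(2)])
    have "B-lipschitz_on UNIV G'" using G(5) B by (intro lipschitz_onI) (auto simp: dist_real_def)
    then show "continuous_on UNIV G'" by (rule lipschitz_on_continuous_on)
  qed
  then have [measurable]: "G \<in> borel_measurable borel" "G' \<in> borel_measurable borel"
    by (auto intro: borel_measurable_continuous_onI)
  have M': "AE x in N. norm (Du x) \<le> \<bar>M\<bar>" using M by eventually_elim auto
  have Lv: "Lp_on \<Omega> p ?v"
  proof (rule Lp_on_bounded)
    show "?v \<in> borel_measurable N" by measurable
    show "AE x in N. norm (?v x) \<le> A * B"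
      using A G(3) by (intro AE_I2) (auto simp: abs_mult intro!: mult_mono)
  qed (use p in simp)
  have LDv: "Lp_on \<Omega> p ?Dv"
  proof (rule Lp_on_bounded)
    show "?Dv \<in> borel_measurable N" by measurable
    show "AE x in N. norm (?Dv x) \<le> B * A + A * B * \<bar>M\<bar>"
      using M'
    proof eventually_elim
      case (elim x)
      have "norm (?Dv x) \<le> \<bar>G (u x)\<bar> * norm (gradient \<eta> x) + \<bar>\<eta> x\<bar> * \<bar>G' (u x)\<bar> * norm (Du x)"
        by (rule order_trans[OF norm_triangle_ineq]) (simp add: abs_mult)
      also have "\<dots> \<le> B * A + A * B * \<bar>M\<bar>"
        by (intro add_mono mult_mono G A elim) (use A B in simp_all)
      finally show ?case .
    qed
  qed (use p in simp)
  define \<phi>' where "\<phi>' k x = \<eta> x * G (\<phi> k x)" for k x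
  have t: "test_function \<Omega> (\<phi>' k)" for k
    unfolding \<phi>'_def
    by (rule test_function_mult_smooth[OF \<eta>])
      (use \<phi>(4)[of k] in \<open>auto simp: smooth_on_def test_function_def intro: G(1)\<close>)
  have grad: "gradient (\<phi>' k) x = G (\<phi> k x) *\<^sub>R gradient \<eta> x + (\<eta> x * G' (\<phi> k x)) *\<^sub>R gradient (\<phi> k) x" for k x
  proof -
    have g: "GDERIV (\<phi> k) x :> gradient (\<phi> k) x"
      using \<phi>(4)[of k] smooth_on_GDERIV unfolding test_function_def by blast
    show ?thesis
      unfolding \<phi>'_def
      using GDERIV_mult[OF K(5)[of x] GDERIV_DERIV_compose[OF g G(2)]]
      by (intro gradient_eq) (simp add: add.commute)
  qed
  have Lip: "\<bar>G s - G r\<bar> \<le> B * \<bar>s - r\<bar>" for s r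
    using field_differentiable_bound[of UNIV G G' B s r] G(2,4) by simp
  have small: "(\<lambda>k. c * ((\<integral>x. \<bar>u x - \<phi> k x\<bar> powr p \<partial>N) + (\<integral>x. norm (Du x - gradient (\<phi> k) x) powr p \<partial>N))) \<longlonglongrightarrow> 0" for c
    using tendsto_mult_left[OF tendsto_add[OF \<phi>(5,6)], of c] by simp
  have pI: "integrable N (\<lambda>x. \<bar>u x - \<phi> k x\<bar> powr p)" "integrable N (\<lambda>x. norm (Du x - gradient (\<phi> k) x) powr p)" for k
    using Lp_on_diff_integrable[OF \<phi>(1) L(1)] Lp_on_diff_integrable[OF \<phi>(2) L(2)] p by auto
  show ?thesis
  proof (rule W1p0I[OF p Lv LDv t])
    show "(\<lambda>k. \<integral>x. \<bar>?v x - \<phi>' k x\<bar> powr p \<partial>N) \<longlonglongrightarrow> 0"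
    proof (rule Lim_null_comparison[OF _ small[of "(A * B) powr p"]], intro always_eventually allI)
      fix k
      have "(\<integral>x. \<bar>?v x - \<phi>' k x\<bar> powr p \<partial>N) \<le> (\<integral>x. (A * B) powr p * \<bar>u x - \<phi> k x\<bar> powr p \<partial>N)"
      proof (rule integral_mono_AE')
        show "integrable N (\<lambda>x. (A * B) powr p * \<bar>u x - \<phi> k x\<bar> powr p)" using pI by simp
        show "AE x in N. \<bar>?v x - \<phi>' k x\<bar> powr p \<le> (A * B) powr p * \<bar>u x - \<phi> k x\<bar> powr p"
        proof (intro AE_I2)
          fix x
          have "\<bar>?v x - \<phi>' k x\<bar> = \<bar>\<eta> x\<bar> * \<bar>G (u x) - G (\<phi> k x)\<bar>"
            by (simp add: \<phi>'_def right_diff_distrib[symmetric] abs_mult)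
          also have "\<dots> \<le> A * (B * \<bar>u x - \<phi> k x\<bar>)" using A Lip by (intro mult_mono) auto
          finally have "\<bar>?v x - \<phi>' k x\<bar> powr p \<le> (A * B * \<bar>u x - \<phi> k x\<bar>) powr p"
            using p by (intro powr_mono2) (auto simp: mult.assoc)
          then show "\<bar>?v x - \<phi>' k x\<bar> powr p \<le> (A * B) powr p * \<bar>u x - \<phi> k x\<bar> powr p"
            using A(1) B by (simp add: powr_mult)
        qed
      qed auto
      also have "\<dots> \<le> (A * B) powr p * ((\<integral>x. \<bar>u x - \<phi> k x\<bar> powr p \<partial>N) + (\<integral>x. norm (Du x - gradient (\<phi> k) x) powr p \<partial>N))"
        by (simp add: mult_left_mono)
      finally show "norm (\<integral>x. \<bar>?v x - \<phi>' k x\<bar> powr p \<partial>N) \<le>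
          (A * B) powr p * ((\<integral>x. \<bar>u x - \<phi> k x\<bar> powr p \<partial>N) + (\<integral>x. norm (Du x - gradient (\<phi> k) x) powr p \<partial>N))"
        by simp
    qed
    define C where "C = A * B + A * B * \<bar>M\<bar>"
    have C: "C \<ge> 0" using A B by (simp add: C_def)
    show "(\<lambda>k. \<integral>x. norm (?Dv x - gradient (\<phi>' k) x) powr p \<partial>N) \<longlonglongrightarrow> 0"
    proof (rule Lim_null_comparison[OF _ small[of "C powr p * 2 powr p"]], intro always_eventually allI)
      fix k
      have "(\<integral>x. norm (?Dv x - gradient (\<phi>' k) x) powr p \<partial>N)
        \<le> (\<integral>x. C powr p * 2 powr p * (\<bar>u x - \<phi> k x\<bar> powr p + norm (Du x - gradient (\<phi> k) x) powr p) \<partial>N)"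
      proof (rule integral_mono_AE')
        show "integrable N (\<lambda>x. C powr p * 2 powr p * (\<bar>u x - \<phi> k x\<bar> powr p + norm (Du x - gradient (\<phi> k) x) powr p))"
          using pI by simp
        show "AE x in N. norm (?Dv x - gradient (\<phi>' k) x) powr p \<le>
            C powr p * 2 powr p * (\<bar>u x - \<phi> k x\<bar> powr p + norm (Du x - gradient (\<phi> k) x) powr p)"
          using M'
        proof eventually_elim
          case (elim x)
          let ?a = "\<bar>u x - \<phi> k x\<bar>" and ?b = "norm (Du x - gradient (\<phi> k) x)"
          have eq: "?Dv x - gradient (\<phi>' k) x = (G (u x) - G (\<phi> k x)) *\<^sub>R gradient \<eta> x
              + ((\<eta> x * (G' (u x) - G' (\<phi> k x))) *\<^sub>R Du x + (\<eta> x * G' (\<phi> k x)) *\<^sub>R (Du x - gradient (\<phi> k) x))"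
            by (simp add: grad algebra_simps)
          have "norm (?Dv x - gradient (\<phi>' k) x) \<le> \<bar>G (u x) - G (\<phi> k x)\<bar> * norm (gradient \<eta> x)
              + (\<bar>\<eta> x\<bar> * \<bar>G' (u x) - G' (\<phi> k x)\<bar> * norm (Du x) + \<bar>\<eta> x\<bar> * \<bar>G' (\<phi> k x)\<bar> * ?b)"
            unfolding eq
            by (rule order_trans[OF norm_triangle_ineq add_mono[OF _ order_trans[OF norm_triangle_ineq add_mono]]])
              (simp_all add: abs_mult)
          also have "\<dots> \<le> (B * ?a) * A + (A * (B * ?a) * \<bar>M\<bar> + A * B * ?b)"
          proof -
            have "\<bar>G (u x) - G (\<phi> k x)\<bar> * norm (gradient \<eta> x) \<le> (B * ?a) * A"
              by (rule mult_mono[OF Lip A(3)]) (use B in simp_all)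
            moreover have "\<bar>\<eta> x\<bar> * \<bar>G' (u x) - G' (\<phi> k x)\<bar> \<le> A * (B * ?a)"
              by (rule mult_mono[OF A(2) G(5)]) (use A in simp_all)
            then have "\<bar>\<eta> x\<bar> * \<bar>G' (u x) - G' (\<phi> k x)\<bar> * norm (Du x) \<le> A * (B * ?a) * \<bar>M\<bar>"
              by (rule mult_mono[OF _ elim]) (use A B in simp_all)
            moreover have "\<bar>\<eta> x\<bar> * \<bar>G' (\<phi> k x)\<bar> \<le> A * B"
              by (rule mult_mono[OF A(2) G(4)]) (use A in simp_all)
            then have "\<bar>\<eta> x\<bar> * \<bar>G' (\<phi> k x)\<bar> * ?b \<le> A * B * ?b"
              by (rule mult_right_mono) simp
            ultimately show ?thesis by linarith
          qed
          also have "\<dots> \<le> C * (?a - (- ?b))"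
            using A B by (simp add: C_def algebra_simps)
          finally have 1: "norm (?Dv x - gradient (\<phi>' k) x) \<le> C * (?a + ?b)" by simp
          have 2: "(?a + ?b) powr p \<le> 2 powr p * (?a powr p + ?b powr p)"
            using norm_diff_powr_le[of p ?a "- ?b"] p by simp
          have "norm (?Dv x - gradient (\<phi>' k) x) powr p \<le> (C * (?a + ?b)) powr p"
            using p by (intro powr_mono2 1) auto
          also have "\<dots> = C powr p * (?a + ?b) powr p" by (simp add: powr_mult C)
          also have "\<dots> \<le> C powr p * (2 powr p * (?a powr p + ?b powr p))"
            by (intro mult_left_mono 2) simp
          finally show ?case by (simp add: mult.assoc)
        qed
      qed simp
      also have "\<dots> = C powr p * 2 powr p * ((\<integral>x. \<bar>u x - \<phi> k x\<bar> powr p \<partial>N) + (\<integral>x. norm (Du x - gradient (\<phi> k) x) powr p \<partial>N))"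
        using pI by simp
      finally show "norm (\<integral>x. norm (?Dv x - gradient (\<phi>' k) x) powr p \<partial>N) \<le>
          C powr p * 2 powr p * ((\<integral>x. \<bar>u x - \<phi> k x\<bar> powr p \<partial>N) + (\<integral>x. norm (Du x - gradient (\<phi> k) x) powr p \<partial>N))"
        by simp
    qed
  qed
qed

text \<open>The divergence theorem for the vector field \<open>u(x) (x - a)\<close>: zero boundary values enter only
  through the approximating test functions.\<close>

lemma W1p0_divergence:
  assumes W: "W1p0 \<Omega> p u Du" and p: "p \<ge> 1"
  shows "real CARD('n) * (\<integral>x. u x \<partial>N) + (\<integral>x. Du x \<bullet> (x - a) \<partial>N) = 0"
proof -
  obtain \<phi> where \<phi>: "Lp_on \<Omega> p u" "Lp_on \<Omega> p Du" "weak_gradient \<Omega> u Du" "\<And>k::nat. test_function \<Omega> (\<phi> k)"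
    "(\<lambda>k. \<integral>x. \<bar>u x - \<phi> k x\<bar> powr p \<partial>N) \<longlonglongrightarrow> 0"
    "(\<lambda>k. \<integral>x. norm (Du x - gradient (\<phi> k) x) powr p \<partial>N) \<longlonglongrightarrow> 0"
    by (rule W1p0E[OF W]) (rule that)
  have L: "Lp_on \<Omega> p (\<phi> k)" "Lp_on \<Omega> p (gradient (\<phi> k))" for k
    using test_function_Lp[OF \<phi>(4)] p by auto
  obtain R0 where R0: "\<And>x. x \<in> \<Omega> \<Longrightarrow> norm x \<le> R0" using bounded_\<Omega> by (auto simp: bounded_iff)
  define R where "R = R0 + norm a"
  have R: "\<bar>(x - a) $ i\<bar> \<le> R" if "x \<in> space N" for x i
    using component_le_norm_cart[of "x - a" i] norm_triangle_ineq4[of x a] R0[of x] that by (simp add: R_def)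
  have c: "continuous_on UNIV (\<lambda>x. (x - a) $ i)" for i by (intro continuous_intros)
  have m: "(\<lambda>x. (x - a) $ i) \<in> borel_measurable N" for i
    by (rule borel_measurable_lebesgue_on_continuous[OF c])
  have i0: "(\<integral>x. u x \<partial>N) + (\<integral>x. Du x $ i * (x - a) $ i \<partial>N) = 0" for i
  proof -
    have "(\<lambda>k. \<integral>x. \<phi> k x * 1 \<partial>N) \<longlonglongrightarrow> (\<integral>x. u x * 1 \<partial>N)"
      by (rule tendsto_integral_mult_bounded[OF Lp_integrable[OF L(1) p] Lp_integrable[OF \<phi>(1) p], where B=1])
        (use Lp_tendsto_imp_L1_tendsto[OF \<phi>(1) L(1) p] \<phi>(5) in auto)
    moreover have "(\<lambda>k. \<integral>x. gradient (\<phi> k) x $ i * (x - a) $ i \<partial>N) \<longlonglongrightarrow> (\<integral>x. Du x $ i * (x - a) $ i \<partial>N)"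
      by (rule tendsto_integral_mult_bounded[OF Lp_component_integrable[OF L(2) p]
            Lp_component_integrable[OF \<phi>(2) p] L1_tendsto_components[OF \<phi>(2) L(2) p \<phi>(6)] m R])
    ultimately have "(\<lambda>k. (\<integral>x. \<phi> k x \<partial>N) + (\<integral>x. gradient (\<phi> k) x $ i * (x - a) $ i \<partial>N)) \<longlonglongrightarrow>
        (\<integral>x. u x \<partial>N) + (\<integral>x. Du x $ i * (x - a) $ i \<partial>N)"
      by (simp add: tendsto_add)
    moreover have "(\<integral>x. \<phi> k x \<partial>N) + (\<integral>x. gradient (\<phi> k) x $ i * (x - a) $ i \<partial>N) = 0" for k
    proof -
      have d: "GDERIV (\<lambda>x. (x - a) $ i) x :> axis i 1" for x
      proof -
        have "GDERIV (\<lambda>x. (x - a) \<bullet> axis i 1) x :> axis i 1"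
          unfolding gderiv_def by (auto intro!: derivative_eq_intros)
        then show ?thesis by (simp add: inner_axis)
      qed
      have "(\<integral>x. (x - a) $ i * gradient (\<phi> k) x $ i + axis i 1 $ i * \<phi> k x \<partial>N) = 0"
        by (rule integral_product_test_function[OF open_\<Omega> d continuous_on_const \<phi>(4)])
      then have "(\<integral>x. gradient (\<phi> k) x $ i * (x - a) $ i + \<phi> k x \<partial>N) = 0"
        by (simp add: mult.commute)
      moreover have "integrable N (\<lambda>x. gradient (\<phi> k) x $ i * (x - a) $ i)"
        by (rule integrable_mult_bounded[OF Lp_component_integrable[OF L(2) p] m R])
      ultimately show ?thesis
        using Lp_integrable[OF L(1) p, of k] by simp
    qed
    ultimately have "(\<lambda>k::nat. 0::real) \<longlonglongrightarrow> (\<integral>x. u x \<partial>N) + (\<integral>x. Du x $ i * (x - a) $ i \<partial>N)" by simp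
    then show ?thesis by (rule LIMSEQ_unique) (rule tendsto_const)
  qed
  have "(\<integral>x. Du x \<bullet> (x - a) \<partial>N) = (\<Sum>i\<in>UNIV. \<integral>x. Du x $ i * (x - a) $ i \<partial>N)"
    unfolding inner_vec_def inner_real_def
    by (rule Bochner_Integration.integral_sum)
      (rule integrable_mult_bounded[OF Lp_component_integrable[OF \<phi>(2) p] m R])
  also have "\<dots> = (\<Sum>i\<in>(UNIV::'n set). - (\<integral>x. u x \<partial>N))"
    using i0 by (intro sum.cong refl) (simp add: eq_neg_iff_add_eq_0 add.commute)
  finally show ?thesis by simp
qed

end

section \<open>Star-shaped sets and dilations\<close>

locale star_shaped_set = bounded_open_set \<Omega> for \<Omega> :: "(real^'n) set" +
  fixes a :: "real^'n"
  assumes star: "\<And>x t. x \<in> \<Omega> \<Longrightarrow> 0 \<le> t \<Longrightarrow> t \<le> 1 \<Longrightarrow> (1 - t) *\<^sub>R a + t *\<^sub>R x \<in> \<Omega>"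
begin

definition dil :: "real \<Rightarrow> real^'n \<Rightarrow> real^'n" where
  "dil t x = (1 - t) *\<^sub>R a + t *\<^sub>R x"

lemma dil_dil: "dil s (dil t x) = dil (s * t) x"
  by (simp add: dil_def algebra_simps)

lemma dil_1 [simp]: "dil 1 x = x"
  by (simp add: dil_def)

lemma dil_minus: "dil t x - a = t *\<^sub>R (x - a)"
  by (simp add: dil_def algebra_simps)

lemma dil_star: "x \<in> \<Omega> \<Longrightarrow> 0 \<le> t \<Longrightarrow> t \<le> 1 \<Longrightarrow> dil t x \<in> \<Omega>"
  unfolding dil_def by (rule star)

text \<open>The competitor \<open>u(a + (x - a) / t)\<close> with which \<open>u\<close> is compared. It lives on the set \<open>dil t ` \<Omega>\<close>,
  which lies inside \<open>\<Omega>\<close> because \<open>\<Omega>\<close> is star-shaped.\<close>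

definition shrink :: "real \<Rightarrow> (real^'n \<Rightarrow> 'b::zero) \<Rightarrow> real^'n \<Rightarrow> 'b" where
  "shrink t f x = (if dil (1 / t) x \<in> \<Omega> then f (dil (1 / t) x) else 0)"

lemma dil_inverse_notin:
  assumes "0 < t" "t \<le> 1" "x \<notin> \<Omega>" shows "dil (1 / t) x \<notin> \<Omega>"
  using dil_star[of "dil (1 / t) x" t] assms by (auto simp: dil_dil)

lemma measurable_dil: "t \<noteq> 0 \<Longrightarrow> dil t \<in> lebesgue \<rightarrow>\<^sub>M lebesgue"
  unfolding dil_def[abs_def] by (rule measurable_lebesgue_homothety)

lemma measurable_N_shrink:
  fixes f :: "real^'n \<Rightarrow> 'b::{real_normed_vector, second_countable_topology}"
  assumes "f \<in> borel_measurable N" "0 < t"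
  shows "shrink t f \<in> borel_measurable N"
proof -
  have "(\<lambda>x. indicator \<Omega> x *\<^sub>R f x) \<in> borel_measurable lebesgue"
    using assms(1) borel_measurable_restrict_space_iff[of \<Omega> lebesgue f] open_\<Omega> by simp
  then have "(\<lambda>x. indicator \<Omega> (dil (1 / t) x) *\<^sub>R f (dil (1 / t) x)) \<in> borel_measurable lebesgue"
    by (rule measurable_compose[OF measurable_dil, rotated]) (use assms(2) in simp)
  also have "(\<lambda>x. indicator \<Omega> (dil (1 / t) x) *\<^sub>R f (dil (1 / t) x)) = shrink t f"
    by (auto simp: shrink_def indicator_def)
  finally show ?thesis by (rule measurable_restrict_space1)
qed

lemma measurable_N_dil:
  fixes f :: "real^'n \<Rightarrow> 'b::{real_normed_vector, second_countable_topology}"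
  assumes "f \<in> borel_measurable N" "0 < t" "t \<le> 1"
  shows "(\<lambda>x. f (dil t x)) \<in> borel_measurable N"
proof -
  have "(\<lambda>x. indicator \<Omega> x *\<^sub>R f x) \<in> borel_measurable lebesgue"
    using assms(1) borel_measurable_restrict_space_iff[of \<Omega> lebesgue f] open_\<Omega> by simp
  then have "(\<lambda>x. indicator \<Omega> (dil t x) *\<^sub>R f (dil t x)) \<in> borel_measurable lebesgue"
    by (rule measurable_compose[OF measurable_dil, rotated]) (use assms(2) in simp)
  then have "(\<lambda>x. indicator \<Omega> (dil t x) *\<^sub>R f (dil t x)) \<in> borel_measurable N"
    by (rule measurable_restrict_space1)
  then show ?thesis
    by (rule measurable_cong[THEN iffD1, rotated]) (use dil_star assms in auto)
qed

lemma integral_shrink: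
  fixes f :: "real^'n \<Rightarrow> real"
  assumes "f \<in> borel_measurable N" "0 < t" "t \<le> 1"
  shows "(\<integral>x. shrink t f x \<partial>N) = t ^ CARD('n) * (\<integral>x. f x \<partial>N)"
proof -
  have m: "(\<lambda>x. indicator \<Omega> x * f x) \<in> borel_measurable lebesgue"
    using assms(1) borel_measurable_restrict_space_iff[of \<Omega> lebesgue f] open_\<Omega> by simp
  have "(\<integral>x. shrink t f x \<partial>N) = (\<integral>x. indicator \<Omega> x * shrink t f x \<partial>lebesgue)"
    by (rule integral_lebesgue_on[OF \<Omega>_sets])
  also have "(\<lambda>x. indicator \<Omega> x * shrink t f x) = (\<lambda>x. indicator \<Omega> (dil (1 / t) x) * f (dil (1 / t) x))"
    using dil_inverse_notin assms by (intro ext) (auto simp: shrink_def indicator_def)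
  also have "(\<integral>x. indicator \<Omega> (dil (1 / t) x) * f (dil (1 / t) x) \<partial>lebesgue) = (\<integral>x. indicator \<Omega> x * f x \<partial>lebesgue) / (1 / t) ^ DIM(real^'n)"
    unfolding dil_def using assms m by (intro integral_lebesgue_homothety) auto
  finally show ?thesis using assms by (simp add: integral_lebesgue_on[OF \<Omega>_sets] power_divide)
qed

lemma integrable_shrink:
  fixes f :: "real^'n \<Rightarrow> real"
  assumes "integrable N f" "0 < t" "t \<le> 1"
  shows "integrable N (shrink t f)"
proof -
  have m: "integrable lebesgue (\<lambda>x. indicator \<Omega> x * f x)"
    using assms(1) integrable_lebesgue_on[OF \<Omega>_sets] by simp
  have "integrable lebesgue (\<lambda>x. indicator \<Omega> (dil (1 / t) x) * f (dil (1 / t) x))"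
    unfolding dil_def using assms by (intro integrable_lebesgue_homothety[OF _ m]) auto
  also have "(\<lambda>x. indicator \<Omega> (dil (1 / t) x) * f (dil (1 / t) x)) = (\<lambda>x. indicator \<Omega> x * shrink t f x)"
    using dil_inverse_notin assms by (intro ext) (auto simp: shrink_def indicator_def)
  finally show ?thesis by (simp add: integrable_lebesgue_on[OF \<Omega>_sets])
qed

lemma shrink_test_function:
  assumes \<phi>: "test_function \<Omega> \<phi>" and t: "0 < t" "t \<le> 1"
  shows "test_function \<Omega> (shrink t \<phi>)"
    and "gradient (shrink t \<phi>) x = shrink t (\<lambda>y. (1 / t) *\<^sub>R gradient \<phi> y) x"
proof -
  obtain K where K: "compact K" "K \<subseteq> \<Omega>" "\<And>x. x \<notin> K \<Longrightarrow> \<phi> x = 0"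
    "\<And>x. x \<notin> K \<Longrightarrow> gradient \<phi> x = 0" "\<And>x. GDERIV \<phi> x :> gradient \<phi> x"
    "continuous_on UNIV \<phi>" "continuous_on UNIV (gradient \<phi>)"
    by (rule test_functionE[OF \<phi>]) (rule that)
  have eq: "shrink t \<phi> = (\<lambda>x. \<phi> ((1 - 1 / t) *\<^sub>R a + (1 / t) *\<^sub>R x))"
    using K(2,3) by (intro ext) (auto simp: shrink_def dil_def)
  show "test_function \<Omega> (shrink t \<phi>)"
  proof (rule test_functionI)
    show "smooth_on (shrink t \<phi>) UNIV"
      unfolding eq using \<phi> by (auto simp: smooth_on_def test_function_def intro: Ck_on_affine)
    have "continuous_on K (dil t)" unfolding dil_def by (intro continuous_intros)
    then show "compact (dil t ` K)" using K(1) by (rule compact_continuous_image)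
    show "dil t ` K \<subseteq> \<Omega>" using K(2) dil_star t by auto
    fix x assume "x \<notin> dil t ` K"
    then have "dil (1 / t) x \<notin> K"
      using t dil_dil[of t "1 / t" x] image_eqI[of x "dil t" "dil (1 / t) x" K] by auto
    then show "shrink t \<phi> x = 0" using K(3) by (simp add: shrink_def)
  qed
  have "GDERIV (shrink t \<phi>) x :> (1 / t) *\<^sub>R gradient \<phi> (dil (1 / t) x)"
    unfolding eq dil_def by (rule GDERIV_affine[OF K(5)])
  then have "gradient (shrink t \<phi>) x = (1 / t) *\<^sub>R gradient \<phi> (dil (1 / t) x)" by (rule gradient_eq)
  then show "gradient (shrink t \<phi>) x = shrink t (\<lambda>y. (1 / t) *\<^sub>R gradient \<phi> y) x"
    using K(2,4) by (auto simp: shrink_def)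
qed

lemma Lp_on_shrink:
  fixes f :: "real^'n \<Rightarrow> 'b::{real_normed_vector, second_countable_topology}"
  assumes "Lp_on \<Omega> p f" "0 < t" "t \<le> 1"
  shows "Lp_on \<Omega> p (shrink t f)"
proof -
  have "integrable N (shrink t (\<lambda>x. norm (f x) powr p))"
    using assms by (intro integrable_shrink) (auto simp: Lp_on_def)
  moreover have "shrink t (\<lambda>x. norm (f x) powr p) = (\<lambda>x. norm (shrink t f x) powr p)"
    by (intro ext) (simp add: shrink_def)
  ultimately show ?thesis using assms measurable_N_shrink by (auto simp: Lp_on_def)
qed

lemma W1p0_shrink:
  assumes W: "W1p0 \<Omega> p u Du" and p: "p \<ge> 1" and t: "0 < t" "t \<le> 1"
  shows "W1p0 \<Omega> p (shrink t u) (shrink t (\<lambda>x. (1 / t) *\<^sub>R Du x))"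
proof -
  obtain \<phi> where \<phi>: "Lp_on \<Omega> p u" "Lp_on \<Omega> p Du" "weak_gradient \<Omega> u Du" "\<And>k::nat. test_function \<Omega> (\<phi> k)"
    "(\<lambda>k. \<integral>x. \<bar>u x - \<phi> k x\<bar> powr p \<partial>N) \<longlonglongrightarrow> 0"
    "(\<lambda>k. \<integral>x. norm (Du x - gradient (\<phi> k) x) powr p \<partial>N) \<longlonglongrightarrow> 0"
    by (rule W1p0E[OF W]) (rule that)
  have [measurable]: "u \<in> borel_measurable N" "Du \<in> borel_measurable N"
    using \<phi>(1,2) by (auto simp: Lp_on_def)
  have [measurable]: "\<phi> k \<in> borel_measurable N" "gradient (\<phi> k) \<in> borel_measurable N" for k
    using test_function_measurable[OF \<phi>(4)] by auto
  have Lc: "Lp_on \<Omega> p (\<lambda>x. (1 / t) *\<^sub>R Du x)"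
    using \<phi>(2) t by (auto simp: Lp_on_def powr_mult powr_divide)
  show ?thesis
  proof (rule W1p0I[OF p Lp_on_shrink[OF \<phi>(1) t] Lp_on_shrink[OF Lc t] shrink_test_function(1)[OF \<phi>(4) t]])
    have "(\<lambda>x. \<bar>shrink t u x - shrink t (\<phi> k) x\<bar> powr p) = shrink t (\<lambda>x. \<bar>u x - \<phi> k x\<bar> powr p)" for k
      by (intro ext) (simp add: shrink_def)
    moreover have "(\<lambda>x. \<bar>u x - \<phi> k x\<bar> powr p) \<in> borel_measurable N" for k by measurable
    ultimately have "(\<integral>x. \<bar>shrink t u x - shrink t (\<phi> k) x\<bar> powr p \<partial>N) = t ^ CARD('n) * (\<integral>x. \<bar>u x - \<phi> k x\<bar> powr p \<partial>N)" for k
      using integral_shrink[OF _ t] by simp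
    then show "(\<lambda>k. \<integral>x. \<bar>shrink t u x - shrink t (\<phi> k) x\<bar> powr p \<partial>N) \<longlonglongrightarrow> 0"
      using tendsto_mult_left[OF \<phi>(5), of "t ^ CARD('n)"] by simp
    have "(\<lambda>x. norm (shrink t (\<lambda>x. (1 / t) *\<^sub>R Du x) x - gradient (shrink t (\<phi> k)) x) powr p) =
        shrink t (\<lambda>x. (1 / t) powr p * norm (Du x - gradient (\<phi> k) x) powr p)" for k
      using t by (intro ext)
        (auto simp: shrink_test_function(2)[OF \<phi>(4) t] shrink_def scaleR_diff_right[symmetric] powr_mult powr_divide
          simp del: scaleR_diff_right)
    moreover have "(\<lambda>x. (1 / t) powr p * norm (Du x - gradient (\<phi> k) x) powr p) \<in> borel_measurable N" for k by measurable
    ultimately have "(\<integral>x. norm (shrink t (\<lambda>x. (1 / t) *\<^sub>R Du x) x - gradient (shrink t (\<phi> k)) x) powr p \<partial>N)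
        = t ^ CARD('n) * ((1 / t) powr p * (\<integral>x. norm (Du x - gradient (\<phi> k) x) powr p \<partial>N))" for k
      using integral_shrink[OF _ t] by simp
    then show "(\<lambda>k. \<integral>x. norm (shrink t (\<lambda>x. (1 / t) *\<^sub>R Du x) x - gradient (shrink t (\<phi> k)) x) powr p \<partial>N) \<longlonglongrightarrow> 0"
      using tendsto_mult_left[OF tendsto_mult_left[OF \<phi>(6), of "(1 / t) powr p"], of "t ^ CARD('n)"] by simp
  qed
qed

end

lemma one_minus_power_quotient:
  fixes t :: "nat \<Rightarrow> real"
  assumes "\<And>k. t k < 1" "t \<longlonglongrightarrow> 1"
  shows "(\<lambda>k. (1 - t k ^ n) / (1 - t k)) \<longlonglongrightarrow> real n"
proof -
  have "(1 - t k ^ n) / (1 - t k) = (\<Sum>i<n. t k ^ i)" for k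
    using assms(1)[of k] by (simp add: sum_gp_strict divide_simps)
  moreover have "(\<lambda>k. \<Sum>i<n. t k ^ i) \<longlonglongrightarrow> (\<Sum>i<n. 1 ^ i)"
    by (intro tendsto_intros assms(2))
  ultimately show ?thesis by simp
qed

context star_shaped_set
begin

definition radius :: real where
  "radius = (SOME R. R > 0 \<and> (\<forall>x\<in>\<Omega>. norm (x - a) \<le> R))"

lemma radius: "radius > 0" "x \<in> \<Omega> \<Longrightarrow> norm (x - a) \<le> radius"
proof -
  obtain R where R: "R > 0" "\<And>x. x \<in> \<Omega> \<Longrightarrow> norm x \<le> R"
    using bounded_\<Omega> by (auto simp: bounded_pos)
  have "norm (x - a) \<le> R + norm a" if "x \<in> \<Omega>" for x
    using R(2)[OF that] norm_triangle_ineq4[of x a] by linarith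
  then have "R + norm a > 0 \<and> (\<forall>x\<in>\<Omega>. norm (x - a) \<le> R + norm a)"
    using R(1) by (auto intro: add_pos_nonneg)
  then have "radius > 0 \<and> (\<forall>x\<in>\<Omega>. norm (x - a) \<le> radius)" unfolding radius_def by (rule someI)
  then show "radius > 0" "x \<in> \<Omega> \<Longrightarrow> norm (x - a) \<le> radius" by auto
qed

lemma radial_Lipschitz:
  assumes "\<And>x. x \<in> \<Omega> \<Longrightarrow> GDERIV v x :> g x" "\<And>x. x \<in> \<Omega> \<Longrightarrow> norm (g x) \<le> B"
    and "x \<in> \<Omega>" "0 \<le> t" "t \<le> 1"
  shows "\<bar>v x - v (dil t x)\<bar> \<le> B * radius * (1 - t)"
proof -
  have sub: "closed_segment a x \<subseteq> \<Omega>" using star[OF assms(3)] by (auto simp: closed_segment_def)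
  have "dil t x \<in> closed_segment a x" using assms by (auto simp: closed_segment_def dil_def)
  then have "\<bar>v x - v (dil t x)\<bar> \<le> B * norm (x - dil t x)"
    using assms(1,2) sub by (intro GDERIV_Lipschitz[of "closed_segment a x"]) auto
  also have "x - dil t x = (1 - t) *\<^sub>R (x - a)" by (simp add: dil_def algebra_simps)
  also have "B * norm \<dots> \<le> B * ((1 - t) * radius)"
  proof (rule mult_left_mono)
    show "norm ((1 - t) *\<^sub>R (x - a)) \<le> (1 - t) * radius"
      using assms(4,5) radius(2)[OF assms(3)] by (simp add: mult_left_mono)
    show "0 \<le> B" using assms(2)[OF assms(3)] norm_ge_zero order_trans by blast
  qed
  finally show ?thesis by (simp add: ac_simps)
qed

lemma radial_difference_quotient:
  assumes "GDERIV v x :> D" and t: "\<And>k::nat. t k < 1" "t \<longlonglongrightarrow> 1"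
  shows "(\<lambda>k. (v x - v (dil (t k) x)) / (1 - t k)) \<longlonglongrightarrow> D \<bullet> (x - a)"
proof -
  have "((\<lambda>s. dil s x) has_derivative (\<lambda>h. h *\<^sub>R (x - a))) (at 1)"
    unfolding dil_def by (auto intro!: derivative_eq_intros simp: algebra_simps)
  then have "((\<lambda>s. v (dil s x)) has_derivative (\<lambda>h. (h *\<^sub>R (x - a)) \<bullet> D)) (at 1)"
    using has_derivative_compose[of "\<lambda>s. dil s x" "\<lambda>h. h *\<^sub>R (x - a)" 1 UNIV v "\<lambda>h. h \<bullet> D"] assms(1)
    unfolding gderiv_def by simp
  moreover have "(\<lambda>h. (h *\<^sub>R (x - a)) \<bullet> D) = (*) (D \<bullet> (x - a))"
    by (intro ext) (simp add: inner_commute)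
  ultimately have "((\<lambda>s. v (dil s x)) has_real_derivative D \<bullet> (x - a)) (at 1)"
    unfolding has_field_derivative_def by (simp only:)
  then have "((\<lambda>h. (v (dil (1 + h) x) - v x) / h) \<longlongrightarrow> D \<bullet> (x - a)) (at 0)"
    by (simp add: DERIV_def)
  moreover have "(\<lambda>k. t k - 1) \<longlonglongrightarrow> 0" using tendsto_diff[OF t(2) tendsto_const, of 1] by simp
  then have "filterlim (\<lambda>k. t k - 1) (at 0) sequentially"
    using t(1) by (auto simp: filterlim_at less_imp_neq)
  ultimately have "(\<lambda>k. (v (dil (1 + (t k - 1)) x) - v x) / (t k - 1)) \<longlonglongrightarrow> D \<bullet> (x - a)"
    by (rule filterlim_compose)
  moreover have "(v (dil (1 + (t k - 1)) x) - v x) / (t k - 1) = (v x - v (dil (t k) x)) / (1 - t k)" for k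
    using t(1)[of k] by (simp add: divide_simps) (simp add: algebra_simps)
  ultimately show ?thesis by simp
qed

text \<open>The part of \<open>\<Omega>\<close> that the dilation of ratio \<open>t < 1\<close> uncovers. It takes the place of the
  boundary: integrals over it, divided by \<open>1 - t\<close>, play the role of boundary integrals.\<close>

definition layer :: "real \<Rightarrow> (real^'n) set" where
  "layer t = {x \<in> \<Omega>. dil (1 / t) x \<notin> \<Omega>}"

lemma layer_sets: "0 < t \<Longrightarrow> layer t \<in> sets N"
proof -
  assume t: "0 < t"
  have "dil (1 / t) -` \<Omega> \<inter> space lebesgue \<in> sets lebesgue"
    using t measurable_sets[OF measurable_dil \<Omega>_sets, of "1 / t"] by simp
  then have "\<Omega> - dil (1 / t) -` \<Omega> \<in> sets lebesgue" using \<Omega>_sets by auto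
  moreover have "\<Omega> - dil (1 / t) -` \<Omega> = layer t" by (auto simp: layer_def)
  ultimately have "layer t \<in> sets lebesgue" by simp
  moreover have "layer t = \<Omega> \<inter> layer t" by (auto simp: layer_def)
  ultimately show ?thesis using \<Omega>_sets sets_restrict_space_iff[of \<Omega> lebesgue "layer t"] by (auto simp: layer_def)
qed

lemma integrable_layer: "integrable N Q \<Longrightarrow> 0 < t \<Longrightarrow> integrable N (\<lambda>x. indicator (layer t) x * (Q x :: real))"
  using integrable_mult_indicator[OF layer_sets, of t Q] by simp

lemma shrink_dil:
  assumes "0 < t" "x \<in> \<Omega>"
  shows "shrink t (\<lambda>y. Q (dil t y)) x = Q x - indicator (layer t) x * (Q x :: real)"
  using assms by (auto simp: shrink_def layer_def indicator_def dil_dil)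

lemma integral_layer:
  fixes Q :: "real^'n \<Rightarrow> real"
  assumes Q: "integrable N Q" and t: "0 < t" "t \<le> 1"
  shows "(\<integral>x. indicator (layer t) x * Q x \<partial>N) = (\<integral>x. Q x \<partial>N) - t ^ CARD('n) * (\<integral>x. Q (dil t x) \<partial>N)"
proof -
  have "t ^ CARD('n) * (\<integral>x. Q (dil t x) \<partial>N) = (\<integral>x. shrink t (\<lambda>y. Q (dil t y)) x \<partial>N)"
    using Q t by (intro integral_shrink[symmetric] measurable_N_dil) auto
  also have "\<dots> = (\<integral>x. Q x - indicator (layer t) x * Q x \<partial>N)"
    using shrink_dil[OF t(1)] by (intro Bochner_Integration.integral_cong) auto
  also have "\<dots> = (\<integral>x. Q x \<partial>N) - (\<integral>x. indicator (layer t) x * Q x \<partial>N)"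
    using Q integrable_layer[OF Q t(1)] by simp
  finally show ?thesis by simp
qed

text \<open>Dominated convergence. The weights \<open>w k\<close> account for a second factor of the integrand that is
  dilated as well.\<close>

lemma radial_differences_tendsto:
  fixes Q :: "real^'n \<Rightarrow> real"
  assumes Q: "Q \<in> borel_measurable N" and d: "d \<in> borel_measurable N"
    and t: "\<And>k::nat. 0 < t k" "\<And>k. t k < 1" "t \<longlonglongrightarrow> 1"
    and lip: "\<And>x k. x \<in> \<Omega> \<Longrightarrow> \<bar>Q x - Q (dil (t k) x)\<bar> \<le> C * (1 - t k)"
    and lim: "AE x in N. (\<lambda>k. (Q x - Q (dil (t k) x)) / (1 - t k)) \<longlonglongrightarrow> d x"
    and w: "\<And>k. w k \<in> borel_measurable N" "\<And>x k. x \<in> \<Omega> \<Longrightarrow> \<bar>w k x\<bar> \<le> B"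
      "\<And>x. x \<in> \<Omega> \<Longrightarrow> (\<lambda>k. w k x) \<longlonglongrightarrow> w' x" and w': "w' \<in> borel_measurable N"
  shows "(\<lambda>k. (\<integral>x. w k x * (Q x - Q (dil (t k) x)) \<partial>N) / (1 - t k)) \<longlonglongrightarrow> (\<integral>x. w' x * d x \<partial>N)"
proof -
  have m: "(\<lambda>x. Q (dil (t k) x)) \<in> borel_measurable N" for k
    using t less_imp_le by (intro measurable_N_dil Q) auto
  have "(\<lambda>k. \<integral>x. w k x * ((Q x - Q (dil (t k) x)) / (1 - t k)) \<partial>N) \<longlonglongrightarrow> (\<integral>x. w' x * d x \<partial>N)"
  proof (rule integral_dominated_convergence[where w="\<lambda>x. B * C"])
    show "(\<lambda>x. w' x * d x) \<in> borel_measurable N" using w' d by (rule borel_measurable_times)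
    show "(\<lambda>x. w k x * ((Q x - Q (dil (t k) x)) / (1 - t k))) \<in> borel_measurable N" for k
      using w(1) Q m by (intro borel_measurable_times borel_measurable_divide borel_measurable_diff) auto
    show "integrable N (\<lambda>x. B * C)" by simp
    show "AE x in N. (\<lambda>k. w k x * ((Q x - Q (dil (t k) x)) / (1 - t k))) \<longlonglongrightarrow> w' x * d x"
      using lim AE_space by eventually_elim (rule tendsto_mult[OF w(3)], simp_all)
    show "AE x in N. norm (w k x * ((Q x - Q (dil (t k) x)) / (1 - t k))) \<le> B * C" for k
    proof (rule AE_I2)
      fix x assume "x \<in> space N"
      then have x: "x \<in> \<Omega>" by simp
      have "\<bar>(Q x - Q (dil (t k) x)) / (1 - t k)\<bar> \<le> C"
        using lip[OF x, of k] t(2)[of k] by (simp add: abs_divide divide_le_eq)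
      then have "\<bar>w k x\<bar> * \<bar>(Q x - Q (dil (t k) x)) / (1 - t k)\<bar> \<le> B * C"
        using w(2)[OF x, of k] by (intro mult_mono) auto
      then show "norm (w k x * ((Q x - Q (dil (t k) x)) / (1 - t k))) \<le> B * C"
        by (simp only: real_norm_def abs_mult)
    qed
  qed
  then show ?thesis by (simp add: times_divide_eq_right)
qed

text \<open>A change of variables turns the integral over the layer into a difference of two integrals over
  \<open>\<Omega>\<close>. Hence only difference quotients inside \<open>\<Omega>\<close> occur, and the limit is the integral of the
  divergence of \<open>Q(x) (x - a)\<close>.\<close>

lemma layer_integral_tendsto:
  fixes Q :: "real^'n \<Rightarrow> real"
  assumes Q: "integrable N Q" and d: "d \<in> borel_measurable N"
    and t: "\<And>k::nat. 0 < t k" "\<And>k. t k < 1" "t \<longlonglongrightarrow> 1"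
    and lip: "\<And>x k. x \<in> \<Omega> \<Longrightarrow> \<bar>Q x - Q (dil (t k) x)\<bar> \<le> C * (1 - t k)"
    and lim: "AE x in N. (\<lambda>k. (Q x - Q (dil (t k) x)) / (1 - t k)) \<longlonglongrightarrow> d x"
  shows "(\<lambda>k. (\<integral>x. indicator (layer (t k)) x * Q x \<partial>N) / (1 - t k)) \<longlonglongrightarrow>
    real CARD('n) * (\<integral>x. Q x \<partial>N) + (\<integral>x. d x \<partial>N)"
proof -
  have Qm: "Q \<in> borel_measurable N" using Q by auto
  have diff: "(\<integral>x. 1 * (Q x - Q (dil (t k) x)) \<partial>N) = (\<integral>x. Q x \<partial>N) - (\<integral>x. Q (dil (t k) x) \<partial>N)" for k
  proof -
    have "integrable N (\<lambda>x. Q x - Q (dil (t k) x))"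
      using lip by (intro integrable_bounded[of _ "C * (1 - t k)"] borel_measurable_diff Qm
          measurable_N_dil[OF Qm t(1) less_imp_le[OF t(2)]] AE_I2) auto
    then have "integrable N (\<lambda>x. Q (dil (t k) x))"
      using Bochner_Integration.integrable_diff[OF Q] by fastforce
    then show ?thesis using Q by simp
  qed
  have "(\<integral>x. indicator (layer (t k)) x * Q x \<partial>N) / (1 - t k) =
      (1 - t k ^ CARD('n)) / (1 - t k) * (\<integral>x. Q x \<partial>N)
      + t k ^ CARD('n) * ((\<integral>x. 1 * (Q x - Q (dil (t k) x)) \<partial>N) / (1 - t k))" for k
    unfolding diff using t(1)[of k] t(2)[of k] by (subst integral_layer[OF Q]) (auto simp: diff_divide_distrib left_diff_distrib right_diff_distrib)
  moreover have "(\<lambda>k. (1 - t k ^ CARD('n)) / (1 - t k) * (\<integral>x. Q x \<partial>N)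
      + t k ^ CARD('n) * ((\<integral>x. 1 * (Q x - Q (dil (t k) x)) \<partial>N) / (1 - t k))) \<longlonglongrightarrow>
      real CARD('n) * (\<integral>x. Q x \<partial>N) + 1 ^ CARD('n) * (\<integral>x. 1 * d x \<partial>N)"
    by (intro tendsto_add tendsto_mult tendsto_const one_minus_power_quotient tendsto_power
        radial_differences_tendsto[OF Qm d t lip lim, where B=1] t) auto
  ultimately show ?thesis by simp
qed

end

section \<open>The anisotropic flux\<close>

lemma Young_powr:
  fixes X Y p :: real
  assumes "X \<ge> 0" "Y \<ge> 0" "p > 1"
  shows "X powr (p - 1) * Y \<le> (1 - 1 / p) * X powr p + Y powr p / p"
proof -
  define q where "q = p / (p - 1)"
  have q: "q > 1" "1 / p + 1 / q = 1" using assms by (auto simp: q_def field_simps)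
  have "X powr (p - 1) * Y = Y * X powr (p - 1)" by simp
  also have "\<dots> \<le> Y powr p / p + (X powr (p - 1)) powr q / q"
    by (rule Youngs_inequality[OF assms(3) q]) (use assms in auto)
  also have "(X powr (p - 1)) powr q = X powr p"
    using assms(3) by (simp add: powr_powr q_def)
  also have "X powr p / q = (1 / q) * X powr p" by simp
  also have "1 / q = 1 - 1 / p" using q(2) by linarith
  finally show ?thesis by simp
qed

text \<open>Young's inequality in the crude form used to absorb lower order terms.\<close>

lemma powr_mult_le_eps:
  fixes X Y p \<delta> :: real
  assumes "X \<ge> 0" "Y \<ge> 0" "p > 1" "\<delta> > 0"
  shows "X powr (p - 1) * Y \<le> \<delta> * X powr p + \<delta> powr (1 - p) * Y powr p"
proof (cases "Y \<le> \<delta> * X")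
  case True
  then have "X powr (p - 1) * Y \<le> X powr (p - 1) * (\<delta> * X)" by (intro mult_left_mono) auto
  also have "\<dots> = \<delta> * X powr p" using assms by (cases "X = 0") (auto simp: powr_diff)
  finally show ?thesis by (simp add: add_increasing2)
next
  case False
  then have X: "X \<le> Y / \<delta>" using assms by (simp add: field_simps)
  have "X powr (p - 1) * Y \<le> (Y / \<delta>) powr (p - 1) * Y"
    using assms X by (intro mult_right_mono powr_mono2) auto
  also have "\<dots> = \<delta> powr (1 - p) * Y powr p"
  proof (cases "Y = 0")
    case False
    have "\<delta> powr (p - 1) * \<delta> powr (1 - p) = 1"
      using assms by (simp add: powr_add[symmetric])
    then show ?thesis using False assms by (simp add: powr_divide powr_diff[of Y] field_simps)
  qed auto
  finally show ?thesis using assms by (simp add: add_increasing)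
qed

locale anisotropic =
  fixes H :: "real^'n \<Rightarrow> real" and p :: real
  assumes norm_H: "anisotropic_norm H" and p_gt_1: "1 < p"
begin

lemma H_scale: "t > 0 \<Longrightarrow> H (t *\<^sub>R \<xi>) = t * H \<xi>"
  using norm_H by (simp add: anisotropic_norm_def)

lemma H_zero [simp]: "H 0 = 0"
  using H_scale[of 2 0] by simp

lemma H_pos: "\<xi> \<noteq> 0 \<Longrightarrow> H \<xi> > 0"
  using norm_H by (simp add: anisotropic_norm_def)

lemma H_nonneg: "H \<xi> \<ge> 0"
  using H_pos[of \<xi>] by (cases "\<xi> = 0") auto

lemma H_convex: "convex_on UNIV H"
  using norm_H by (simp add: anisotropic_norm_def)

lemma H_continuous: "continuous_on UNIV H"
  by (rule convex_on_continuous[OF open_UNIV H_convex])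

lemma H_subadditive: "H (\<xi> + \<zeta>) \<le> H \<xi> + H \<zeta>"
proof -
  have "H ((1 - 1/2) *\<^sub>R \<xi> + (1/2) *\<^sub>R \<zeta>) \<le> (1 - 1/2) * H \<xi> + (1/2) * H \<zeta>"
    by (rule convex_onD[OF H_convex]) auto
  then have "2 * H ((1/2) *\<^sub>R \<xi> + (1/2) *\<^sub>R \<zeta>) \<le> H \<xi> + H \<zeta>" by simp
  also have "2 * H ((1/2) *\<^sub>R \<xi> + (1/2) *\<^sub>R \<zeta>) = H (2 *\<^sub>R ((1/2) *\<^sub>R \<xi> + (1/2) *\<^sub>R \<zeta>))"
    by (rule H_scale[symmetric]) simp
  finally show ?thesis by (simp add: scaleR_add_right)
qed

lemma H_bounds:
  obtains c C where "c > 0" "C > 0" "\<And>\<xi>. c * norm \<xi> \<le> H \<xi>" "\<And>\<xi>. H \<xi> \<le> C * norm \<xi>"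
proof -
  let ?S = "sphere 0 1 :: (real^'n) set"
  have c: "continuous_on ?S H" using H_continuous continuous_on_subset[OF _ subset_UNIV] by blast
  have S: "compact ?S" "?S \<noteq> {}" by auto
  obtain x where x: "x \<in> ?S" "\<And>y. y \<in> ?S \<Longrightarrow> H x \<le> H y"
    using continuous_attains_inf[OF S c] by blast
  obtain y where y: "y \<in> ?S" "\<And>z. z \<in> ?S \<Longrightarrow> H z \<le> H y"
    using continuous_attains_sup[OF S c] by blast
  have sc: "H \<xi> = norm \<xi> * H (\<xi> /\<^sub>R norm \<xi>)" "\<xi> /\<^sub>R norm \<xi> \<in> ?S" if "\<xi> \<noteq> 0" for \<xi>
    using that H_scale[of "norm \<xi>" "\<xi> /\<^sub>R norm \<xi>"] by auto
  have "H x > 0" "H y > 0" using x(1) y(1) by (auto intro!: H_pos)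
  moreover have "H x * norm \<xi> \<le> H \<xi>" for \<xi>
    using sc[of \<xi>] x(2)[of "\<xi> /\<^sub>R norm \<xi>"] mult_left_mono[of "H x" _ "norm \<xi>"]
    by (cases "\<xi> = 0") (auto simp: mult.commute)
  moreover have "H \<xi> \<le> H y * norm \<xi>" for \<xi>
    using sc[of \<xi>] y(2)[of "\<xi> /\<^sub>R norm \<xi>"] mult_left_mono[of _ "H y" "norm \<xi>"]
    by (cases "\<xi> = 0") (auto simp: mult.commute)
  ultimately show ?thesis by (rule that)
qed

lemma H_gradient:
  assumes "\<xi> \<noteq> 0" shows "GDERIV H \<xi> :> gradient H \<xi>"
proof -
  have "Ck_on (Suc 1) H (- {0})" using norm_H by (simp add: anisotropic_norm_def numeral_2_eq_2)
  then show ?thesis using assms Ck_on_Suc_iff[of "- {0}"] by blast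
qed

lemma gradient_H_continuous: "continuous_on (- {0}) (gradient H)"
proof (rule continuous_on_gradient)
  show "Ck_on (Suc 1) H (- {0})" using norm_H by (simp add: anisotropic_norm_def numeral_2_eq_2)
qed (rule open_Compl, simp)

lemma gradient_H_le:
  assumes "\<xi> \<noteq> 0" shows "gradient H \<xi> \<bullet> \<zeta> \<le> H \<zeta>"
proof -
  have "real (Suc k) * (H (\<xi> + (1 / real (Suc k)) *\<^sub>R \<zeta>) - H \<xi>) \<le> H \<zeta>" for k
  proof -
    have "H (\<xi> + (1 / real (Suc k)) *\<^sub>R \<zeta>) - H \<xi> \<le> (1 / real (Suc k)) * H \<zeta>"
      using H_subadditive[of \<xi> "(1 / real (Suc k)) *\<^sub>R \<zeta>"] H_scale[of "1 / real (Suc k)" \<zeta>] by simp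
    then have "real (Suc k) * (H (\<xi> + (1 / real (Suc k)) *\<^sub>R \<zeta>) - H \<xi>) \<le> real (Suc k) * ((1 / real (Suc k)) * H \<zeta>)"
      by (intro mult_left_mono) auto
    then show ?thesis by simp
  qed
  then have "\<zeta> \<bullet> gradient H \<xi> \<le> H \<zeta>"
    by (intro LIMSEQ_le_const2[OF GDERIV_directional_limit[OF H_gradient[OF assms]]] exI allI impI)
  then show ?thesis by (simp add: inner_commute)
qed

lemma gradient_H_Euler:
  assumes "\<xi> \<noteq> 0" shows "gradient H \<xi> \<bullet> \<xi> = H \<xi>"
proof -
  have eq: "real (Suc k) * (H (\<xi> + (1 / real (Suc k)) *\<^sub>R \<xi>) - H \<xi>) = H \<xi>" for k
  proof -
    have "\<xi> + (1 / real (Suc k)) *\<^sub>R \<xi> = (1 + 1 / real (Suc k)) *\<^sub>R \<xi>" by (simp add: scaleR_add_left)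
    moreover have "H ((1 + 1 / real (Suc k)) *\<^sub>R \<xi>) = (1 + 1 / real (Suc k)) * H \<xi>"
      by (intro H_scale add_pos_pos) auto
    ultimately show ?thesis by (simp add: field_simps)
  qed
  have "(\<lambda>k::nat. H \<xi>) \<longlonglongrightarrow> \<xi> \<bullet> gradient H \<xi>"
    using GDERIV_directional_limit[OF H_gradient[OF assms], of \<xi>] unfolding eq .
  then have "\<xi> \<bullet> gradient H \<xi> = H \<xi>" by (rule LIMSEQ_unique) (rule tendsto_const)
  then show ?thesis by (simp add: inner_commute)
qed

abbreviation flux :: "real^'n \<Rightarrow> real^'n" where "flux \<equiv> aniso_flux H p"

lemma flux_inner_le: "flux \<xi> \<bullet> \<zeta> \<le> H \<xi> powr (p - 1) * H \<zeta>"
  using gradient_H_le[of \<xi> \<zeta>] H_nonneg[of \<zeta>] by (auto simp: aniso_flux_def intro: mult_left_mono)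

lemma flux_inner_self: "flux \<xi> \<bullet> \<xi> = H \<xi> powr p"
proof (cases "\<xi> = 0")
  case False
  then show ?thesis
    using gradient_H_Euler[of \<xi>] H_pos[of \<xi>] by (simp add: aniso_flux_def powr_diff)
qed (simp add: aniso_flux_def)

text \<open>The convexity of \<open>H^p / p\<close>, whose gradient is the flux: it reduces to \<open>flux_inner_le\<close> and
  Young's inequality.\<close>

lemma flux_subgradient: "H \<xi> powr p / p + flux \<xi> \<bullet> (\<zeta> - \<xi>) \<le> H \<zeta> powr p / p"
proof -
  have "flux \<xi> \<bullet> \<zeta> \<le> (1 - 1 / p) * H \<xi> powr p + H \<zeta> powr p / p"
    using flux_inner_le[of \<xi> \<zeta>] Young_powr[OF H_nonneg H_nonneg p_gt_1, of \<xi> \<zeta>] by linarith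
  moreover have "(1 - 1 / p) * H \<xi> powr p = H \<xi> powr p - H \<xi> powr p / p" by (simp add: algebra_simps)
  ultimately show ?thesis by (simp add: inner_diff_right flux_inner_self)
qed

text \<open>Apply \<open>flux_inner_le\<close> with the flux itself as the second vector.\<close>

lemma flux_norm_le:
  assumes "\<And>\<xi>. H \<xi> \<le> C * norm \<xi>"
  shows "norm (flux \<xi>) \<le> C * H \<xi> powr (p - 1)"
proof (cases "flux \<xi> = 0")
  case True
  have "0 \<le> C * norm (axis undefined 1 :: real^'n)"
    using assms[of "axis undefined 1"] H_nonneg order_trans by blast
  then show ?thesis using True by simp
next
  case False
  have "norm (flux \<xi>) * norm (flux \<xi>) = flux \<xi> \<bullet> flux \<xi>" by (simp add: dot_square_norm power2_eq_square)
  also have "\<dots> \<le> H \<xi> powr (p - 1) * H (flux \<xi>)" by (rule flux_inner_le)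
  also have "\<dots> \<le> H \<xi> powr (p - 1) * (C * norm (flux \<xi>))" by (intro mult_left_mono assms) simp
  finally have "norm (flux \<xi>) * norm (flux \<xi>) \<le> (C * H \<xi> powr (p - 1)) * norm (flux \<xi>)" by (simp add: ac_simps)
  then show ?thesis using False by simp
qed

lemma flux_measurable [measurable]: "flux \<in> borel_measurable borel"
proof -
  have "continuous_on (- {0}) (\<lambda>\<xi>. H \<xi> powr (p - 1) *\<^sub>R gradient H \<xi>)"
    using H_pos by (intro continuous_intros gradient_H_continuous continuous_on_subset[OF H_continuous subset_UNIV])
      (auto simp: less_imp_neq[THEN not_sym])
  then have "(\<lambda>\<xi>. indicator (- {0}) \<xi> *\<^sub>R (H \<xi> powr (p - 1) *\<^sub>R gradient H \<xi>)) \<in> borel_measurable borel"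
    by (intro borel_measurable_continuous_on_indicator) auto
  moreover have "flux = (\<lambda>\<xi>. indicator (- {0}) \<xi> *\<^sub>R (H \<xi> powr (p - 1) *\<^sub>R gradient H \<xi>))"
    by (intro ext) (simp add: aniso_flux_def)
  ultimately show ?thesis by simp
qed

lemma H_measurable [measurable]: "H \<in> borel_measurable borel"
  by (rule borel_measurable_continuous_onI[OF H_continuous])

end

section \<open>Pohozaev's inequality\<close>

lemma powr_mult_self: "x \<ge> 0 \<Longrightarrow> x powr (r - 1) * x = x powr r" for x r :: real
  by (cases "x = 0") (auto simp: powr_diff)

lemma powr_Lipschitz:
  fixes x y r M :: real
  assumes "0 \<le> x" "x \<le> M" "0 \<le> y" "y \<le> M" "r \<ge> 1"
  shows "\<bar>x powr r - y powr r\<bar> \<le> r * M powr (r - 1) * \<bar>x - y\<bar>"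
proof -
  have *: "\<bar>y powr r - x powr r\<bar> \<le> r * M powr (r - 1) * \<bar>y - x\<bar>"
    if xy: "0 \<le> x" "x < y" "y \<le> M" for x y
  proof -
    obtain z where z: "x < z" "z < y" "y powr r - x powr r = r * z powr (r - 1) * (y - x)"
    proof (rule mvt[of x y "\<lambda>s. s powr r" "\<lambda>s h. r * s powr (r - 1) * h"])
      show "x < y" by (rule xy)
      show "continuous_on {x..y} (\<lambda>s. s powr r)"
        using xy assms by (intro continuous_on_powr' continuous_intros) auto
      show "((\<lambda>s. s powr r) has_derivative (\<lambda>h. r * s powr (r - 1) * h)) (at s)" if "x < s" for s
        using that xy(1) unfolding has_field_derivative_def[symmetric]
        by (auto intro!: derivative_eq_intros)
    qed (rule that)
    have "z powr (r - 1) \<le> M powr (r - 1)" using z that assms by (intro powr_mono2) auto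
    then have "r * z powr (r - 1) * (y - x) \<le> r * M powr (r - 1) * (y - x)"
      using that assms by (intro mult_left_mono mult_right_mono) auto
    moreover have "0 \<le> r * z powr (r - 1) * (y - x)" using that assms by auto
    ultimately show ?thesis using z(3) that by simp
  qed
  consider "x < y" | "y < x" | "x = y" by linarith
  then show ?thesis
    using *[of x y] *[of y x] assms by cases (auto simp: abs_minus_commute)
qed

lemma powr_quotient_tendsto:
  fixes t :: "nat \<Rightarrow> real"
  assumes t: "\<And>k. t k < 1" "t \<longlonglongrightarrow> 1"
  shows "(\<lambda>k. (t k powr r - 1) / (1 - t k)) \<longlonglongrightarrow> - r"
proof -
  have "((\<lambda>s. s powr r) has_real_derivative r) (at (1::real))"
    by (auto intro!: derivative_eq_intros)
  then have "((\<lambda>h. ((1 + h) powr r - 1) / h) \<longlongrightarrow> r) (at 0)"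
    by (simp add: DERIV_def)
  moreover have "(\<lambda>k. t k - 1) \<longlonglongrightarrow> 0" using tendsto_diff[OF t(2) tendsto_const, of 1] by simp
  then have "filterlim (\<lambda>k. t k - 1) (at 0) sequentially"
    using t(1) by (auto simp: filterlim_at less_imp_neq)
  ultimately have "(\<lambda>k. ((1 + (t k - 1)) powr r - 1) / (t k - 1)) \<longlonglongrightarrow> r"
    by (rule filterlim_compose)
  then have "(\<lambda>k. - (((1 + (t k - 1)) powr r - 1) / (t k - 1))) \<longlonglongrightarrow> - r"
    by (rule tendsto_minus)
  moreover have "- (((1 + (t k - 1)) powr r - 1) / (t k - 1)) = (t k powr r - 1) / (1 - t k)" for k
    by (simp add: minus_divide_right)
  ultimately show ?thesis by simp
qed

text \<open>The data extracted from a weak solution that is \<open>C^1\<close> up to the boundary: here \<open>g\<close> is both its weak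
  and its classical gradient.\<close>

locale bounded_C1_solution = star_shaped_set \<Omega> a + anisotropic H p
  for \<Omega> :: "(real^'n) set" and a :: "real^'n" and H :: "real^'n \<Rightarrow> real" and p :: real +
  fixes u :: "real^'n \<Rightarrow> real" and g :: "real^'n \<Rightarrow> real^'n" and M \<mu> :: real
  assumes p_less: "p < real CARD('n)" and \<Omega>_nonempty: "\<Omega> \<noteq> {}"
    and u_deriv: "\<And>x. x \<in> \<Omega> \<Longrightarrow> GDERIV u x :> g x" and g_cont: "continuous_on \<Omega> g"
    and u_nonneg: "\<And>x. x \<in> \<Omega> \<Longrightarrow> 0 \<le> u x" and u_le: "\<And>x. x \<in> \<Omega> \<Longrightarrow> u x \<le> M"
    and g_le: "\<And>x. x \<in> \<Omega> \<Longrightarrow> norm (g x) \<le> M"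
    and u_pos: "AE x in N. u x > 0" and u_W: "W1p0 \<Omega> p u g"
    and weak: "\<And>v Dv. W1p0 \<Omega> p v Dv \<Longrightarrow>
        (\<integral>x. flux (g x) \<bullet> Dv x \<partial>N) - \<mu> * (\<integral>x. u x powr (p - 1) * v x \<partial>N)
        - (\<integral>x. u x powr (sobolev_conjugate CARD('n) p - 1) * v x \<partial>N) = 0"
begin

definition q :: real where "q = sobolev_conjugate CARD('n) p"

lemma q_gt_1: "q > 1"
proof -
  have "real CARD('n) * p > real CARD('n) * 1" using p_gt_1 by (intro mult_strict_left_mono) auto
  then have "real CARD('n) - p < real CARD('n) * p" using p_gt_1 by linarith
  then show ?thesis using p_less by (simp add: q_def sobolev_conjugate_def)
qed

lemma n_div_q: "real CARD('n) / q = (real CARD('n) - p) / p"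
  using p_less p_gt_1 by (simp add: q_def sobolev_conjugate_def)

lemma M_nonneg: "M \<ge> 0"
  using \<Omega>_nonempty u_nonneg u_le order_trans by blast

lemma u_continuous: "continuous_on \<Omega> u"
  by (intro continuous_at_imp_continuous_on ballI GDERIV_isCont[OF u_deriv])

lemma measurable_on_\<Omega>: "continuous_on \<Omega> f \<Longrightarrow> f \<in> borel_measurable N"
  by (rule continuous_imp_measurable_on_sets_lebesgue[OF _ \<Omega>_sets])

lemma u_measurable [measurable]: "u \<in> borel_measurable N"
  and g_measurable [measurable]: "g \<in> borel_measurable N"
  using measurable_on_\<Omega> u_continuous g_cont by auto

lemma flux_g_measurable [measurable]: "(\<lambda>x. flux (g x)) \<in> borel_measurable N"
  and H_g_measurable [measurable]: "(\<lambda>x. H (g x)) \<in> borel_measurable N"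
  using measurable_compose[OF g_measurable flux_measurable] measurable_compose[OF g_measurable H_measurable]
  by auto

lemma H_g_bounded: obtains B where "\<And>x. x \<in> \<Omega> \<Longrightarrow> H (g x) \<le> B"
proof -
  obtain c C where C: "c > 0" "C > 0" "\<And>\<xi>. c * norm \<xi> \<le> H \<xi>" "\<And>\<xi>. H \<xi> \<le> C * norm \<xi>" by (rule H_bounds) (rule that)
  have "H (g x) \<le> C * M" if "x \<in> \<Omega>" for x
    using C(4)[of "g x"] mult_left_mono[OF g_le[OF that], of C] C(2) by linarith
  then show ?thesis by (rule that)
qed

lemma flux_g_bounded: obtains B where "\<And>x. x \<in> \<Omega> \<Longrightarrow> norm (flux (g x)) \<le> B"
proof -
  obtain c C where C: "c > 0" "C > 0" "\<And>\<xi>. c * norm \<xi> \<le> H \<xi>" "\<And>\<xi>. H \<xi> \<le> C * norm \<xi>" by (rule H_bounds) (rule that)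
  obtain B where B: "\<And>x. x \<in> \<Omega> \<Longrightarrow> H (g x) \<le> B" by (rule H_g_bounded) (rule that)
  have "norm (flux (g x)) \<le> C * B powr (p - 1)" if "x \<in> \<Omega>" for x
  proof -
    have "H (g x) powr (p - 1) \<le> B powr (p - 1)"
      using B[OF that] H_nonneg p_gt_1 by (intro powr_mono2) auto
    then show ?thesis using flux_norm_le[OF C(4), of "g x"] mult_left_mono[of _ "B powr (p - 1)" C] C(2)
      by (smt (verit))
  qed
  then show ?thesis by (rule that)
qed

lemma H_g_powr_integrable: "r \<ge> 0 \<Longrightarrow> integrable N (\<lambda>x. H (g x) powr r)"
proof -
  assume r: "r \<ge> 0"
  obtain B where B: "\<And>x. x \<in> \<Omega> \<Longrightarrow> H (g x) \<le> B" by (rule H_g_bounded) (rule that)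
  show ?thesis
    using B H_nonneg r by (intro integrable_bounded[of _ "B powr r"] AE_I2) (auto intro: powr_mono2)
qed

lemma u_powr_measurable [measurable]: "(\<lambda>x. u x powr r) \<in> borel_measurable N"
  by measurable

lemma u_powr_bounded: "r \<ge> 0 \<Longrightarrow> x \<in> \<Omega> \<Longrightarrow> \<bar>u x powr r\<bar> \<le> M powr r"
  using u_nonneg u_le by (auto intro: powr_mono2)

lemma u_powr_integrable: "r \<ge> 0 \<Longrightarrow> integrable N (\<lambda>x. u x powr r)"
  using u_powr_bounded by (intro integrable_bounded[of _ "M powr r"] AE_I2) auto

lemma u_integrable: "integrable N u"
  using u_nonneg u_le by (intro integrable_bounded[of _ M] AE_I2) auto

definition f :: "real^'n \<Rightarrow> real" where
  "f x = \<mu> * u x powr (p - 1) + u x powr (q - 1)"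

lemma f_measurable [measurable]: "f \<in> borel_measurable N"
  unfolding f_def by measurable

lemma f_continuous: "continuous_on \<Omega> f"
  unfolding f_def using u_nonneg p_gt_1 q_gt_1
  by (intro continuous_intros continuous_on_powr' u_continuous) auto

lemma f_bounded: "x \<in> \<Omega> \<Longrightarrow> \<bar>f x\<bar> \<le> \<bar>\<mu>\<bar> * M powr (p - 1) + M powr (q - 1)"
proof -
  assume x: "x \<in> \<Omega>"
  have "\<bar>f x\<bar> \<le> \<bar>\<mu>\<bar> * \<bar>u x powr (p - 1)\<bar> + \<bar>u x powr (q - 1)\<bar>"
    unfolding f_def by (rule order_trans[OF abs_triangle_ineq]) (simp add: abs_mult)
  also have "\<dots> \<le> \<bar>\<mu>\<bar> * M powr (p - 1) + M powr (q - 1)"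
    using x p_gt_1 q_gt_1 by (intro add_mono mult_left_mono u_powr_bounded) auto
  finally show ?thesis .
qed

lemma weak_equation:
  assumes "W1p0 \<Omega> p v Dv"
  shows "(\<integral>x. flux (g x) \<bullet> Dv x \<partial>N) = (\<integral>x. f x * v x \<partial>N)"
proof -
  have v: "integrable N v"
    using assms p_gt_1 Lp_integrable[of p v] unfolding W1p0_def W1p_def by auto
  have i: "integrable N (\<lambda>x. u x powr (p - 1) * v x)" "integrable N (\<lambda>x. u x powr (q - 1) * v x)"
    using integrable_mult_bounded[OF v u_powr_measurable u_powr_bounded, of "p - 1"]
      integrable_mult_bounded[OF v u_powr_measurable u_powr_bounded, of "q - 1"] p_gt_1 q_gt_1
    by (auto simp: mult.commute)
  have "(\<integral>x. f x * v x \<partial>N) = (\<integral>x. \<mu> * (u x powr (p - 1) * v x) + u x powr (q - 1) * v x \<partial>N)"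
    by (intro Bochner_Integration.integral_cong) (auto simp: f_def algebra_simps)
  also have "\<dots> = \<mu> * (\<integral>x. u x powr (p - 1) * v x \<partial>N) + (\<integral>x. u x powr (q - 1) * v x \<partial>N)"
    using i by simp
  finally show ?thesis using weak[OF assms] by (simp add: q_def)
qed

lemma energy_identity:
  "(\<integral>x. H (g x) powr p \<partial>N) = \<mu> * (\<integral>x. u x powr p \<partial>N) + (\<integral>x. u x powr q \<partial>N)"
proof -
  have "(\<integral>x. H (g x) powr p \<partial>N) = (\<integral>x. f x * u x \<partial>N)"
    using weak_equation[OF u_W] by (simp add: flux_inner_self)
  also have "\<dots> = (\<integral>x. \<mu> * u x powr p + u x powr q \<partial>N)"
    using u_nonneg powr_mult_self
    by (intro Bochner_Integration.integral_cong) (auto simp: f_def distrib_right mult.assoc)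
  also have "\<dots> = \<mu> * (\<integral>x. u x powr p \<partial>N) + (\<integral>x. u x powr q \<partial>N)"
    using u_powr_integrable p_gt_1 q_gt_1 by simp
  finally show ?thesis .
qed

lemma u_radial_Lipschitz:
  "x \<in> \<Omega> \<Longrightarrow> 0 \<le> t \<Longrightarrow> t \<le> 1 \<Longrightarrow> \<bar>u x - u (dil t x)\<bar> \<le> M * radius * (1 - t)"
  by (rule radial_Lipschitz[OF u_deriv g_le])

lemma radial_derivative_measurable: "(\<lambda>x. g x \<bullet> (x - a)) \<in> borel_measurable N"
  by (intro measurable_on_\<Omega> continuous_intros g_cont)

text \<open>By the divergence theorem for \<open>u(x) (x - a)\<close> the limit is zero. In this weak sense \<open>u\<close> vanishes
  on the boundary.\<close>

lemma layer_integral_u: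
  assumes t: "\<And>k::nat. 0 < t k" "\<And>k. t k < 1" "t \<longlonglongrightarrow> 1"
  shows "(\<lambda>k. (\<integral>x. indicator (layer (t k)) x * u x \<partial>N) / (1 - t k)) \<longlonglongrightarrow> 0"
proof -
  have "(\<lambda>k. (\<integral>x. indicator (layer (t k)) x * u x \<partial>N) / (1 - t k)) \<longlonglongrightarrow>
    real CARD('n) * (\<integral>x. u x \<partial>N) + (\<integral>x. g x \<bullet> (x - a) \<partial>N)"
  proof (rule layer_integral_tendsto[OF u_integrable radial_derivative_measurable t])
    show "\<bar>u x - u (dil (t k) x)\<bar> \<le> M * radius * (1 - t k)" if "x \<in> \<Omega>" for x k
      using u_radial_Lipschitz[OF that, of "t k"] t(1,2)[of k] by simp
    show "AE x in N. (\<lambda>k. (u x - u (dil (t k) x)) / (1 - t k)) \<longlonglongrightarrow> g x \<bullet> (x - a)"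
      using radial_difference_quotient[OF u_deriv t(2,3)] by (intro AE_I2) simp
  qed
  also have "real CARD('n) * (\<integral>x. u x \<partial>N) + (\<integral>x. g x \<bullet> (x - a) \<partial>N) = 0"
    using W1p0_divergence[OF u_W] p_gt_1 by simp
  finally show ?thesis .
qed

lemma layer_integral_dominated:
  assumes t: "\<And>k::nat. 0 < t k" "\<And>k. t k < 1" "t \<longlonglongrightarrow> 1"
    and Q: "Q \<in> borel_measurable N" "\<And>x. x \<in> \<Omega> \<Longrightarrow> \<bar>Q x\<bar> \<le> B * u x"
  shows "(\<lambda>k. (\<integral>x. indicator (layer (t k)) x * Q x \<partial>N) / (1 - t k)) \<longlonglongrightarrow> 0"
proof (rule Lim_null_comparison)
  show "(\<lambda>k. B * ((\<integral>x. indicator (layer (t k)) x * u x \<partial>N) / (1 - t k))) \<longlonglongrightarrow> 0"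
    using tendsto_mult_left[OF layer_integral_u[OF t], of B] by simp
  show "\<forall>\<^sub>F k in sequentially. norm ((\<integral>x. indicator (layer (t k)) x * Q x \<partial>N) / (1 - t k))
      \<le> B * ((\<integral>x. indicator (layer (t k)) x * u x \<partial>N) / (1 - t k))"
  proof (intro always_eventually allI)
    fix k
    have "norm (\<integral>x. indicator (layer (t k)) x * Q x \<partial>N) \<le> (\<integral>x. norm (indicator (layer (t k)) x * Q x) \<partial>N)"
      by (rule integral_norm_bound)
    also have "\<dots> \<le> (\<integral>x. B * (indicator (layer (t k)) x * u x) \<partial>N)"
    proof (rule integral_mono_AE')
      show "integrable N (\<lambda>x. B * (indicator (layer (t k)) x * u x))"
        using integrable_layer[OF u_integrable t(1)] by simp
      have *: "\<bar>Q x\<bar> \<le> B * u x" "0 \<le> B * u x" if "x \<in> space N" for x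
        using Q(2)[of x] abs_ge_zero[of "Q x"] that by (auto intro: order_trans)
      show "AE x in N. norm (indicator (layer (t k)) x * Q x) \<le> B * (indicator (layer (t k)) x * u x)"
        using * by (intro AE_I2) (simp add: indicator_def)
      show "AE x in N. 0 \<le> B * (indicator (layer (t k)) x * u x)"
        using * by (intro AE_I2) (simp add: indicator_def)
    qed
    finally show "norm ((\<integral>x. indicator (layer (t k)) x * Q x \<partial>N) / (1 - t k))
      \<le> B * ((\<integral>x. indicator (layer (t k)) x * u x \<partial>N) / (1 - t k))"
      using t(2)[of k] by (simp add: norm_divide divide_right_mono)
  qed
qed

definition ratio :: "nat \<Rightarrow> real" where "ratio k = 1 - inverse (real (Suc (Suc k)))"

lemma ratio: "0 < ratio k" "ratio k < 1" "ratio \<longlonglongrightarrow> 1"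
proof -
  show "0 < ratio k" by (simp add: ratio_def field_simps)
  show "ratio k < 1" by (simp add: ratio_def)
  have "(\<lambda>k. 1 - inverse (real (Suc (Suc k)))) \<longlonglongrightarrow> 1 - 0"
    by (intro tendsto_diff tendsto_const LIMSEQ_Suc[OF LIMSEQ_inverse_real_of_nat])
  then show "ratio \<longlonglongrightarrow> 1" by (simp add: ratio_def[abs_def])
qed

text \<open>The divergence theorem for \<open>Q(x) (x - a)\<close>: as \<open>Q\<close> is dominated by \<open>u\<close>, it has no boundary
  contribution either.\<close>

lemma Euler_identity:
  assumes Q: "Q \<in> borel_measurable N" "\<And>x. x \<in> \<Omega> \<Longrightarrow> \<bar>Q x\<bar> \<le> B * u x" and d: "d \<in> borel_measurable N"
    and lip: "\<And>x t. x \<in> \<Omega> \<Longrightarrow> 0 \<le> t \<Longrightarrow> t \<le> 1 \<Longrightarrow> \<bar>Q x - Q (dil t x)\<bar> \<le> C * (1 - t)"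
    and deriv: "AE x in N. \<exists>D. GDERIV Q x :> D \<and> d x = D \<bullet> (x - a)"
  shows "real CARD('n) * (\<integral>x. Q x \<partial>N) + (\<integral>x. d x \<partial>N) = 0"
proof -
  have "\<bar>Q x\<bar> \<le> \<bar>B\<bar> * M" if "x \<in> \<Omega>" for x
  proof -
    have "\<bar>Q x\<bar> \<le> B * u x" by (rule Q(2)[OF that])
    also have "\<dots> \<le> \<bar>B\<bar> * M" using u_nonneg[OF that] u_le[OF that] by (intro mult_mono) auto
    finally show ?thesis .
  qed
  then have Qi: "integrable N Q" by (intro integrable_bounded[OF Q(1), of "\<bar>B\<bar> * M"] AE_I2) simp
  have "(\<lambda>k. (\<integral>x. indicator (layer (ratio k)) x * Q x \<partial>N) / (1 - ratio k)) \<longlonglongrightarrow>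
    real CARD('n) * (\<integral>x. Q x \<partial>N) + (\<integral>x. d x \<partial>N)"
  proof (rule layer_integral_tendsto[OF Qi d ratio])
    show "\<bar>Q x - Q (dil (ratio k) x)\<bar> \<le> C * (1 - ratio k)" if "x \<in> \<Omega>" for x k
      using lip[OF that, of "ratio k"] ratio(1,2)[of k] by simp
    show "AE x in N. (\<lambda>k. (Q x - Q (dil (ratio k) x)) / (1 - ratio k)) \<longlonglongrightarrow> d x"
      using deriv by eventually_elim (use radial_difference_quotient[OF _ ratio(2,3)] in force)
  qed
  then show ?thesis using layer_integral_dominated[OF ratio Q] by (rule LIMSEQ_unique)
qed

definition F :: "real^'n \<Rightarrow> real" where
  "F x = \<mu> * (u x powr p / p) + u x powr q / q"

lemma u_powr_radial_Lipschitz: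
  assumes "r \<ge> 1" "x \<in> \<Omega>" "0 \<le> t" "t \<le> 1"
  shows "\<bar>u x powr r - u (dil t x) powr r\<bar> \<le> r * M powr (r - 1) * (M * radius * (1 - t))"
proof -
  have "dil t x \<in> \<Omega>" using assms dil_star by blast
  then have "\<bar>u x powr r - u (dil t x) powr r\<bar> \<le> r * M powr (r - 1) * \<bar>u x - u (dil t x)\<bar>"
    using assms u_nonneg u_le by (intro powr_Lipschitz) auto
  also have "\<dots> \<le> r * M powr (r - 1) * (M * radius * (1 - t))"
    using assms u_radial_Lipschitz by (intro mult_left_mono) auto
  finally show ?thesis .
qed

lemma u_powr_dominated:
  assumes "r \<ge> 1" "x \<in> \<Omega>"
  shows "u x powr r \<le> M powr (r - 1) * u x"
proof -
  have "u x powr r = u x powr (r - 1) * u x" using u_nonneg[OF assms(2)] by (simp add: powr_mult_self)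
  also have "\<dots> \<le> M powr (r - 1) * u x"
    using assms u_nonneg u_le by (intro mult_right_mono powr_mono2) auto
  finally show ?thesis .
qed

lemma Euler_identity_powr:
  assumes r: "r \<ge> 1"
  shows "real CARD('n) * (\<integral>x. u x powr r / r \<partial>N) + (\<integral>x. u x powr (r - 1) * (g x \<bullet> (x - a)) \<partial>N) = 0"
proof (rule Euler_identity)
  show "(\<lambda>x. u x powr r / r) \<in> borel_measurable N" by measurable
  show "\<bar>u x powr r / r\<bar> \<le> (M powr (r - 1) / r) * u x" if "x \<in> \<Omega>" for x
    using u_powr_dominated[OF r that] r by (simp add: divide_right_mono)
  show "(\<lambda>x. u x powr (r - 1) * (g x \<bullet> (x - a))) \<in> borel_measurable N"
    by (intro borel_measurable_times radial_derivative_measurable u_powr_measurable)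
  show "\<bar>u x powr r / r - u (dil t x) powr r / r\<bar> \<le> M powr (r - 1) * (M * radius) * (1 - t)"
    if "x \<in> \<Omega>" "0 \<le> t" "t \<le> 1" for x t
  proof -
    have "\<bar>u x powr r / r - u (dil t x) powr r / r\<bar> = \<bar>u x powr r - u (dil t x) powr r\<bar> / r"
      using r by (simp add: diff_divide_distrib[symmetric] abs_divide)
    also have "\<dots> \<le> (r * M powr (r - 1) * (M * radius * (1 - t))) / r"
      using r u_powr_radial_Lipschitz[OF r that] by (intro divide_right_mono) auto
    also have "\<dots> = M powr (r - 1) * (M * radius) * (1 - t)" using r by simp
    finally show ?thesis .
  qed
  show "AE x in N. \<exists>D. GDERIV (\<lambda>x. u x powr r / r) x :> D \<and> u x powr (r - 1) * (g x \<bullet> (x - a)) = D \<bullet> (x - a)"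
    using u_pos AE_space
  proof eventually_elim
    case (elim x)
    then have x: "x \<in> \<Omega>" by simp
    have "((\<lambda>s. s powr r / r) has_real_derivative u x powr (r - 1)) (at (u x))"
      using elim(1) r by (auto intro!: derivative_eq_intros)
    from GDERIV_DERIV_compose[OF u_deriv[OF x] this]
    have "GDERIV (\<lambda>x. u x powr r / r) x :> u x powr (r - 1) *\<^sub>R g x" .
    then show ?case by (intro exI[of _ "u x powr (r - 1) *\<^sub>R g x"]) simp
  qed
qed

lemma radial_powr_integrable:
  "r \<ge> 0 \<Longrightarrow> integrable N (\<lambda>x. u x powr r * (g x \<bullet> (x - a)))"
proof (rule integrable_mult_bounded[OF u_powr_integrable radial_derivative_measurable])
  show "\<bar>g x \<bullet> (x - a)\<bar> \<le> M * radius" if "x \<in> space N" for x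
  proof -
    have x: "x \<in> \<Omega>" using that by simp
    have "\<bar>g x \<bullet> (x - a)\<bar> \<le> norm (g x) * norm (x - a)" by (rule Cauchy_Schwarz_ineq2)
    also have "\<dots> \<le> M * radius" using g_le[OF x] radius(2)[OF x] M_nonneg by (intro mult_mono) auto
    finally show ?thesis .
  qed
qed

lemma integral_f_radial:
  "(\<integral>x. f x * (g x \<bullet> (x - a)) \<partial>N) = - (real CARD('n)) * (\<integral>x. F x \<partial>N)"
proof -
  let ?R = "\<lambda>r. \<integral>x. u x powr (r - 1) * (g x \<bullet> (x - a)) \<partial>N"
  have i: "integrable N (\<lambda>x. u x powr (p - 1) * (g x \<bullet> (x - a)))"
    "integrable N (\<lambda>x. u x powr (q - 1) * (g x \<bullet> (x - a)))"
    using radial_powr_integrable p_gt_1 q_gt_1 by auto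
  have j: "integrable N (\<lambda>x. u x powr p / p)" "integrable N (\<lambda>x. u x powr q / q)"
    using u_powr_integrable p_gt_1 q_gt_1 by auto
  have "(\<integral>x. f x * (g x \<bullet> (x - a)) \<partial>N) =
      (\<integral>x. \<mu> * (u x powr (p - 1) * (g x \<bullet> (x - a))) + u x powr (q - 1) * (g x \<bullet> (x - a)) \<partial>N)"
    by (intro Bochner_Integration.integral_cong) (auto simp: f_def algebra_simps)
  also have "\<dots> = \<mu> * ?R p + ?R q" using i by simp
  also have "\<dots> = - real CARD('n) * (\<mu> * (\<integral>x. u x powr p / p \<partial>N) + (\<integral>x. u x powr q / q \<partial>N))"
  proof -
    have e: "?R p = - real CARD('n) * (\<integral>x. u x powr p / p \<partial>N)" "?R q = - real CARD('n) * (\<integral>x. u x powr q / q \<partial>N)"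
      using Euler_identity_powr[of p] Euler_identity_powr[of q] p_gt_1 q_gt_1 by linarith+
    show ?thesis unfolding e by (simp add: distrib_left)
  qed
  also have "\<mu> * (\<integral>x. u x powr p / p \<partial>N) + (\<integral>x. u x powr q / q \<partial>N) = (\<integral>x. F x \<partial>N)"
    by (simp only: F_def Bochner_Integration.integral_add[OF Bochner_Integration.integrable_mult_right[OF j(1)] j(2)]
        integral_mult_right_zero)
  finally show ?thesis .
qed

text \<open>On \<open>dil t ` \<Omega>\<close> the integrand is, after a change of variables, a radial difference quotient of
  \<open>u\<close>; on the layer the competitor is zero and the remaining term is dominated by \<open>u\<close>.\<close>

lemma shrink_u_tendsto:
  "(\<lambda>k. (\<integral>x. f x * (shrink (ratio k) u x - u x) \<partial>N) / (1 - ratio k)) \<longlonglongrightarrow> - real CARD('n) * (\<integral>x. F x \<partial>N)"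
proof -
  define B where "B = \<bar>\<mu>\<bar> * M powr (p - 1) + M powr (q - 1)"
  have fm: "(\<lambda>x. f (dil (ratio k) x)) \<in> borel_measurable N" for k
    using ratio by (intro measurable_N_dil f_measurable) (auto intro: less_imp_le)
  have um: "(\<lambda>x. u (dil (ratio k) x)) \<in> borel_measurable N" for k
    using ratio by (intro measurable_N_dil u_measurable) (auto intro: less_imp_le)
  have dilk: "dil (ratio k) x \<in> \<Omega>" if "x \<in> \<Omega>" for x k
    using dil_star[OF that, of "ratio k"] ratio(1,2)[of k] by simp
  have lip: "\<bar>u x - u (dil (ratio k) x)\<bar> \<le> M * radius * (1 - ratio k)" if "x \<in> \<Omega>" for x k
    using u_radial_Lipschitz[OF that, of "ratio k"] ratio(1,2)[of k] by simp
  have L1: "(\<lambda>k. (\<integral>x. f (dil (ratio k) x) * (u x - u (dil (ratio k) x)) \<partial>N) / (1 - ratio k))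
      \<longlonglongrightarrow> (\<integral>x. f x * (g x \<bullet> (x - a)) \<partial>N)"
  proof (rule radial_differences_tendsto[OF u_measurable radial_derivative_measurable ratio lip _ fm])
    show "AE x in N. (\<lambda>k. (u x - u (dil (ratio k) x)) / (1 - ratio k)) \<longlonglongrightarrow> g x \<bullet> (x - a)"
      using radial_difference_quotient[OF u_deriv ratio(2,3)] by (intro AE_I2) simp
    show "\<bar>f (dil (ratio k) x)\<bar> \<le> B" if "x \<in> \<Omega>" for x k
      using f_bounded[OF dilk[OF that]] by (simp add: B_def)
    show "(\<lambda>k. f (dil (ratio k) x)) \<longlonglongrightarrow> f x" if x: "x \<in> \<Omega>" for x
    proof (rule continuous_on_tendsto_compose[OF f_continuous _ x])
      have "(\<lambda>k. (1 - ratio k) *\<^sub>R a + ratio k *\<^sub>R x) \<longlonglongrightarrow> (1 - 1) *\<^sub>R a + 1 *\<^sub>R x"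
        by (intro tendsto_intros ratio(3))
      then show "(\<lambda>k. dil (ratio k) x) \<longlonglongrightarrow> x" by (simp add: dil_def)
      show "\<forall>\<^sub>F k in sequentially. dil (ratio k) x \<in> \<Omega>" using dilk[OF x] by simp
    qed
  qed simp_all
  have L2: "(\<lambda>k. (\<integral>x. indicator (layer (ratio k)) x * (f x * u x) \<partial>N) / (1 - ratio k)) \<longlonglongrightarrow> 0"
  proof (rule layer_integral_dominated[OF ratio, where B=B])
    show "(\<lambda>x. f x * u x) \<in> borel_measurable N" by measurable
    show "\<bar>f x * u x\<bar> \<le> B * u x" if "x \<in> \<Omega>" for x
      using mult_right_mono[OF f_bounded[OF that] u_nonneg[OF that]] u_nonneg[OF that]
      by (simp add: abs_mult B_def)
  qed
  have eq: "(\<integral>x. f x * (shrink (ratio k) u x - u x) \<partial>N) / (1 - ratio k) =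
      ratio k ^ CARD('n) * ((\<integral>x. f (dil (ratio k) x) * (u x - u (dil (ratio k) x)) \<partial>N) / (1 - ratio k))
      - (\<integral>x. indicator (layer (ratio k)) x * (f x * u x) \<partial>N) / (1 - ratio k)" for k
  proof -
    let ?h = "\<lambda>x. f (dil (ratio k) x) * (u x - u (dil (ratio k) x))"
    have hm: "?h \<in> borel_measurable N" using fm um by measurable
    have "\<bar>?h x\<bar> \<le> B * (M * radius * (1 - ratio k))" if "x \<in> \<Omega>" for x
    proof -
      have "\<bar>f (dil (ratio k) x)\<bar> \<le> B" using f_bounded[OF dilk[OF that]] by (simp add: B_def)
      moreover from this have "0 \<le> B" by (rule order_trans[OF abs_ge_zero])
      ultimately show ?thesis using lip[OF that, of k] by (simp only: abs_mult) (intro mult_mono, auto)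
    qed
    then have hi: "integrable N ?h"
      by (intro integrable_bounded[OF hm, of "B * (M * radius * (1 - ratio k))"] AE_I2) simp
    have fui: "integrable N (\<lambda>x. f x * u x)"
      using integrable_mult_bounded[OF u_integrable f_measurable, of B] f_bounded by (simp add: B_def mult.commute)
    have "(\<integral>x. f x * (shrink (ratio k) u x - u x) \<partial>N)
        = (\<integral>x. shrink (ratio k) ?h x - indicator (layer (ratio k)) x * (f x * u x) \<partial>N)"
    proof (rule Bochner_Integration.integral_cong[OF refl])
      fix x assume "x \<in> space N"
      then show "f x * (shrink (ratio k) u x - u x) =
          shrink (ratio k) ?h x - indicator (layer (ratio k)) x * (f x * u x)"
        using ratio(1)[of k] by (auto simp: shrink_def layer_def dil_dil indicator_def)
    qed
    also have "\<dots> = (\<integral>x. shrink (ratio k) ?h x \<partial>N) - (\<integral>x. indicator (layer (ratio k)) x * (f x * u x) \<partial>N)"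
      using ratio(1)[of k] ratio(2)[of k] by (intro Bochner_Integration.integral_diff integrable_shrink[OF hi] integrable_layer[OF fui]) auto
    also have "(\<integral>x. shrink (ratio k) ?h x \<partial>N) = ratio k ^ CARD('n) * (\<integral>x. ?h x \<partial>N)"
      using ratio(1)[of k] ratio(2)[of k] by (intro integral_shrink[OF hm]) auto
    finally show ?thesis by (simp add: diff_divide_distrib)
  qed
  have "(\<lambda>k. (\<integral>x. f x * (shrink (ratio k) u x - u x) \<partial>N) / (1 - ratio k)) \<longlonglongrightarrow>
      1 ^ CARD('n) * (\<integral>x. f x * (g x \<bullet> (x - a)) \<partial>N) - 0"
    unfolding eq by (intro tendsto_diff tendsto_mult tendsto_power L1 L2 ratio(3))
  then show ?thesis by (simp add: integral_f_radial)
qed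

text \<open>Test the equation with the difference of \<open>u\<close> and its competitor. By convexity of \<open>H^p / p\<close> the
  error of the linear approximation of the energy is nonnegative, and on the layer, where the gradient
  of the competitor is zero, it equals \<open>(1 - 1 / p) H(g)^p\<close>.\<close>

lemma dilation_energy_inequality:
  assumes t: "0 < t" "t < 1"
  shows "(1 - 1 / p) * (\<integral>x. indicator (layer t) x * H (g x) powr p \<partial>N)
    \<le> (t powr (real CARD('n) - p) - 1) * ((\<integral>x. H (g x) powr p \<partial>N) / p)
      - (\<integral>x. f x * (shrink t u x - u x) \<partial>N)"
proof -
  define gt where "gt = shrink t (\<lambda>x. (1 / t) *\<^sub>R g x)"
  have W: "W1p0 \<Omega> p (shrink t u) gt"
    unfolding gt_def using W1p0_shrink[OF u_W _ t(1)] t p_gt_1 by simp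
  have gtm: "gt \<in> borel_measurable N" using W unfolding W1p0_def W1p_def Lp_on_def by blast
  have gt_le: "norm (gt x) \<le> (1 / t) * M" for x
    using g_le t M_nonneg by (auto simp: gt_def shrink_def divide_right_mono)
  obtain B where B: "\<And>x. x \<in> \<Omega> \<Longrightarrow> norm (flux (g x)) \<le> B" by (rule flux_g_bounded) (rule that)
  have bnd: "\<bar>flux (g x) \<bullet> \<xi>\<bar> \<le> B * norm \<xi>" if "x \<in> \<Omega>" for x \<xi>
    using Cauchy_Schwarz_ineq2[of "flux (g x)" \<xi>] mult_right_mono[OF B[OF that] norm_ge_zero[of \<xi>]] by linarith
  have B0: "B \<ge> 0" using B \<Omega>_nonempty norm_ge_zero order_trans by blast
  have fi: "integrable N (\<lambda>x. flux (g x) \<bullet> gt x)" "integrable N (\<lambda>x. flux (g x) \<bullet> g x)"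
  proof -
    show "integrable N (\<lambda>x. flux (g x) \<bullet> gt x)"
    proof (rule integrable_bounded[of _ "B * ((1 / t) * M)"])
      show "(\<lambda>x. flux (g x) \<bullet> gt x) \<in> borel_measurable N" using gtm by measurable
      show "AE x in N. \<bar>flux (g x) \<bullet> gt x\<bar> \<le> B * (1 / t * M)"
        using bnd mult_left_mono[OF gt_le B0] by (intro AE_I2) (auto intro: order_trans)
    qed
    show "integrable N (\<lambda>x. flux (g x) \<bullet> g x)"
      unfolding flux_inner_self using p_gt_1 by (intro H_g_powr_integrable) simp
  qed
  have Hg: "integrable N (\<lambda>x. H (g x) powr p)" using p_gt_1 by (intro H_g_powr_integrable) simp
  have Hgt_eq: "H (gt x) powr p = shrink t (\<lambda>x. (1 / t) powr p * H (g x) powr p) x" for x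
    using t H_scale[of "1 / t"] H_nonneg by (simp add: gt_def shrink_def powr_mult powr_divide)
  have Hgt: "integrable N (\<lambda>x. H (gt x) powr p)"
    unfolding Hgt_eq using Hg t by (intro integrable_shrink) auto
  have Hgt_int: "(\<integral>x. H (gt x) powr p \<partial>N) = t powr (real CARD('n) - p) * (\<integral>x. H (g x) powr p \<partial>N)"
  proof -
    have "(\<integral>x. H (gt x) powr p \<partial>N) = t ^ CARD('n) * ((1 / t) powr p * (\<integral>x. H (g x) powr p \<partial>N))"
      unfolding Hgt_eq using t Hg by (subst integral_shrink) auto
    also have "t ^ CARD('n) * ((1 / t) powr p * (\<integral>x. H (g x) powr p \<partial>N)) =
        (t powr real CARD('n) / t powr p) * (\<integral>x. H (g x) powr p \<partial>N)"
      using t by (simp add: powr_realpow powr_divide)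
    finally show ?thesis by (simp add: powr_diff)
  qed
  have fl: "(\<integral>x. flux (g x) \<bullet> gt x \<partial>N) - (\<integral>x. flux (g x) \<bullet> g x \<partial>N) = (\<integral>x. f x * (shrink t u x - u x) \<partial>N)"
  proof -
    have i: "integrable N (\<lambda>x. f x * shrink t u x)" "integrable N (\<lambda>x. f x * u x)"
      using integrable_mult_bounded[OF integrable_shrink[OF u_integrable t(1)] f_measurable f_bounded]
        integrable_mult_bounded[OF u_integrable f_measurable f_bounded] t
      by (simp_all add: mult.commute)
    show ?thesis unfolding weak_equation[OF W] weak_equation[OF u_W] using i by (simp add: right_diff_distrib)
  qed
  have "(\<integral>x. (1 - 1 / p) * (indicator (layer t) x * H (g x) powr p) \<partial>N) \<le>
    (\<integral>x. H (gt x) powr p / p - H (g x) powr p / p - (flux (g x) \<bullet> gt x - flux (g x) \<bullet> g x) \<partial>N)"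
  proof (rule integral_mono)
    show "integrable N (\<lambda>x. (1 - 1 / p) * (indicator (layer t) x * H (g x) powr p))"
      using integrable_layer[OF Hg t(1)] by simp
    show "integrable N (\<lambda>x. H (gt x) powr p / p - H (g x) powr p / p - (flux (g x) \<bullet> gt x - flux (g x) \<bullet> g x))"
      using Hgt Hg fi by simp
    fix x assume "x \<in> space N"
    show "(1 - 1 / p) * (indicator (layer t) x * H (g x) powr p) \<le>
        H (gt x) powr p / p - H (g x) powr p / p - (flux (g x) \<bullet> gt x - flux (g x) \<bullet> g x)"
    proof (cases "x \<in> layer t")
      case True
      then have "gt x = 0" by (simp add: gt_def shrink_def layer_def)
      then show ?thesis using True by (simp add: flux_inner_self algebra_simps)
    next
      case False
      then show ?thesis using flux_subgradient[of "g x" "gt x"] by (simp add: inner_diff_right)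
    qed
  qed
  also have "\<dots> = (\<integral>x. H (gt x) powr p \<partial>N) / p - (\<integral>x. H (g x) powr p \<partial>N) / p
      - ((\<integral>x. flux (g x) \<bullet> gt x \<partial>N) - (\<integral>x. flux (g x) \<bullet> g x \<partial>N))"
    using Hgt Hg fi by simp
  finally have "(1 - 1 / p) * (\<integral>x. indicator (layer t) x * H (g x) powr p \<partial>N) \<le>
      t powr (real CARD('n) - p) * (\<integral>x. H (g x) powr p \<partial>N) / p - (\<integral>x. H (g x) powr p \<partial>N) / p
      - (\<integral>x. f x * (shrink t u x - u x) \<partial>N)"
    unfolding fl Hgt_int by (simp only: integral_mult_right_zero)
  then show ?thesis by (simp add: left_diff_distrib diff_divide_distrib)
qed

text \<open>The integrals of \<open>u^q\<close> cancel because \<open>q\<close> is the critical exponent, that is by \<open>n_div_q\<close>.\<close>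

lemma Pohozaev_limit:
  "(\<lambda>k. ((ratio k powr (real CARD('n) - p) - 1) * ((\<integral>x. H (g x) powr p \<partial>N) / p)
      - (\<integral>x. f x * (shrink (ratio k) u x - u x) \<partial>N)) / (1 - ratio k)) \<longlonglongrightarrow> \<mu> * (\<integral>x. u x powr p \<partial>N)"
proof -
  let ?n = "real CARD('n)" and ?E = "\<integral>x. H (g x) powr p \<partial>N"
  let ?A = "\<integral>x. u x powr p \<partial>N" and ?B = "\<integral>x. u x powr q \<partial>N"
  have "(\<lambda>k. (ratio k powr (?n - p) - 1) / (1 - ratio k) * (?E / p)
      - (\<integral>x. f x * (shrink (ratio k) u x - u x) \<partial>N) / (1 - ratio k)) \<longlonglongrightarrow>
      - (?n - p) * (?E / p) - (- ?n * (\<integral>x. F x \<partial>N))"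
    by (intro tendsto_diff tendsto_mult powr_quotient_tendsto ratio tendsto_const shrink_u_tendsto)
  moreover have "(\<integral>x. F x \<partial>N) = \<mu> * (?A / p) + ?B / q"
    unfolding F_def using u_powr_integrable p_gt_1 q_gt_1 by simp
  then have "- (?n - p) * (?E / p) - (- ?n * (\<integral>x. F x \<partial>N)) = \<mu> * ?A"
  proof -
    assume Fi: "(\<integral>x. F x \<partial>N) = \<mu> * (?A / p) + ?B / q"
    have "?n * (\<integral>x. F x \<partial>N) = ?n * (\<mu> * ?A / p) + (?n / q) * ?B"
      unfolding Fi by (simp add: distrib_left)
    also have "\<dots> = ?n * (\<mu> * ?A / p) + ((?n - p) / p) * ?B" unfolding n_div_q ..
    finally have "- (?n - p) * (?E / p) - (- ?n * (\<integral>x. F x \<partial>N)) =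
        - (?n - p) * ((\<mu> * ?A + ?B) / p) + (?n * (\<mu> * ?A / p) + ((?n - p) / p) * ?B)"
      unfolding energy_identity by linarith
    also have "\<dots> = \<mu> * ?A" using p_gt_1 by (simp add: field_simps)
    finally show ?thesis .
  qed
  moreover have "(X * e - I) / s = X / s * e - I / s" for X e I s :: real
    by (simp add: diff_divide_distrib)
  ultimately show ?thesis by (simp only:)
qed

lemma integral_u_powr_pos: "(\<integral>x. u x powr p \<partial>N) > 0"
proof -
  have "(\<integral>x. u x powr p \<partial>N) \<noteq> 0"
  proof
    assume "(\<integral>x. u x powr p \<partial>N) = 0"
    then have "AE x in N. u x powr p = 0"
      using integral_nonneg_eq_0_iff_AE[OF u_powr_integrable[of p]] p_gt_1 by auto
    then have "AE x in N. x \<notin> \<Omega>" using u_pos by eventually_elim simp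
    then have "\<Omega> \<in> null_sets N" using AE_iff_null_sets[of \<Omega> N] by simp
    then have "emeasure N \<Omega> = 0" by (simp add: null_sets_def)
    then have "emeasure lebesgue \<Omega> = 0" using \<Omega>_sets by (simp add: emeasure_restrict_space)
    then have "negligible \<Omega>" using \<Omega>_sets by (simp add: negligible_iff_null_sets null_sets_def)
    then show False using open_not_negligible[OF open_\<Omega> \<Omega>_nonempty] by blast
  qed
  moreover have "(\<integral>x. u x powr p \<partial>N) \<ge> 0" by (intro integral_nonneg_AE) simp
  ultimately show ?thesis by linarith
qed

text \<open>The quantities of \<open>dilation_energy_inequality\<close>, divided by \<open>1 - t\<close>, are nonnegative and tend to
  \<open>\<mu> \<integral> u^p\<close>.\<close>

theorem Pohozaev_inequality: "\<mu> \<ge> 0"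
proof -
  have "0 \<le> \<mu> * (\<integral>x. u x powr p \<partial>N)"
  proof (rule LIMSEQ_le_const[OF Pohozaev_limit], intro exI allI impI)
    fix k
    have "0 \<le> (1 - 1 / p) * (\<integral>x. indicator (layer (ratio k)) x * H (g x) powr p \<partial>N)"
      using p_gt_1 by (intro mult_nonneg_nonneg integral_nonneg_AE) auto
    then show "0 \<le> ((ratio k powr (real CARD('n) - p) - 1) * ((\<integral>x. H (g x) powr p \<partial>N) / p)
      - (\<integral>x. f x * (shrink (ratio k) u x - u x) \<partial>N)) / (1 - ratio k)"
      using dilation_energy_inequality[OF ratio(1,2), of k] ratio(2)[of k]
      by (intro divide_nonneg_pos) auto
  qed
  then show ?thesis using integral_u_powr_pos by (simp add: zero_le_mult_iff)
qed

text \<open>When the limit is zero, the term that the convexity inequality leaves over is \<open>o(1 - t)\<close>. In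
  classical terms: the gradient vanishes wherever rays from \<open>a\<close> cross the boundary transversally.\<close>

lemma layer_energy:
  assumes "\<mu> = 0"
  shows "(\<lambda>k. (\<integral>x. indicator (layer (ratio k)) x * H (g x) powr p \<partial>N) / (1 - ratio k)) \<longlonglongrightarrow> 0"
proof -
  let ?L = "\<lambda>k. \<integral>x. indicator (layer (ratio k)) x * H (g x) powr p \<partial>N"
  have "(\<lambda>k. (1 - 1 / p) * (?L k / (1 - ratio k))) \<longlonglongrightarrow> 0"
  proof (rule tendsto_sandwich[OF _ _ tendsto_const])
    show "\<forall>\<^sub>F k in sequentially. 0 \<le> (1 - 1 / p) * (?L k / (1 - ratio k))"
      using p_gt_1 ratio(2) less_imp_le
      by (intro always_eventually allI mult_nonneg_nonneg divide_nonneg_nonneg integral_nonneg_AE) auto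
    show "(\<lambda>k. ((ratio k powr (real CARD('n) - p) - 1) * ((\<integral>x. H (g x) powr p \<partial>N) / p)
      - (\<integral>x. f x * (shrink (ratio k) u x - u x) \<partial>N)) / (1 - ratio k)) \<longlonglongrightarrow> 0"
      using Pohozaev_limit assms by simp
    show "\<forall>\<^sub>F k in sequentially. (1 - 1 / p) * (?L k / (1 - ratio k)) \<le>
      ((ratio k powr (real CARD('n) - p) - 1) * ((\<integral>x. H (g x) powr p \<partial>N) / p)
      - (\<integral>x. f x * (shrink (ratio k) u x - u x) \<partial>N)) / (1 - ratio k)"
      using dilation_energy_inequality[OF ratio(1,2)] ratio(2)
      by (intro always_eventually allI) (simp add: divide_right_mono less_imp_le)
  qed
  then have "(\<lambda>k. (1 / (1 - 1 / p)) * ((1 - 1 / p) * (?L k / (1 - ratio k)))) \<longlonglongrightarrow> (1 / (1 - 1 / p)) * 0"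
    by (rule tendsto_mult_left)
  then show ?thesis using p_gt_1 by simp
qed

end

section \<open>A boundary point of maximal distance\<close>

context star_shaped_set
begin

text \<open>Let \<open>z\<close> be a point of the closure farthest from \<open>a\<close>, and \<open>w = z - a\<close>. The outer normal at \<open>z\<close> has
  a positive scalar product with \<open>w\<close>, so rays from \<open>a\<close> cross the boundary transversally near \<open>z\<close>. As
  \<open>\<Omega>\<close> lies in the ball around \<open>a\<close> through \<open>z\<close>, the half-space \<open>m \<le> (x - a) \<bullet> w\<close> alone cuts
  off a small cap near \<open>z\<close>, and a cutoff in the single direction \<open>w\<close> localizes to it.\<close>

lemma boundary_cap:
  assumes smooth: "smooth_boundary \<Omega>" and ne: "\<Omega> \<noteq> {}"
  obtains w \<phi> U m c1 c2 where "open U" "smooth_on \<phi> U" "\<Omega> \<inter> U = {y \<in> U. \<phi> y < 0}"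
    "m > 0" "c1 > 0" "\<And>x. x \<in> \<Omega> \<Longrightarrow> norm (x - a) \<le> norm w"
    "{x. norm (x - a) \<le> norm w \<and> m \<le> (x - a) \<bullet> w} \<subseteq> U"
    "\<exists>x\<in>\<Omega>. m < (x - a) \<bullet> w"
    "\<And>x y. norm (x - a) \<le> norm w \<Longrightarrow> m \<le> (x - a) \<bullet> w \<Longrightarrow> norm (y - a) \<le> norm w \<Longrightarrow> m \<le> (y - a) \<bullet> w
      \<Longrightarrow> c1 \<le> gradient \<phi> x \<bullet> (y - a)"
    "\<And>x. norm (x - a) \<le> norm w \<Longrightarrow> m \<le> (x - a) \<bullet> w \<Longrightarrow> norm (gradient \<phi> x) \<le> c2"
proof -
  have a: "a \<in> \<Omega>" using ne star[of _ 0] by auto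
  have cl: "compact (closure \<Omega>)" "closure \<Omega> \<noteq> {}"
    using bounded_\<Omega> ne by (auto simp: compact_closure)
  have "continuous_on (closure \<Omega>) (\<lambda>x. norm (x - a))" by (intro continuous_intros)
  then obtain z where z: "z \<in> closure \<Omega>" "\<And>x. x \<in> closure \<Omega> \<Longrightarrow> norm (x - a) \<le> norm (z - a)"
    using continuous_attains_sup[OF cl] by blast
  define w where "w = z - a"
  have far: "norm (x - a) \<le> norm w" if "x \<in> \<Omega>" for x
    using z(2) closure_subset that by (auto simp: w_def)
  have z_notin: "z \<notin> \<Omega>"
  proof
    assume "z \<in> \<Omega>"
    then obtain e where e: "e > 0" "ball z e \<subseteq> \<Omega>" using open_\<Omega> open_contains_ball by blast
    define v where "v = (if w = 0 then axis undefined 1 else w /\<^sub>R norm w)"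
    have "norm (z + (e / 2) *\<^sub>R v - a) = norm w + e / 2"
    proof (cases "w = 0")
      case True
      then show ?thesis using e(1) by (simp add: v_def w_def)
    next
      case False
      have "z + (e / 2) *\<^sub>R v - a = (1 + e / 2 / norm w) *\<^sub>R w"
      proof -
        have v: "v = (1 / norm w) *\<^sub>R w" using False by (simp add: v_def inverse_eq_divide)
        have "z + (e / 2) *\<^sub>R v - a = w + (e / 2) *\<^sub>R v" by (simp add: w_def)
        then show ?thesis unfolding v by (simp add: scaleR_add_left)
      qed
      also have "norm \<dots> = (1 + e / 2 / norm w) * norm w"
        using e(1) by (simp add: abs_of_nonneg add_nonneg_nonneg)
      also have "\<dots> = norm w + e / 2" using False by (simp add: distrib_right)
      finally show ?thesis .
    qed
    moreover have "norm v = 1" by (simp add: v_def)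
    then have "z + (e / 2) *\<^sub>R v \<in> ball z e" using e(1) by (simp add: dist_norm)
    then have "norm (z + (e / 2) *\<^sub>R v - a) \<le> norm w" using far e(2) by blast
    ultimately show False using e(1) by simp
  qed
  then have w0: "w \<noteq> 0" using a by (auto simp: w_def)
  have "z \<in> frontier \<Omega>" using z(1) z_notin open_\<Omega> by (simp add: frontier_def interior_open)
  then obtain U \<phi> where U: "local_defining_function \<Omega> z U \<phi>" "smooth_on \<phi> U"
    using smooth unfolding smooth_boundary_def by blast
  have U1: "open U" "z \<in> U" "\<Omega> \<inter> U = {y \<in> U. \<phi> y < 0}" "gradient \<phi> z \<noteq> 0"
    using U(1) unfolding local_defining_function_def by auto
  have \<phi>_cont: "continuous_on U \<phi>"
    using smooth_on_D[OF U(2), of 0] by simp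
  have grad_cont: "continuous_on U (gradient \<phi>)"
    by (rule continuous_on_gradient[OF U1(1) smooth_on_D[OF U(2)]])
  have "\<phi> z = 0"
  proof (rule antisym)
    show "0 \<le> \<phi> z" using z_notin U1(2,3) by force
    show "\<phi> z \<le> 0"
    proof (rule ccontr)
      assume "\<not> \<phi> z \<le> 0"
      have "open (U \<inter> \<phi> -` {0<..})" by (rule continuous_open_preimage[OF \<phi>_cont U1(1)]) simp
      moreover have "z \<in> U \<inter> \<phi> -` {0<..}" using U1(2) \<open>\<not> \<phi> z \<le> 0\<close> by auto
      ultimately have "U \<inter> \<phi> -` {0<..} \<inter> \<Omega> \<noteq> {}"
        using z(1) open_Int_closure_eq_empty by blast
      then obtain y where "y \<in> U" "\<phi> y > 0" "y \<in> \<Omega>" by blast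
      then show False using U1(3) by force
    qed
  qed
  have outward: "gradient \<phi> z \<bullet> w > 0"
  proof (rule ccontr)
    \<comment> \<open>otherwise one could move from \<open>z\<close> into \<open>\<Omega>\<close> while increasing the distance to \<open>a\<close>\<close>
    assume neg: "\<not> gradient \<phi> z \<bullet> w > 0"
    define h where "h = w - gradient \<phi> z"
    have hg: "h \<bullet> gradient \<phi> z < 0"
    proof -
      have "gradient \<phi> z \<bullet> gradient \<phi> z > 0" using U1(4) by simp
      moreover have "h \<bullet> gradient \<phi> z = w \<bullet> gradient \<phi> z - gradient \<phi> z \<bullet> gradient \<phi> z"
        by (simp add: h_def inner_diff_left)
      ultimately show ?thesis using neg inner_commute[of w "gradient \<phi> z"] by linarith
    qed
    have wh: "w \<bullet> h > 0"
    proof -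
      have "w \<bullet> w > 0" using w0 by simp
      moreover have "w \<bullet> h = w \<bullet> w - w \<bullet> gradient \<phi> z"
        by (simp add: h_def inner_diff_right)
      ultimately show ?thesis using neg inner_commute[of w "gradient \<phi> z"] by linarith
    qed
    have "(\<lambda>k. real (Suc k) * (\<phi> (z + (1 / real (Suc k)) *\<^sub>R h) - \<phi> z)) \<longlonglongrightarrow> h \<bullet> gradient \<phi> z"
      by (rule GDERIV_directional_limit[OF smooth_on_GDERIV[OF U(2) U1(2)]])
    then have "\<forall>\<^sub>F k in sequentially. real (Suc k) * (\<phi> (z + (1 / real (Suc k)) *\<^sub>R h) - \<phi> z) < 0"
      by (rule order_tendstoD(2)[OF _ hg])
    moreover have "(\<lambda>k. z + (1 / real (Suc k)) *\<^sub>R h) \<longlonglongrightarrow> z + 0 *\<^sub>R h"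
      using LIMSEQ_inverse_real_of_nat by (intro tendsto_intros) (simp add: divide_inverse del: of_nat_Suc)
    then have "\<forall>\<^sub>F k in sequentially. z + (1 / real (Suc k)) *\<^sub>R h \<in> U"
      by (rule topological_tendstoD) (use U1 in auto)
    ultimately have "\<forall>\<^sub>F k in sequentially. real (Suc k) * (\<phi> (z + (1 / real (Suc k)) *\<^sub>R h) - \<phi> z) < 0 \<and>
        z + (1 / real (Suc k)) *\<^sub>R h \<in> U" by (rule eventually_conj)
    then obtain k where k: "real (Suc k) * (\<phi> (z + (1 / real (Suc k)) *\<^sub>R h) - \<phi> z) < 0"
        "z + (1 / real (Suc k)) *\<^sub>R h \<in> U"
      using eventually_happens'[OF sequentially_bot] by blast
    define s where "s = 1 / real (Suc k)"
    have s: "s > 0" by (simp add: s_def)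
    have "\<phi> (z + s *\<^sub>R h) < 0"
      using k(1) \<open>\<phi> z = 0\<close> by (simp add: s_def mult_less_0_iff del: of_nat_Suc)
    then have "z + s *\<^sub>R h \<in> \<Omega>" using k(2) U1(3) by (auto simp: s_def)
    then have "norm (w + s *\<^sub>R h) \<le> norm w" using far[of "z + s *\<^sub>R h"] by (simp add: w_def algebra_simps)
    then have "(w + s *\<^sub>R h) \<bullet> (w + s *\<^sub>R h) \<le> w \<bullet> w" by (simp add: norm_le)
    moreover have "(w + s *\<^sub>R h) \<bullet> (w + s *\<^sub>R h) = w \<bullet> w + 2 * s * (w \<bullet> h) + s\<^sup>2 * (h \<bullet> h)"
      by (simp add: inner_add_left inner_add_right inner_commute power2_eq_square)
    moreover have "2 * s * (w \<bullet> h) > 0" "s\<^sup>2 * (h \<bullet> h) \<ge> 0" using s wh by auto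
    ultimately show False by linarith
  qed
  define L where "L = gradient \<phi> z \<bullet> w"
  have "continuous_on (U \<times> UNIV) (\<lambda>P. gradient \<phi> (fst P) \<bullet> (snd P - a))"
    by (intro continuous_intros continuous_on_compose2[OF grad_cont]) auto
  then have "open ((U \<times> UNIV) \<inter> (\<lambda>P. gradient \<phi> (fst P) \<bullet> (snd P - a)) -` {L / 2<..})"
    using U1(1) by (intro continuous_open_preimage open_Times) auto
  moreover have "(z, z) \<in> (U \<times> UNIV) \<inter> (\<lambda>P. gradient \<phi> (fst P) \<bullet> (snd P - a)) -` {L / 2<..}"
    using U1(2) outward by (simp add: L_def w_def)
  ultimately obtain A B where AB0: "open A" "open B" "(z, z) \<in> A \<times> B"
      "A \<times> B \<subseteq> (U \<times> UNIV) \<inter> (\<lambda>P. gradient \<phi> (fst P) \<bullet> (snd P - a)) -` {L / 2<..}"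
    by (rule open_prod_elim) (rule that)
  then have AB: "open A" "open B" "z \<in> A" "z \<in> B"
      "A \<times> B \<subseteq> (U \<times> UNIV) \<inter> (\<lambda>P. gradient \<phi> (fst P) \<bullet> (snd P - a)) -` {L / 2<..}"
    by auto
  have "open (A \<inter> B)" "z \<in> A \<inter> B" using AB by auto
  then obtain r0 where r0: "r0 > 0" "ball z r0 \<subseteq> A \<inter> B"
    using open_contains_ball[of "A \<inter> B"] by blast
  define r where "r = min r0 (norm w)"
  have r: "r > 0" "r \<le> norm w" "ball z r \<subseteq> A \<inter> B" using r0 w0 by (auto simp: r_def)
  \<comment> \<open>in the cap \<open>|x - z|\<^sup>2 \<le> 2 (|w|\<^sup>2 - m) = r\<^sup>2 / 2\<close>\<close>
  define m where "m = (norm w)\<^sup>2 - r\<^sup>2 / 4"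
  have "r\<^sup>2 \<le> (norm w)\<^sup>2" using r by (intro power_mono) auto
  moreover have "r\<^sup>2 > 0" using r(1) by simp
  ultimately have m: "m > 0" "m < (norm w)\<^sup>2" unfolding m_def by linarith+
  define C where "C = {x. norm (x - a) \<le> norm w \<and> m \<le> (x - a) \<bullet> w}"
  have Cball: "C \<subseteq> ball z r"
  proof
    fix x assume "x \<in> C"
    then have x: "norm (x - a) \<le> norm w" "m \<le> (x - a) \<bullet> w" by (auto simp: C_def)
    have "(norm (x - a))\<^sup>2 \<le> (norm w)\<^sup>2" using x(1) by (intro power_mono) auto
    moreover have "(norm (x - a - w))\<^sup>2 = (norm (x - a))\<^sup>2 + (norm w)\<^sup>2 - 2 * ((x - a) \<bullet> w)"
      using dot_norm_neg[of "x - a" w] by simp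
    ultimately have "(norm (x - a - w))\<^sup>2 < r\<^sup>2" using x(2) \<open>r\<^sup>2 > 0\<close> unfolding m_def by linarith
    then have "norm (x - a - w) < r" using r(1) by (simp add: power_less_imp_less_base)
    then show "x \<in> ball z r" by (simp add: w_def dist_norm norm_minus_commute)
  qed
  have CU: "C \<subseteq> U" using Cball r(3) AB(4,5) by blast
  have "C = cball a (norm w) \<inter> {x. m \<le> (x - a) \<bullet> w}"
    by (auto simp: C_def dist_norm norm_minus_commute)
  moreover have "closed {x. m \<le> (x - a) \<bullet> w}" by (intro closed_Collect_le continuous_intros)
  ultimately have "compact C" by (simp add: compact_Int_closed)
  then have "compact (gradient \<phi> ` C)"
    by (rule compact_continuous_image[rotated]) (rule continuous_on_subset[OF grad_cont CU])
  then obtain c2 where c2: "\<And>x. x \<in> C \<Longrightarrow> norm (gradient \<phi> x) \<le> c2"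
    using compact_imp_bounded by (force simp: bounded_iff)
  have meets: "\<exists>x\<in>\<Omega>. m < (x - a) \<bullet> w"
  proof -
    have "open {x. m < (x - a) \<bullet> w}" by (intro open_Collect_less continuous_intros)
    moreover have "z \<in> {x. m < (x - a) \<bullet> w}"
      using m(2) by (simp add: w_def power2_norm_eq_inner)
    ultimately have "{x. m < (x - a) \<bullet> w} \<inter> \<Omega> \<noteq> {}" using z(1) open_Int_closure_eq_empty by blast
    then show ?thesis by blast
  qed
  have trans: "L / 2 \<le> gradient \<phi> x \<bullet> (y - a)" if "x \<in> C" "y \<in> C" for x y
  proof -
    have "(x, y) \<in> A \<times> B" using that Cball r(3) by blast
    then have "(x, y) \<in> (\<lambda>P. gradient \<phi> (fst P) \<bullet> (snd P - a)) -` {L / 2<..}" using AB(5) by blast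
    then show ?thesis by simp
  qed
  show thesis
    by (rule that[of U \<phi> m "L / 2" w c2])
      (use U1 U(2) m outward far CU meets trans c2 in \<open>auto simp: C_def L_def\<close>)
qed

end

section \<open>The regularized logarithm\<close>

definition reg_abs :: "real \<Rightarrow> real \<Rightarrow> real" where
  "reg_abs \<epsilon> s = sqrt (s\<^sup>2 + \<epsilon>\<^sup>2)"

text \<open>For \<open>s \<ge> 0\<close> this is comparable with \<open>s + \<epsilon>\<close>. It is smooth and greater than \<open>\<epsilon>\<close> on the whole line,
  as it has to be composed with test functions that may take negative values.\<close>

definition softplus :: "real \<Rightarrow> real \<Rightarrow> real" where
  "softplus \<epsilon> s = \<epsilon> + (s + reg_abs \<epsilon> s)"

definition softplus_deriv :: "real \<Rightarrow> real \<Rightarrow> real" where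
  "softplus_deriv \<epsilon> s = 1 + s / reg_abs \<epsilon> s"

context
  fixes \<epsilon> :: real
  assumes \<epsilon>: "\<epsilon> > 0"
begin

lemma reg_abs_square: "reg_abs \<epsilon> s * reg_abs \<epsilon> s = s\<^sup>2 + \<epsilon>\<^sup>2"
  by (simp add: reg_abs_def)

lemma reg_abs_pos: "reg_abs \<epsilon> s > 0" "reg_abs \<epsilon> s \<ge> \<epsilon>" "\<bar>s\<bar> < reg_abs \<epsilon> s"
proof -
  have e2: "\<epsilon>\<^sup>2 > 0" using \<epsilon> by simp
  have "sqrt (\<epsilon>\<^sup>2) \<le> sqrt (s\<^sup>2 + \<epsilon>\<^sup>2)" by (intro real_sqrt_le_mono) simp
  then show ge: "reg_abs \<epsilon> s \<ge> \<epsilon>" using \<epsilon> by (simp add: reg_abs_def)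
  then show "reg_abs \<epsilon> s > 0" using \<epsilon> by linarith
  have "sqrt (s\<^sup>2) < sqrt (s\<^sup>2 + \<epsilon>\<^sup>2)" using e2 by (intro real_sqrt_less_mono) simp
  then show "\<bar>s\<bar> < reg_abs \<epsilon> s" by (simp add: reg_abs_def)
qed

lemma softplus_gt: "softplus \<epsilon> s > \<epsilon>"
  using reg_abs_pos(3)[of s] by (simp add: softplus_def)

lemma softplus_deriv_bounds: "0 \<le> softplus_deriv \<epsilon> s" "softplus_deriv \<epsilon> s \<le> 2" "s \<ge> 0 \<Longrightarrow> 1 \<le> softplus_deriv \<epsilon> s"
proof -
  have "s / reg_abs \<epsilon> s \<le> 1" "- 1 \<le> s / reg_abs \<epsilon> s"
    using reg_abs_pos(1,3)[of s] by (auto simp: divide_le_eq le_divide_eq)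
  then show "0 \<le> softplus_deriv \<epsilon> s" "softplus_deriv \<epsilon> s \<le> 2" by (auto simp: softplus_deriv_def)
  show "s \<ge> 0 \<Longrightarrow> 1 \<le> softplus_deriv \<epsilon> s" using reg_abs_pos(1)[of s] by (simp add: softplus_deriv_def)
qed

lemma softplus_bounds:
  assumes "s \<ge> 0" shows "2 * \<epsilon> \<le> softplus \<epsilon> s" "s \<le> softplus \<epsilon> s" "softplus \<epsilon> s \<le> 2 * \<epsilon> + 2 * s"
proof -
  have "reg_abs \<epsilon> s \<le> s + \<epsilon>"
    using sqrt_sum_squares_le_sum[of s \<epsilon>] assms \<epsilon> by (simp add: reg_abs_def)
  then show "softplus \<epsilon> s \<le> 2 * \<epsilon> + 2 * s" by (simp add: softplus_def)
  show "2 * \<epsilon> \<le> softplus \<epsilon> s" "s \<le> softplus \<epsilon> s"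
    using reg_abs_pos(1,2)[of s] assms \<epsilon> unfolding softplus_def by linarith+
qed

lemma DERIV_reg_abs: "(reg_abs \<epsilon> has_real_derivative s / reg_abs \<epsilon> s) (at s)"
proof -
  have pos: "s\<^sup>2 + \<epsilon>\<^sup>2 > 0" using \<epsilon> by (simp add: add_nonneg_pos)
  have "((\<lambda>s. s\<^sup>2 + \<epsilon>\<^sup>2) has_real_derivative 2 * s) (at s)" by (auto intro!: derivative_eq_intros)
  from DERIV_chain2[OF DERIV_real_sqrt[OF pos] this]
  have "((\<lambda>s. sqrt (s\<^sup>2 + \<epsilon>\<^sup>2)) has_real_derivative inverse (sqrt (s\<^sup>2 + \<epsilon>\<^sup>2)) / 2 * (2 * s)) (at s)" .
  moreover have "inverse r / 2 * (2 * s) = s / r" for r :: real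
    by (cases "r = 0") (auto simp: field_simps)
  ultimately show ?thesis unfolding reg_abs_def[abs_def] by (simp only:)
qed

lemma DERIV_softplus: "(softplus \<epsilon> has_real_derivative softplus_deriv \<epsilon> s) (at s)"
  unfolding softplus_def[abs_def] softplus_deriv_def
  by (auto intro!: derivative_eq_intros DERIV_reg_abs)

lemma DERIV_softplus_deriv:
  "(softplus_deriv \<epsilon> has_real_derivative \<epsilon>\<^sup>2 / reg_abs \<epsilon> s ^ 3) (at s)"
proof -
  let ?r = "reg_abs \<epsilon> s"
  have r: "?r > 0" by (rule reg_abs_pos)
  have r0: "?r \<noteq> 0" using r by simp
  have "((\<lambda>s. s / reg_abs \<epsilon> s) has_real_derivative (1 * ?r - s * (s / ?r)) / (?r * ?r)) (at s)"
    by (rule DERIV_divide[OF DERIV_ident DERIV_reg_abs r0])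
  then have "(softplus_deriv \<epsilon> has_real_derivative 0 + (1 * ?r - s * (s / ?r)) / (?r * ?r)) (at s)"
    unfolding softplus_deriv_def[abs_def] by (intro DERIV_add DERIV_const)
  moreover have "(1 * ?r - s * (s / ?r)) / (?r * ?r) = \<epsilon>\<^sup>2 / ?r ^ 3"
  proof -
    have "1 * ?r - s * (s / ?r) = (?r * ?r - s\<^sup>2) / ?r"
      using r0 by (simp add: diff_divide_distrib power2_eq_square)
    also have "\<dots> = \<epsilon>\<^sup>2 / ?r" by (simp add: reg_abs_square)
    finally show ?thesis by (simp add: power3_eq_cube)
  qed
  ultimately show ?thesis by simp
qed

lemma softplus_second_bound: "\<bar>\<epsilon>\<^sup>2 / reg_abs \<epsilon> s ^ 3\<bar> \<le> 1 / \<epsilon>"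
proof -
  have "\<epsilon> ^ 3 \<le> reg_abs \<epsilon> s ^ 3" using \<epsilon> by (intro power_mono reg_abs_pos) auto
  then have "\<epsilon>\<^sup>2 / reg_abs \<epsilon> s ^ 3 \<le> \<epsilon>\<^sup>2 / \<epsilon> ^ 3"
    using \<epsilon> reg_abs_pos(1)[of s] by (intro divide_left_mono) auto
  also have "\<dots> = 1 / \<epsilon>" using \<epsilon> by (simp add: power2_eq_square power3_eq_cube)
  finally show ?thesis using reg_abs_pos(1)[of s] by simp
qed

lemma softplus_pos: "softplus \<epsilon> s > 0"
  using softplus_gt[of s] \<epsilon> by linarith

lemma Ck_on_softplus:
  assumes "Ck_on k \<phi> S" shows "Ck_on k (\<lambda>x. softplus \<epsilon> (\<phi> x)) S"
proof -
  have e2: "\<epsilon>\<^sup>2 > 0" using \<epsilon> by simp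
  have "Ck_on k (\<lambda>x. (\<phi> x * \<phi> x + \<epsilon>\<^sup>2) powr (1 / 2)) S"
    by (rule Ck_on_compose[OF infinitely_differentiable_powr Ck_on_add[OF Ck_on_mult[OF assms assms] Ck_on_const]])
      (use e2 in \<open>auto intro: add_nonneg_pos\<close>)
  moreover have "(\<phi> x * \<phi> x + \<epsilon>\<^sup>2) powr (1 / 2) = reg_abs \<epsilon> (\<phi> x)" for x
    by (simp add: powr_half_sqrt power2_eq_square reg_abs_def)
  ultimately have "Ck_on k (\<lambda>x. reg_abs \<epsilon> (\<phi> x)) S" by simp
  then show ?thesis unfolding softplus_def
    by (intro Ck_on_add Ck_on_const assms)
qed

lemma Ck_on_softplus_powr:
  assumes "Ck_on k \<phi> S" shows "Ck_on k (\<lambda>x. softplus \<epsilon> (\<phi> x) powr r) S"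
  by (rule Ck_on_compose[OF infinitely_differentiable_powr Ck_on_softplus[OF assms]])
    (auto simp: softplus_pos)

lemma DERIV_softplus_powr:
  "((\<lambda>s. softplus \<epsilon> s powr r) has_real_derivative r * softplus \<epsilon> s powr (r - 1) * softplus_deriv \<epsilon> s) (at s)"
  using softplus_pos[of s] by (auto intro!: derivative_eq_intros DERIV_softplus)

lemma softplus_powr_le: "r \<le> 0 \<Longrightarrow> softplus \<epsilon> s powr r \<le> \<epsilon> powr r"
  using softplus_gt[of s] \<epsilon> by (intro powr_mono2') auto

lemma softplus_powr_bounds:
  assumes r: "r \<le> 0"
  obtains B where "\<And>s. \<bar>softplus \<epsilon> s powr r\<bar> \<le> B"
    "\<And>s. \<bar>r * softplus \<epsilon> s powr (r - 1) * softplus_deriv \<epsilon> s\<bar> \<le> B"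
    "\<And>s s'. \<bar>r * softplus \<epsilon> s powr (r - 1) * softplus_deriv \<epsilon> s - r * softplus \<epsilon> s' powr (r - 1) * softplus_deriv \<epsilon> s'\<bar>
      \<le> B * \<bar>s - s'\<bar>"
proof -
  let ?G' = "\<lambda>s. r * softplus \<epsilon> s powr (r - 1) * softplus_deriv \<epsilon> s"
  let ?G'' = "\<lambda>s. r * ((r - 1) * softplus \<epsilon> s powr (r - 1 - 1) * softplus_deriv \<epsilon> s) * softplus_deriv \<epsilon> s
      + r * softplus \<epsilon> s powr (r - 1) * (\<epsilon>\<^sup>2 / reg_abs \<epsilon> s ^ 3)"
  define B0 where "B0 = \<epsilon> powr r"
  define B1 where "B1 = \<bar>r\<bar> * \<epsilon> powr (r - 1) * 2"
  define B2 where "B2 = \<bar>r\<bar> * (\<bar>r - 1\<bar> * \<epsilon> powr (r - 1 - 1) * 2) * 2 + \<bar>r\<bar> * \<epsilon> powr (r - 1) * (1 / \<epsilon>)"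
  have sd: "\<bar>softplus_deriv \<epsilon> s\<bar> \<le> 2" for s using softplus_deriv_bounds[of s] by simp
  have sp: "\<bar>softplus \<epsilon> s powr e\<bar> \<le> \<epsilon> powr e" if "e \<le> 0" for s e using softplus_powr_le[OF that] by simp
  have G1: "\<bar>?G' s\<bar> \<le> B1" for s
    unfolding abs_mult B1_def using r by (intro mult_mono sp sd order_refl mult_nonneg_nonneg) auto
  have G2: "\<bar>?G'' s\<bar> \<le> B2" for s
  proof -
    have "\<bar>?G'' s\<bar> \<le> \<bar>r * ((r - 1) * softplus \<epsilon> s powr (r - 1 - 1) * softplus_deriv \<epsilon> s) * softplus_deriv \<epsilon> s\<bar>
      + \<bar>r * softplus \<epsilon> s powr (r - 1) * (\<epsilon>\<^sup>2 / reg_abs \<epsilon> s ^ 3)\<bar>" by (rule abs_triangle_ineq)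
    also have "\<dots> \<le> B2"
    proof (unfold B2_def, rule add_mono)
      show "\<bar>r * ((r - 1) * softplus \<epsilon> s powr (r - 1 - 1) * softplus_deriv \<epsilon> s) * softplus_deriv \<epsilon> s\<bar>
          \<le> \<bar>r\<bar> * (\<bar>r - 1\<bar> * \<epsilon> powr (r - 1 - 1) * 2) * 2"
        unfolding abs_mult using r by (intro mult_mono sp sd order_refl mult_nonneg_nonneg) auto
      have "\<bar>r * softplus \<epsilon> s powr (r - 1)\<bar> \<le> \<bar>r\<bar> * \<epsilon> powr (r - 1)"
        unfolding abs_mult using r by (intro mult_mono sp order_refl) auto
      then show "\<bar>r * softplus \<epsilon> s powr (r - 1) * (\<epsilon>\<^sup>2 / reg_abs \<epsilon> s ^ 3)\<bar> \<le> \<bar>r\<bar> * \<epsilon> powr (r - 1) * (1 / \<epsilon>)"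
        by (subst abs_mult) (intro mult_mono softplus_second_bound, auto)
    qed
    finally show ?thesis .
  qed
  have D: "(?G' has_real_derivative ?G'' s) (at s)" for s
    using DERIV_mult[OF DERIV_cmult[OF DERIV_softplus_powr[of "r - 1" s], of r] DERIV_softplus_deriv[of s]]
    by (simp add: algebra_simps)
  have L: "\<bar>?G' s - ?G' s'\<bar> \<le> B2 * \<bar>s - s'\<bar>" for s s'
    using field_differentiable_bound[of UNIV ?G' ?G'' B2 s s'] D G2 by simp
  define B where "B = max B0 (max B1 B2)"
  show thesis
  proof (rule that[of B])
    show "\<bar>softplus \<epsilon> s powr r\<bar> \<le> B" for s using sp[OF r, of s] by (simp add: B_def B0_def)
    show "\<bar>?G' s\<bar> \<le> B" for s using G1[of s] by (simp add: B_def)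
    show "\<bar>?G' s - ?G' s'\<bar> \<le> B * \<bar>s - s'\<bar>" for s s'
    proof -
      have "B2 \<le> B" by (simp add: B_def)
      then show ?thesis by (rule order_trans[OF L mult_right_mono]) simp
    qed
  qed
qed

end

context bounded_open_set
begin

lemma not_AE_outside_open:
  assumes "open V" "V \<noteq> {}" "V \<subseteq> \<Omega>"
  shows "\<not> (AE x in N. x \<notin> V)"
proof
  assume "AE x in N. x \<notin> V"
  then have "AE x in lebesgue. x \<in> \<Omega> \<longrightarrow> x \<notin> V" using \<Omega>_sets by (simp add: AE_restrict_space_iff)
  then have "AE x in lebesgue. x \<notin> V" by eventually_elim (use assms(3) in blast)
  then have "negligible V"
    using AE_iff_null_sets[of V lebesgue] assms(1) by (simp add: negligible_iff_null_sets)
  then show False using open_not_negligible[OF assms(1,2)] by blast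
qed

end

section \<open>The strong maximum principle at the cap\<close>

text \<open>A solution for \<open>\<mu> = 0\<close>, together with a cap as provided by \<open>boundary_cap\<close>.\<close>

locale critical_solution = bounded_C1_solution \<Omega> a H p u g M \<mu>
  for \<Omega> :: "(real^'n) set" and a :: "real^'n" and H :: "real^'n \<Rightarrow> real" and p :: real
    and u :: "real^'n \<Rightarrow> real" and g :: "real^'n \<Rightarrow> real^'n" and M \<mu> :: real +
  fixes w :: "real^'n" and \<phi> :: "real^'n \<Rightarrow> real" and U :: "(real^'n) set" and m c1 c2 :: real
  assumes \<mu>0: "\<mu> = 0"
    and U: "open U" "smooth_on \<phi> U" "\<Omega> \<inter> U = {y \<in> U. \<phi> y < 0}"
    and m: "m > 0" and c1: "c1 > 0"
    and far: "\<And>x. x \<in> \<Omega> \<Longrightarrow> norm (x - a) \<le> norm w"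
    and cap_U: "{x. norm (x - a) \<le> norm w \<and> m \<le> (x - a) \<bullet> w} \<subseteq> U"
    and cap_nonempty: "\<exists>x\<in>\<Omega>. m < (x - a) \<bullet> w"
    and transversal: "\<And>x y. norm (x - a) \<le> norm w \<Longrightarrow> m \<le> (x - a) \<bullet> w \<Longrightarrow> norm (y - a) \<le> norm w \<Longrightarrow>
      m \<le> (y - a) \<bullet> w \<Longrightarrow> c1 \<le> gradient \<phi> x \<bullet> (y - a)"
    and c2: "\<And>x. norm (x - a) \<le> norm w \<Longrightarrow> m \<le> (x - a) \<bullet> w \<Longrightarrow> norm (gradient \<phi> x) \<le> c2"
begin

definition volume :: real where "volume = (\<integral>x. 1 \<partial>N)"

lemma volume_nonneg: "volume \<ge> 0"
  by (simp add: volume_def)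

lemma layer_volume:
  "(\<lambda>k. (\<integral>x. indicator (layer (ratio k)) x * 1 \<partial>N) / (1 - ratio k)) \<longlonglongrightarrow> real CARD('n) * volume"
proof -
  have "(\<lambda>k. (\<integral>x. indicator (layer (ratio k)) x * 1 \<partial>N) / (1 - ratio k)) \<longlonglongrightarrow>
    real CARD('n) * (\<integral>x. 1 \<partial>N) + (\<integral>x. 0 \<partial>N)"
    by (rule layer_integral_tendsto[OF _ _ ratio, where C=0]) auto
  then show ?thesis by (simp add: volume_def)
qed

text \<open>Young's inequality plays off the energy of the layer, which is \<open>o(1 - t)\<close>, against its volume,
  which is \<open>O(1 - t)\<close>. It follows that the solution has no flux through the boundary in the cap.\<close>

lemma layer_flux:
  "(\<lambda>k. (\<integral>x. indicator (layer (ratio k)) x * H (g x) powr (p - 1) \<partial>N) / (1 - ratio k)) \<longlonglongrightarrow> 0"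
proof (rule LIMSEQ_I)
  fix e :: real assume e: "e > 0"
  let ?J = "\<lambda>k. (\<integral>x. indicator (layer (ratio k)) x * H (g x) powr (p - 1) \<partial>N) / (1 - ratio k)"
  let ?E = "\<lambda>k. (\<integral>x. indicator (layer (ratio k)) x * H (g x) powr p \<partial>N) / (1 - ratio k)"
  let ?V = "\<lambda>k. (\<integral>x. indicator (layer (ratio k)) x * 1 \<partial>N) / (1 - ratio k)"
  define V where "V = real CARD('n) * volume + 1"
  have V: "V > 0" using volume_nonneg by (simp add: V_def add_nonneg_pos)
  \<comment> \<open>the weight in Young's inequality for which the volume term is at most \<open>e / 2\<close>\<close>
  define D where "D = (e / (2 * V)) powr (1 / (1 - p))"
  have D: "D > 0" using e V by (simp add: D_def)
  have D_powr: "D powr (1 - p) = e / (2 * V)"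
    using e V p_gt_1 by (simp add: D_def powr_powr)
  have "(\<lambda>k. D * ?E k) \<longlonglongrightarrow> D * 0" by (intro tendsto_mult_left layer_energy \<mu>0)
  then have ev1: "\<forall>\<^sub>F k in sequentially. D * ?E k < e / 2" by (rule order_tendstoD) (use e in simp)
  have ev2: "\<forall>\<^sub>F k in sequentially. ?V k < V"
    by (rule order_tendstoD[OF layer_volume]) (simp add: V_def)
  have "\<forall>\<^sub>F k in sequentially. norm (?J k - 0) < e"
    using ev1 ev2
  proof eventually_elim
    case (elim k)
    have i: "integrable N (\<lambda>x. indicator (layer (ratio k)) x * H (g x) powr p)"
      "integrable N (\<lambda>x. indicator (layer (ratio k)) x * 1 :: real)"
      "integrable N (\<lambda>x. indicator (layer (ratio k)) x * H (g x) powr (p - 1))"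
      using p_gt_1 by (intro integrable_layer H_g_powr_integrable ratio; simp)+
    have "(\<integral>x. indicator (layer (ratio k)) x * H (g x) powr (p - 1) \<partial>N) \<le>
      (\<integral>x. D * (indicator (layer (ratio k)) x * H (g x) powr p)
        + D powr (1 - p) * (indicator (layer (ratio k)) x * 1) \<partial>N)"
    proof (rule integral_mono)
      show "integrable N (\<lambda>x. D * (indicator (layer (ratio k)) x * H (g x) powr p)
        + D powr (1 - p) * (indicator (layer (ratio k)) x * 1))" using i by simp
      show "indicator (layer (ratio k)) x * H (g x) powr (p - 1) \<le>
          D * (indicator (layer (ratio k)) x * H (g x) powr p)
        + D powr (1 - p) * (indicator (layer (ratio k)) x * 1)" for x
        using powr_mult_le_eps[OF H_nonneg zero_le_one p_gt_1 D, of "g x"] by (simp add: indicator_def)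
    qed (rule i)
    also have "\<dots> = D * (\<integral>x. indicator (layer (ratio k)) x * H (g x) powr p \<partial>N)
        + D powr (1 - p) * (\<integral>x. indicator (layer (ratio k)) x * 1 \<partial>N)"
      using i by simp
    finally have "?J k \<le> (D * (\<integral>x. indicator (layer (ratio k)) x * H (g x) powr p \<partial>N)
        + D powr (1 - p) * (\<integral>x. indicator (layer (ratio k)) x * 1 \<partial>N)) / (1 - ratio k)"
      using ratio(2)[of k] by (intro divide_right_mono) auto
    also have "\<dots> = D * ?E k + D powr (1 - p) * ?V k" by (simp add: add_divide_distrib)
    also have "\<dots> < e / 2 + D powr (1 - p) * V"
      using elim D by (intro add_less_le_mono mult_left_mono) auto
    also have "\<dots> = e" using V by (simp add: D_powr)
    finally have "?J k < e" .
    moreover have "0 \<le> ?J k"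
      using ratio(2)[of k] by (intro divide_nonneg_nonneg integral_nonneg_AE) auto
    ultimately show ?case by (simp only: diff_zero real_norm_def abs_of_nonneg)
  qed
  then show "\<exists>k0. \<forall>k\<ge>k0. norm (?J k - 0) < e" by (simp add: eventually_sequentially)
qed

definition height :: "real^'n \<Rightarrow> real" where "height x = (x - a) \<bullet> w - m"

definition \<zeta> :: "real^'n \<Rightarrow> real" where "\<zeta> x = bump (height x)"

lemma height_GDERIV: "GDERIV height x :> w"
  unfolding height_def[abs_def] gderiv_def by (auto intro!: derivative_eq_intros)

lemma \<zeta>_GDERIV: "GDERIV \<zeta> x :> bump_deriv (height x) *\<^sub>R w"
  unfolding \<zeta>_def[abs_def] by (rule GDERIV_DERIV_compose[OF height_GDERIV DERIV_bump])

lemma \<zeta>_bounds: "0 \<le> \<zeta> x" "\<zeta> x \<le> 1"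
  by (simp_all add: \<zeta>_def bump_bounds)

lemma \<zeta>_continuous: "continuous_on S \<zeta>"
  by (intro continuous_at_imp_continuous_on ballI GDERIV_isCont[OF \<zeta>_GDERIV])

lemma \<zeta>_measurable [measurable]: "\<zeta> \<in> borel_measurable N"
  by (rule measurable_on_\<Omega>[OF \<zeta>_continuous])

lemma \<zeta>_smooth: "Ck_on k \<zeta> S"
proof -
  have "Ck_on k (\<lambda>x. x \<bullet> w + (- (a \<bullet> w) - m)) S" by (intro Ck_on_add Ck_on_inner Ck_on_const)
  then have "Ck_on k height S" by (simp add: height_def[abs_def] inner_diff_left algebra_simps)
  then show ?thesis unfolding \<zeta>_def[abs_def]
    by (rule Ck_on_compose[OF infinitely_differentiable_bump]) auto
qed

lemma \<zeta>_pos_iff: "\<zeta> x > 0 \<longleftrightarrow> height x > 0"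
  by (simp add: \<zeta>_def bump_pos_iff)

lemma \<zeta>_eq_0: "height x \<le> 0 \<Longrightarrow> \<zeta> x = 0"
  by (simp add: \<zeta>_def bump_def)

lemma cap_in_U: "x \<in> \<Omega> \<Longrightarrow> height x \<ge> 0 \<Longrightarrow> x \<in> U"
  using far cap_U by (auto simp: height_def)

text \<open>A point of the cap outside the layer can be moved away from \<open>a\<close> by the factor \<open>1 / t\<close> without
  leaving \<open>\<Omega>\<close>; along the way \<open>\<phi>\<close> grows at a rate of at least \<open>c1\<close>, and it is still negative at
  the end.\<close>

lemma depth_off_layer:
  assumes x: "x \<in> \<Omega>" "height x \<ge> 0" "x \<notin> layer t" and t: "0 < t" "t < 1"
  shows "\<phi> x \<le> - c1 * (1 - t)"
proof -
  have y: "dil (1 / t) x \<in> \<Omega>" using x by (simp add: layer_def)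
  have mx: "m \<le> (x - a) \<bullet> w" using x(2) by (simp add: height_def)
  have in_cap: "norm (dil s x - a) \<le> norm w \<and> m \<le> (dil s x - a) \<bullet> w" if s: "1 \<le> s" "s \<le> 1 / t" for s
  proof
    have "norm (dil s x - a) = s * norm (x - a)" using s by (simp add: dil_minus)
    also have "\<dots> \<le> (1 / t) * norm (x - a)" using s by (intro mult_right_mono) auto
    also have "\<dots> = norm (dil (1 / t) x - a)" using t by (simp add: dil_minus)
    also have "\<dots> \<le> norm w" by (rule far[OF y])
    finally show "norm (dil s x - a) \<le> norm w" .
    have "1 * ((x - a) \<bullet> w) \<le> s * ((x - a) \<bullet> w)" using s mx m by (intro mult_right_mono) auto
    then show "m \<le> (dil s x - a) \<bullet> w" using mx by (simp add: dil_minus)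
  qed
  have d: "((\<lambda>s. \<phi> (dil s x)) has_derivative (\<lambda>h. (h *\<^sub>R (x - a)) \<bullet> gradient \<phi> (dil s x))) (at s)"
    if s: "1 \<le> s" "s \<le> 1 / t" for s
  proof -
    have "dil s x \<in> U" using in_cap[OF s] cap_U by blast
    then have 1: "(\<phi> has_derivative (\<lambda>h. h \<bullet> gradient \<phi> (dil s x))) (at (dil s x))"
      using smooth_on_GDERIV[OF U(2)] by (simp add: gderiv_def)
    have "((\<lambda>s. dil s x) has_derivative (\<lambda>h. h *\<^sub>R (x - a))) (at s)"
      unfolding dil_def by (auto intro!: derivative_eq_intros simp: algebra_simps)
    from has_derivative_compose[OF this 1] show ?thesis .
  qed
  have lt: "1 < 1 / t" using t by simp
  obtain s where s: "1 < s" "s < 1 / t"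
    "\<phi> (dil (1 / t) x) - \<phi> (dil 1 x) = ((1 / t - 1) *\<^sub>R (x - a)) \<bullet> gradient \<phi> (dil s x)"
  proof (rule mvt[OF lt, of "\<lambda>s. \<phi> (dil s x)" "\<lambda>s h. (h *\<^sub>R (x - a)) \<bullet> gradient \<phi> (dil s x)"])
    show "continuous_on {1..1 / t} (\<lambda>s. \<phi> (dil s x))"
      using d by (intro continuous_at_imp_continuous_on ballI has_derivative_continuous) auto
  qed (use d that in auto)
  have "c1 \<le> gradient \<phi> (dil s x) \<bullet> (x - a)"
    using in_cap[of s] in_cap[of 1] s lt by (intro transversal) auto
  then have "(1 / t - 1) * c1 \<le> (1 / t - 1) * (gradient \<phi> (dil s x) \<bullet> (x - a))"
    using lt by (intro mult_left_mono) auto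
  also have "\<dots> = \<phi> (dil (1 / t) x) - \<phi> x" using s(3) by (simp add: inner_commute)
  finally have le: "\<phi> x \<le> \<phi> (dil (1 / t) x) - (1 / t - 1) * c1" by linarith
  have "dil (1 / t) x \<in> U" using in_cap[of "1 / t"] lt cap_U by auto
  then have "\<phi> (dil (1 / t) x) < 0" using y U(3) by blast
  moreover have "(1 - t) * c1 \<le> (1 / t - 1) * c1"
  proof (rule mult_right_mono)
    have "(1 - t) * 1 \<le> (1 - t) * (1 / t)" using t by (intro mult_left_mono) auto
    also have "\<dots> = 1 / t - 1" using t by (simp add: field_simps)
    finally show "1 - t \<le> 1 / t - 1" by simp
  qed (use c1 in simp)
  ultimately show ?thesis using le by (simp add: mult.commute)
qed

definition \<eta> :: "real \<Rightarrow> real^'n \<Rightarrow> real" where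
  "\<eta> \<tau> x = (if x \<in> \<Omega> \<inter> U then \<zeta> x * step (- (1 / \<tau>) * \<phi> x) else 0)"

definition \<eta>_support :: "real \<Rightarrow> (real^'n) set" where
  "\<eta>_support \<tau> = {x. norm (x - a) \<le> norm w \<and> m \<le> (x - a) \<bullet> w} \<inter> \<phi> -` {..- \<tau>}"

lemma \<eta>_support: "compact (\<eta>_support \<tau>)" "\<tau> > 0 \<Longrightarrow> \<eta>_support \<tau> \<subseteq> \<Omega> \<inter> U"
proof -
  let ?C = "{x. norm (x - a) \<le> norm w \<and> m \<le> (x - a) \<bullet> w}"
  have "?C = cball a (norm w) \<inter> {x. m \<le> (x - a) \<bullet> w}"
    by (auto simp: dist_norm norm_minus_commute)
  moreover have "closed {x. m \<le> (x - a) \<bullet> w}" by (intro closed_Collect_le continuous_intros)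
  ultimately have C: "compact ?C" by (simp add: compact_Int_closed)
  have "continuous_on U \<phi>" using smooth_on_D[OF U(2), of 0] by simp
  then have "closed (?C \<inter> \<phi> -` {..- \<tau>})"
    by (intro continuous_closed_preimage compact_imp_closed[OF C] closed_atMost) (rule continuous_on_subset[OF _ cap_U])
  then have "compact (?C \<inter> (?C \<inter> \<phi> -` {..- \<tau>}))" by (rule compact_Int_closed[OF C])
  then show "compact (\<eta>_support \<tau>)" by (simp add: \<eta>_support_def Int_assoc[symmetric])
  show "\<eta>_support \<tau> \<subseteq> \<Omega> \<inter> U" if \<tau>: "\<tau> > 0"
  proof
    fix x assume x: "x \<in> \<eta>_support \<tau>"
    then have "x \<in> U" "\<phi> x < 0" using cap_U \<tau> by (auto simp: \<eta>_support_def)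
    then show "x \<in> \<Omega> \<inter> U" using U(3) by blast
  qed
qed

lemma \<eta>_eq_0:
  assumes "\<tau> > 0" "x \<notin> \<eta>_support \<tau>" shows "\<eta> \<tau> x = 0"
proof (cases "x \<in> \<Omega> \<inter> U")
  case True
  then have "norm (x - a) \<le> norm w" using far by blast
  then consider "height x \<le> 0" | "\<phi> x > - \<tau>"
    using assms(2) by (auto simp: \<eta>_support_def height_def)
  then show ?thesis
  proof cases
    case 1
    then show ?thesis by (simp add: \<eta>_def \<zeta>_eq_0)
  next
    case 2
    have "- (1 / \<tau>) * \<phi> x \<le> 1" using 2 assms(1) by (simp add: field_simps)
    then show ?thesis unfolding \<eta>_def by (simp only: step_eq_0) simp
  qed
qed (auto simp: \<eta>_def)

lemma \<eta>_test_function: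
  assumes \<tau>: "\<tau> > 0" shows "test_function \<Omega> (\<eta> \<tau>)"
proof (rule test_functionI[OF _ \<eta>_support(1)])
  show "\<eta>_support \<tau> \<subseteq> \<Omega>" using \<eta>_support(2)[OF \<tau>] by blast
  show "\<eta> \<tau> x = 0" if "x \<notin> \<eta>_support \<tau>" for x by (rule \<eta>_eq_0[OF \<tau> that])
  have o: "open (\<Omega> \<inter> U)" "open (- \<eta>_support \<tau>)"
    using open_\<Omega> U(1) compact_imp_closed[OF \<eta>_support(1)] by auto
  show "smooth_on (\<eta> \<tau>) UNIV"
    unfolding smooth_on_def
  proof
    fix k
    have "Ck_on k \<phi> (\<Omega> \<inter> U)" by (rule Ck_on_subset[OF smooth_on_D[OF U(2)]]) simp
    then have "Ck_on k (\<lambda>x. \<zeta> x * step (- (1 / \<tau>) * \<phi> x)) (\<Omega> \<inter> U)"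
      by (intro Ck_on_mult \<zeta>_smooth Ck_on_step Ck_on_const)
    then have 1: "Ck_on k (\<eta> \<tau>) (\<Omega> \<inter> U)"
      by (rule Ck_on_cong[OF o(1), rotated]) (simp add: \<eta>_def)
    have 2: "Ck_on k (\<eta> \<tau>) (- \<eta>_support \<tau>)"
      by (rule Ck_on_cong[OF o(2) _ Ck_on_const[of k 0]]) (use \<eta>_eq_0[OF \<tau>] in auto)
    have "(\<Omega> \<inter> U) \<union> - \<eta>_support \<tau> = UNIV" using \<eta>_support(2)[OF \<tau>] by blast
    then show "Ck_on k (\<eta> \<tau>) UNIV" using Ck_on_Un[OF o 1 2] by simp
  qed
qed

lemma gradient_\<eta>:
  assumes \<tau>: "\<tau> > 0"
  shows "x \<in> \<Omega> \<inter> U \<Longrightarrow> gradient (\<eta> \<tau>) x = (step (- (1 / \<tau>) * \<phi> x) * bump_deriv (height x)) *\<^sub>R w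
      - (\<zeta> x * step_deriv (- (1 / \<tau>) * \<phi> x) / \<tau>) *\<^sub>R gradient \<phi> x"
    and "x \<notin> U \<Longrightarrow> gradient (\<eta> \<tau>) x = 0"
proof -
  assume x: "x \<in> \<Omega> \<inter> U"
  have "GDERIV (\<lambda>x. \<zeta> x * step (- (1 / \<tau>) * \<phi> x)) x :>
      \<zeta> x *\<^sub>R (step_deriv (- (1 / \<tau>) * \<phi> x) *\<^sub>R ((- (1 / \<tau>)) *\<^sub>R gradient \<phi> x))
      + step (- (1 / \<tau>) * \<phi> x) *\<^sub>R (bump_deriv (height x) *\<^sub>R w)"
  proof (rule GDERIV_mult[OF \<zeta>_GDERIV GDERIV_DERIV_compose[OF _ DERIV_step]])
    have "GDERIV \<phi> x :> gradient \<phi> x" using smooth_on_GDERIV[OF U(2)] x by blast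
    then have "GDERIV (\<lambda>x. (- (1 / \<tau>)) * \<phi> x) x :> (- (1 / \<tau>)) *\<^sub>R gradient \<phi> x + \<phi> x *\<^sub>R 0"
      by (intro GDERIV_mult GDERIV_const)
    then show "GDERIV (\<lambda>x. - (1 / \<tau>) * \<phi> x) x :> (- (1 / \<tau>)) *\<^sub>R gradient \<phi> x" by simp
  qed
  then have "GDERIV (\<eta> \<tau>) x :>
      \<zeta> x *\<^sub>R (step_deriv (- (1 / \<tau>) * \<phi> x) *\<^sub>R ((- (1 / \<tau>)) *\<^sub>R gradient \<phi> x))
      + step (- (1 / \<tau>) * \<phi> x) *\<^sub>R (bump_deriv (height x) *\<^sub>R w)"
    by (rule GDERIV_transform[OF _ _ x]) (use open_\<Omega> U(1) in \<open>auto simp: \<eta>_def\<close>)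
  then show "gradient (\<eta> \<tau>) x = (step (- (1 / \<tau>) * \<phi> x) * bump_deriv (height x)) *\<^sub>R w
      - (\<zeta> x * step_deriv (- (1 / \<tau>) * \<phi> x) / \<tau>) *\<^sub>R gradient \<phi> x"
    by (simp add: gradient_eq)
next
  assume "x \<notin> U"
  then have x: "x \<notin> \<eta>_support \<tau>" using \<eta>_support(2)[OF \<tau>] by blast
  have "GDERIV (\<eta> \<tau>) x :> 0"
    by (rule GDERIV_zero_outside[OF compact_imp_closed[OF \<eta>_support(1)] _ x]) (rule \<eta>_eq_0[OF \<tau>])
  then show "gradient (\<eta> \<tau>) x = 0" by (rule gradient_eq)
qed

text \<open>With this scale the cutoff \<open>\<eta>\<close> varies near the boundary only within the layer of ratio \<open>t\<close>; see
  \<open>off_layer_ge_2\<close>.\<close>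

definition depth :: "real \<Rightarrow> real" where "depth t = c1 * (1 - t) / 2"

definition \<theta> :: "real \<Rightarrow> real^'n \<Rightarrow> real" where
  "\<theta> t x = (if x \<in> U then step (- (1 / depth t) * \<phi> x) else 0)"

lemma depth_pos: "t < 1 \<Longrightarrow> depth t > 0"
  using c1 by (simp add: depth_def)

lemma \<theta>_bounds: "0 \<le> \<theta> t x" "\<theta> t x \<le> 1"
  by (auto simp: \<theta>_def step_bounds)

lemma \<eta>_eq: "x \<in> \<Omega> \<Longrightarrow> \<eta> (depth t) x = \<zeta> x * \<theta> t x"
  by (simp add: \<eta>_def \<theta>_def)

lemma off_layer_ge_2:
  assumes "x \<in> \<Omega>" "height x \<ge> 0" "x \<notin> layer t" "0 < t" "t < 1"
  shows "- (1 / depth t) * \<phi> x \<ge> 2"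
proof -
  have "2 * depth t \<le> - \<phi> x" using depth_off_layer[OF assms] by (simp add: depth_def)
  then show ?thesis using depth_pos[OF assms(5)] by (simp add: field_simps)
qed

lemma \<zeta>_le_\<theta>:
  assumes "x \<in> \<Omega>" "0 < t" "t < 1"
  shows "\<zeta> x \<le> \<zeta> x * \<theta> t x + indicator (layer t) x"
proof (cases "height x \<le> 0 \<or> x \<in> layer t")
  case True
  then show ?thesis using \<zeta>_bounds[of x] \<theta>_bounds[of t x] by (auto simp: \<zeta>_eq_0 add_increasing)
next
  case False
  then have "\<theta> t x = 1"
    using off_layer_ge_2[of x t] assms cap_in_U[of x] by (simp add: \<theta>_def step_eq_1)
  then show ?thesis by simp
qed

lemma flux_gradient_\<eta>:
  assumes x: "x \<in> \<Omega>" and t: "0 < t" "t < 1" and C: "C > 0" "\<And>\<xi>. H \<xi> \<le> C * norm \<xi>"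
  shows "flux (g x) \<bullet> gradient (\<eta> (depth t)) x \<le>
    \<theta> t x * (bump_deriv (height x) * (C * norm w * H (g x) powr (p - 1)))
    + indicator (layer t) x * (4 * exp 2 * \<bar>c2\<bar> * C / depth t * H (g x) powr (p - 1))"
proof -
  let ?Hp = "H (g x) powr (p - 1)" and ?\<tau> = "depth t"
  have \<tau>: "?\<tau> > 0" by (rule depth_pos[OF t(2)])
  have fl: "\<bar>flux (g x) \<bullet> v\<bar> \<le> C * ?Hp * norm v" for v
    using Cauchy_Schwarz_ineq2[of "flux (g x)" v] mult_right_mono[OF flux_norm_le[OF C(2), of "g x"] norm_ge_zero[of v]]
    by linarith
  have nn: "0 \<le> indicator (layer t) x * (4 * exp 2 * \<bar>c2\<bar> * C / ?\<tau> * ?Hp)"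
    using \<tau> C(1) by simp
  show ?thesis
  proof (cases "x \<in> U")
    case False
    then show ?thesis using gradient_\<eta>(2)[OF \<tau> False] nn by (simp add: \<theta>_def)
  next
    case True
    let ?s = "- (1 / ?\<tau>) * \<phi> x"
    have th: "\<theta> t x = step ?s" using True by (simp add: \<theta>_def)
    have "flux (g x) \<bullet> gradient (\<eta> ?\<tau>) x =
        \<theta> t x * (bump_deriv (height x) * (flux (g x) \<bullet> w)) - \<zeta> x * step_deriv ?s / ?\<tau> * (flux (g x) \<bullet> gradient \<phi> x)"
      using gradient_\<eta>(1)[OF \<tau>, of x] x True by (simp add: th inner_diff_right mult.assoc)
    moreover have "\<theta> t x * (bump_deriv (height x) * (flux (g x) \<bullet> w)) \<le>
        \<theta> t x * (bump_deriv (height x) * (C * norm w * ?Hp))"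
      using fl[of w] by (intro mult_left_mono \<theta>_bounds bump_bounds) (simp add: ac_simps abs_le_iff)
    moreover have "- (\<zeta> x * step_deriv ?s / ?\<tau> * (flux (g x) \<bullet> gradient \<phi> x)) \<le>
        indicator (layer t) x * (4 * exp 2 * \<bar>c2\<bar> * C / ?\<tau> * ?Hp)"
    proof (cases "height x \<le> 0")
      case True
      then show ?thesis using nn by (simp add: \<zeta>_eq_0)
    next
      case False
      show ?thesis
      proof (cases "x \<in> layer t")
        case True
        have "norm (gradient \<phi> x) \<le> \<bar>c2\<bar>"
          using c2[of x] far[OF x] False by (auto simp: height_def)
        then have f2: "\<bar>flux (g x) \<bullet> gradient \<phi> x\<bar> \<le> C * ?Hp * \<bar>c2\<bar>"
          using C(1) by (intro order_trans[OF fl] mult_left_mono) auto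
        have "\<bar>\<zeta> x * step_deriv ?s / ?\<tau>\<bar> = \<zeta> x * \<bar>step_deriv ?s\<bar> / ?\<tau>"
          using \<zeta>_bounds(1)[of x] \<tau> by (simp add: abs_mult)
        also have "\<dots> \<le> 1 * (4 * exp 2) / ?\<tau>"
          using \<zeta>_bounds \<tau> step_deriv_bounds by (intro divide_right_mono mult_mono) auto
        finally have f1: "\<bar>\<zeta> x * step_deriv ?s / ?\<tau>\<bar> \<le> 4 * exp 2 / ?\<tau>" by simp
        have "- (\<zeta> x * step_deriv ?s / ?\<tau> * (flux (g x) \<bullet> gradient \<phi> x)) \<le>
            \<bar>\<zeta> x * step_deriv ?s / ?\<tau>\<bar> * \<bar>flux (g x) \<bullet> gradient \<phi> x\<bar>"
          unfolding abs_mult[symmetric] by (rule abs_ge_minus_self)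
        also have "\<dots> \<le> (4 * exp 2 / ?\<tau>) * (C * ?Hp * \<bar>c2\<bar>)"
          using \<tau> by (intro mult_mono f1 f2) auto
        finally show ?thesis using True by (simp add: ac_simps)
      next
        case False2: False
        have "step_deriv ?s = 0"
          using off_layer_ge_2[OF x _ False2 t] False by (intro step_deriv_zero) simp
        then show ?thesis using False2 by simp
      qed
    qed
    ultimately show ?thesis by linarith
  qed
qed

text \<open>The Caccioppoli estimate for the logarithm of \<open>u + \<epsilon>\<close>. Its test function is essentially
  \<open>\<zeta> (u + \<epsilon>)^{1 - p}\<close>, cut off near the boundary by \<open>\<theta>\<close>; the terms due to this second cutoff live in the
  layer and disappear in the limit by \<open>layer_flux\<close> and \<open>layer_energy\<close>. The source term has a sign and
  is dropped. The power \<open>1 - p\<close> makes both sides homogeneous of degree zero in \<open>u + \<epsilon>\<close>, and this is why the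
  bound does not depend on \<open>\<epsilon>\<close>.\<close>

lemma log_gradient_estimate:
  obtains C where "\<And>\<epsilon>. \<epsilon> > 0 \<Longrightarrow> integrable N (\<lambda>x. \<zeta> x * (H (g x) / softplus \<epsilon> (u x)) powr p)"
    "\<And>\<epsilon>. \<epsilon> > 0 \<Longrightarrow> (\<integral>x. \<zeta> x * (H (g x) / softplus \<epsilon> (u x)) powr p \<partial>N) \<le> C"
proof -
  obtain c C where C: "c > 0" "C > 0" "\<And>\<xi>. c * norm \<xi> \<le> H \<xi>" "\<And>\<xi>. H \<xi> \<le> C * norm \<xi>"
    by (rule H_bounds) (rule that)
  define \<delta> where "\<delta> = (p - 1) / 2"
  have \<delta>: "\<delta> > 0" using p_gt_1 by (simp add: \<delta>_def)
  define C4 where "C4 = 2 * p\<^sup>2 * (C * norm w)"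
  have C4: "C4 \<ge> 0" using C(2) by (simp add: C4_def)
  define C5 where "C5 = \<delta> powr (1 - p) * C4 powr p"
  have C5: "C5 \<ge> 0" by (simp add: C5_def)
  define K where "K = 4 * exp 2 * \<bar>c2\<bar> * C"
  have K: "K \<ge> 0" using C(2) by (simp add: K_def)
  have main: "integrable N (\<lambda>x. \<zeta> x * (H (g x) / softplus \<epsilon> (u x)) powr p) \<and>
      (\<integral>x. \<zeta> x * (H (g x) / softplus \<epsilon> (u x)) powr p \<partial>N) \<le> C5 * volume / \<delta>" if \<epsilon>: "\<epsilon> > 0" for \<epsilon>
  proof -
    let ?\<sigma> = "\<lambda>x. softplus \<epsilon> (u x)"
    define Y where "Y x = \<zeta> x * (H (g x) / ?\<sigma> x) powr p" for x
    have \<sigma>_pos: "?\<sigma> x > 0" for x by (rule softplus_pos[OF \<epsilon>])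
    have \<sigma>_ge: "\<epsilon> \<le> ?\<sigma> x" for x using softplus_gt[OF \<epsilon>, of "u x"] by simp
    have sm: "softplus \<epsilon> \<in> borel_measurable borel"
      by (intro borel_measurable_continuous_onI continuous_at_imp_continuous_on ballI DERIV_isCont[OF DERIV_softplus[OF \<epsilon>]])
    have \<sigma>m [measurable]: "?\<sigma> \<in> borel_measurable N" by (rule measurable_compose[OF u_measurable sm])
    have Ym: "Y \<in> borel_measurable N" unfolding Y_def by measurable
    obtain B where B: "\<And>x. x \<in> \<Omega> \<Longrightarrow> H (g x) \<le> B" by (rule H_g_bounded) (rule that)
    have Hs: "(H (g x) / ?\<sigma> x) powr p \<le> \<epsilon> powr (- p) * H (g x) powr p" for x
    proof -
      have "H (g x) / ?\<sigma> x \<le> H (g x) / \<epsilon>"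
        using \<sigma>_ge[of x] \<epsilon> H_nonneg \<sigma>_pos[of x] by (intro divide_left_mono) auto
      then have "(H (g x) / ?\<sigma> x) powr p \<le> (H (g x) / \<epsilon>) powr p"
        using p_gt_1 H_nonneg \<sigma>_pos[of x] by (intro powr_mono2 divide_nonneg_pos) auto
      also have "\<dots> = \<epsilon> powr (- p) * H (g x) powr p"
        using H_nonneg \<epsilon> by (simp add: powr_divide powr_minus_divide)
      finally show ?thesis .
    qed
    have Y_nonneg: "Y x \<ge> 0" for x using \<zeta>_bounds(1) by (simp add: Y_def)
    have Y_le: "Y x \<le> \<epsilon> powr (- p) * H (g x) powr p" for x
    proof -
      have "Y x \<le> 1 * (H (g x) / ?\<sigma> x) powr p" unfolding Y_def by (intro mult_right_mono \<zeta>_bounds) simp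
      then show ?thesis using Hs[of x] by simp
    qed
    have Hi: "integrable N (\<lambda>x. H (g x) powr p)" "integrable N (\<lambda>x. H (g x) powr (p - 1))"
      using p_gt_1 by (intro H_g_powr_integrable; simp)+
    have Yi: "integrable N Y"
    proof (rule Bochner_Integration.integrable_bound)
      show "integrable N (\<lambda>x. \<epsilon> powr (- p) * H (g x) powr p)" using Hi by simp
      show "AE x in N. norm (Y x) \<le> norm (\<epsilon> powr (- p) * H (g x) powr p)"
        using Y_le Y_nonneg by (intro AE_I2) simp
    qed (rule Ym)
    \<comment> \<open>Young's inequality absorbs the derivative of the cutoff\<close>
    have absorb: "?\<sigma> x powr (1 - p) * (bump_deriv (height x) * (C * norm w * H (g x) powr (p - 1))) \<le> \<delta> * Y x + C5" for x
    proof -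
      define X where "X = \<zeta> x powr (1 / p) * (H (g x) / ?\<sigma> x)"
      have X: "X \<ge> 0" using H_nonneg \<sigma>_pos[of x] by (simp add: X_def)
      have Xp: "X powr p = Y x"
      proof -
        have "(\<zeta> x powr (1 / p)) powr p = \<zeta> x"
          using p_gt_1 \<zeta>_bounds(1)[of x] by (simp add: powr_powr)
        then show ?thesis by (simp only: X_def Y_def powr_mult)
      qed
      have Xp1: "X powr (p - 1) = \<zeta> x powr (1 - 1 / p) * (?\<sigma> x powr (1 - p) * H (g x) powr (p - 1))"
      proof -
        have "(1 / p) * (p - 1) = 1 - 1 / p" using p_gt_1 by (simp add: field_simps)
        moreover have "?\<sigma> x powr (1 - p) = 1 / ?\<sigma> x powr (p - 1)"
          using powr_minus_divide[of "?\<sigma> x" "p - 1"] by simp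
        ultimately show ?thesis
          using H_nonneg \<sigma>_pos[of x] by (simp add: X_def powr_mult powr_powr powr_divide)
      qed
      have "bump_deriv (height x) \<le> 2 * p\<^sup>2 * \<zeta> x powr (1 - 1 / p)"
        unfolding \<zeta>_def using p_gt_1 by (intro bump_deriv_le) simp
      then have "bump_deriv (height x) * (?\<sigma> x powr (1 - p) * (C * norm w * H (g x) powr (p - 1)))
          \<le> 2 * p\<^sup>2 * \<zeta> x powr (1 - 1 / p) * (?\<sigma> x powr (1 - p) * (C * norm w * H (g x) powr (p - 1)))"
        using C(2) by (intro mult_right_mono) auto
      also have "\<dots> = X powr (p - 1) * C4" unfolding Xp1 C4_def by (simp add: ac_simps)
      also have "\<dots> \<le> \<delta> * X powr p + \<delta> powr (1 - p) * C4 powr p"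
        by (rule powr_mult_le_eps[OF X C4 p_gt_1 \<delta>])
      finally show ?thesis unfolding Xp C5_def by (simp add: ac_simps)
    qed
    let ?L = "\<lambda>k x. indicator (layer (ratio k)) x :: real"
    have step_k: "0 \<le> C5 * volume - \<delta> * (\<integral>x. Y x \<partial>N)
        + \<delta> * \<epsilon> powr (- p) * (\<integral>x. ?L k x * H (g x) powr p \<partial>N)
        + \<epsilon> powr (1 - p) * (2 * K / c1) * ((\<integral>x. ?L k x * H (g x) powr (p - 1) \<partial>N) / (1 - ratio k))" for k
    proof -
      let ?t = "ratio k" and ?\<tau> = "depth (ratio k)"
      let ?G = "\<lambda>s. softplus \<epsilon> s powr (1 - p)"
      let ?G' = "\<lambda>s. (1 - p) * softplus \<epsilon> s powr (1 - p - 1) * softplus_deriv \<epsilon> s"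
      let ?v = "\<lambda>x. \<eta> ?\<tau> x * ?G (u x)"
      let ?Dv = "\<lambda>x. ?G (u x) *\<^sub>R gradient (\<eta> ?\<tau>) x + (\<eta> ?\<tau> x * ?G' (u x)) *\<^sub>R g x"
      have t: "0 < ?t" "?t < 1" by (rule ratio)+
      have \<tau>: "?\<tau> > 0" by (rule depth_pos[OF t(2)])
      have r: "1 - p \<le> 0" using p_gt_1 by simp
      obtain B1 where B1: "\<And>s. \<bar>?G s\<bar> \<le> B1" "\<And>s. \<bar>?G' s\<bar> \<le> B1" "\<And>s s'. \<bar>?G' s - ?G' s'\<bar> \<le> B1 * \<bar>s - s'\<bar>"
        by (rule softplus_powr_bounds[OF \<epsilon> r]) (rule that)
      have W: "W1p0 \<Omega> p ?v ?Dv"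
      proof (rule W1p0_composition[OF u_W _ _ \<eta>_test_function[OF \<tau>] _ _ B1])
        show "1 \<le> p" using p_gt_1 by simp
        show "AE x in N. norm (g x) \<le> M" using g_le by (intro AE_I2) simp
        show "Ck_on k' \<phi>' UNIV \<Longrightarrow> Ck_on k' (\<lambda>x::real^'n. ?G (\<phi>' x)) UNIV" for k' \<phi>'
          by (rule Ck_on_softplus_powr[OF \<epsilon>])
        show "(?G has_real_derivative ?G' s) (at s)" for s by (rule DERIV_softplus_powr[OF \<epsilon>])
      qed
      have Dv_i: "integrable N (\<lambda>x. flux (g x) \<bullet> ?Dv x)"
      proof -
        obtain B2 where B2: "\<And>x. x \<in> \<Omega> \<Longrightarrow> norm (flux (g x)) \<le> B2" by (rule flux_g_bounded) (rule that)
        have L: "Lp_on \<Omega> p ?Dv" using W unfolding W1p0_def W1p_def by blast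
        then have [measurable]: "?Dv \<in> borel_measurable N" by (simp add: Lp_on_def)
        show ?thesis
        proof (rule Bochner_Integration.integrable_bound)
          show "integrable N (\<lambda>x. B2 * norm (?Dv x))"
            using Lp_on_integrable_norm[OF L] p_gt_1 by simp
          show "(\<lambda>x. flux (g x) \<bullet> ?Dv x) \<in> borel_measurable N" by measurable
          show "AE x in N. norm (flux (g x) \<bullet> ?Dv x) \<le> norm (B2 * norm (?Dv x))"
          proof (rule AE_I2)
            fix x assume "x \<in> space N"
            then have "norm (flux (g x)) * norm (?Dv x) \<le> \<bar>B2\<bar> * norm (?Dv x)"
              using B2[of x] by (intro mult_right_mono) auto
            then show "norm (flux (g x) \<bullet> ?Dv x) \<le> norm (B2 * norm (?Dv x))"
              using Cauchy_Schwarz_ineq2[of "flux (g x)" "?Dv x"] by (simp add: abs_mult)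
          qed
        qed
      qed
      let ?R = "\<lambda>x. C5 - \<delta> * Y x + \<delta> * \<epsilon> powr (- p) * (?L k x * H (g x) powr p)
          + \<epsilon> powr (1 - p) * (K / ?\<tau>) * (?L k x * H (g x) powr (p - 1))"
      have point: "flux (g x) \<bullet> ?Dv x \<le> ?R x" if x: "x \<in> \<Omega>" for x
      proof -
        let ?Hp = "H (g x) powr (p - 1)"
        have G_nonneg: "0 \<le> ?G (u x)" by simp
        have u0: "u x \<ge> 0" by (rule u_nonneg[OF x])
        have e: "flux (g x) \<bullet> ?Dv x = ?G (u x) * (flux (g x) \<bullet> gradient (\<eta> ?\<tau>) x) + \<eta> ?\<tau> x * ?G' (u x) * H (g x) powr p"
          by (simp add: inner_add_right flux_inner_self)
        have p1: "?G (u x) * (flux (g x) \<bullet> gradient (\<eta> ?\<tau>) x) \<le>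
            \<theta> ?t x * (?G (u x) * (bump_deriv (height x) * (C * norm w * ?Hp))) + ?L k x * (?G (u x) * (K / ?\<tau> * ?Hp))"
          using mult_left_mono[OF flux_gradient_\<eta>[OF x t C(2,4)] G_nonneg]
          by (simp add: K_def distrib_left ac_simps)
        have p2: "\<theta> ?t x * (?G (u x) * (bump_deriv (height x) * (C * norm w * ?Hp))) \<le> \<theta> ?t x * (\<delta> * Y x + C5)"
          by (intro mult_left_mono absorb \<theta>_bounds)
        have p3: "?L k x * (?G (u x) * (K / ?\<tau> * ?Hp)) \<le> ?L k x * (\<epsilon> powr (1 - p) * (K / ?\<tau> * ?Hp))"
          using \<tau> K by (intro mult_left_mono mult_right_mono softplus_powr_le[OF \<epsilon> r]) auto
        have p4: "\<eta> ?\<tau> x * ?G' (u x) * H (g x) powr p \<le> - (2 * \<delta>) * (\<theta> ?t x * Y x)"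
        proof -
          have s: "?\<sigma> x powr (1 - p - 1) * H (g x) powr p = (H (g x) / ?\<sigma> x) powr p"
            using \<sigma>_pos[of x] H_nonneg by (simp add: powr_divide powr_minus_divide)
          have "1 * (\<theta> ?t x * Y x) \<le> softplus_deriv \<epsilon> (u x) * (\<theta> ?t x * Y x)"
            using softplus_deriv_bounds(3)[OF \<epsilon> u0] \<theta>_bounds Y_nonneg by (intro mult_right_mono mult_nonneg_nonneg)
          then have "(1 - p) * (softplus_deriv \<epsilon> (u x) * (\<theta> ?t x * Y x)) \<le> (1 - p) * (1 * (\<theta> ?t x * Y x))"
            using r by (intro mult_left_mono_neg)
          moreover have "\<eta> ?\<tau> x * ?G' (u x) * H (g x) powr p = (1 - p) * (softplus_deriv \<epsilon> (u x) * (\<theta> ?t x * Y x))"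
            unfolding \<eta>_eq[OF x] Y_def s[symmetric] by (simp only: ac_simps)
          moreover have d: "- (2 * \<delta>) = 1 - p" by (simp add: \<delta>_def field_simps)
          ultimately show ?thesis by (simp only: d mult_1)
        qed
        \<comment> \<open>removing the factor \<open>\<theta>\<close> costs an integral over the layer\<close>
        have p5: "Y x \<le> \<theta> ?t x * Y x + ?L k x * (\<epsilon> powr (- p) * H (g x) powr p)"
        proof -
          have "Y x \<le> (\<zeta> x * \<theta> ?t x + ?L k x) * (H (g x) / ?\<sigma> x) powr p"
            unfolding Y_def by (intro mult_right_mono \<zeta>_le_\<theta>[OF x t]) simp
          also have "\<dots> = \<theta> ?t x * Y x + ?L k x * (H (g x) / ?\<sigma> x) powr p"
            by (simp add: Y_def distrib_right)
          also have "\<dots> \<le> \<theta> ?t x * Y x + ?L k x * (\<epsilon> powr (- p) * H (g x) powr p)"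
            by (intro add_left_mono mult_left_mono Hs) simp
          finally show ?thesis .
        qed
        have p6: "\<theta> ?t x * C5 \<le> C5" using mult_right_mono[OF \<theta>_bounds(2)[of ?t x] C5] by simp
        have "flux (g x) \<bullet> ?Dv x \<le> \<theta> ?t x * (\<delta> * Y x + C5) + ?L k x * (\<epsilon> powr (1 - p) * (K / ?\<tau> * ?Hp))
            - (2 * \<delta>) * (\<theta> ?t x * Y x)"
          unfolding e using p1 p2 p3 p4 by linarith
        also have "\<dots> = \<theta> ?t x * C5 - \<delta> * (\<theta> ?t x * Y x) + ?L k x * (\<epsilon> powr (1 - p) * (K / ?\<tau> * ?Hp))"
          by (simp add: algebra_simps)
        also have "\<dots> \<le> C5 - \<delta> * (Y x - ?L k x * (\<epsilon> powr (- p) * H (g x) powr p)) + ?L k x * (\<epsilon> powr (1 - p) * (K / ?\<tau> * ?Hp))"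
        proof -
          have "\<delta> * (Y x - ?L k x * (\<epsilon> powr (- p) * H (g x) powr p)) \<le> \<delta> * (\<theta> ?t x * Y x)"
            using p5 \<delta> by (intro mult_left_mono) linarith+
          then show ?thesis using p6 by linarith
        qed
        finally show ?thesis by (simp add: algebra_simps)
      qed
      have Li: "integrable N (\<lambda>x. ?L k x * H (g x) powr p)" "integrable N (\<lambda>x. ?L k x * H (g x) powr (p - 1))"
        by (rule integrable_layer[OF Hi(1) t(1)], rule integrable_layer[OF Hi(2) t(1)])
      have "0 \<le> (\<integral>x. f x * ?v x \<partial>N)"
      proof (intro integral_nonneg_AE AE_I2)
        fix x assume "x \<in> space N"
        then have x: "x \<in> \<Omega>" by simp
        have "0 \<le> f x" by (subst f_def) (simp add: \<mu>0)
        moreover have "0 \<le> \<eta> ?\<tau> x" unfolding \<eta>_eq[OF x] by (intro mult_nonneg_nonneg \<zeta>_bounds \<theta>_bounds)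
        ultimately show "0 \<le> f x * ?v x" by simp
      qed
      also have "\<dots> = (\<integral>x. flux (g x) \<bullet> ?Dv x \<partial>N)" by (rule weak_equation[OF W, symmetric])
      also have "\<dots> \<le> (\<integral>x. ?R x \<partial>N)"
        by (rule integral_mono[OF Dv_i]) (use Yi Li point in auto)
      also have "\<dots> = C5 * volume - \<delta> * (\<integral>x. Y x \<partial>N)
          + \<delta> * \<epsilon> powr (- p) * (\<integral>x. ?L k x * H (g x) powr p \<partial>N)
          + \<epsilon> powr (1 - p) * (K / ?\<tau>) * (\<integral>x. ?L k x * H (g x) powr (p - 1) \<partial>N)"
        using Yi Li by (simp add: volume_def)
      also have "\<epsilon> powr (1 - p) * (K / ?\<tau>) * (\<integral>x. ?L k x * H (g x) powr (p - 1) \<partial>N) =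
          \<epsilon> powr (1 - p) * (2 * K / c1) * ((\<integral>x. ?L k x * H (g x) powr (p - 1) \<partial>N) / (1 - ?t))"
        by (simp add: depth_def)
      finally show ?thesis .
    qed
    have E0: "(\<lambda>k. \<integral>x. ?L k x * H (g x) powr p \<partial>N) \<longlonglongrightarrow> 0"
    proof -
      have "(\<lambda>k. (1 - ratio k) * ((\<integral>x. ?L k x * H (g x) powr p \<partial>N) / (1 - ratio k))) \<longlonglongrightarrow> (1 - 1) * 0"
        by (intro tendsto_mult tendsto_diff tendsto_const ratio layer_energy \<mu>0)
      moreover have "(1 - ratio k) * ((\<integral>x. ?L k x * H (g x) powr p \<partial>N) / (1 - ratio k)) = (\<integral>x. ?L k x * H (g x) powr p \<partial>N)" for k
        using ratio(2)[of k] by simp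
      ultimately show ?thesis by simp
    qed
    have "(\<lambda>k. C5 * volume - \<delta> * (\<integral>x. Y x \<partial>N)
        + \<delta> * \<epsilon> powr (- p) * (\<integral>x. ?L k x * H (g x) powr p \<partial>N)
        + \<epsilon> powr (1 - p) * (2 * K / c1) * ((\<integral>x. ?L k x * H (g x) powr (p - 1) \<partial>N) / (1 - ratio k)))
      \<longlonglongrightarrow> C5 * volume - \<delta> * (\<integral>x. Y x \<partial>N) + \<delta> * \<epsilon> powr (- p) * 0 + \<epsilon> powr (1 - p) * (2 * K / c1) * 0"
      by (intro tendsto_add tendsto_mult_left tendsto_const E0 layer_flux)
    then have "0 \<le> C5 * volume - \<delta> * (\<integral>x. Y x \<partial>N) + \<delta> * \<epsilon> powr (- p) * 0 + \<epsilon> powr (1 - p) * (2 * K / c1) * 0"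
      by (rule LIMSEQ_le_const) (use step_k in blast)
    then have "\<delta> * (\<integral>x. Y x \<partial>N) \<le> C5 * volume" by simp
    then have "(\<integral>x. Y x \<partial>N) \<le> C5 * volume / \<delta>" using \<delta> by (simp add: field_simps)
    then show ?thesis using Yi unfolding Y_def by blast
  qed
  show thesis by (rule that[of "C5 * volume / \<delta>"]) (use main in blast)+
qed

lemma DERIV_log_softplus:
  assumes "\<epsilon> > 0"
  shows "((\<lambda>s. ln (softplus \<epsilon> s / (2 * \<epsilon>))) has_real_derivative softplus_deriv \<epsilon> s / softplus \<epsilon> s) (at s)"
  using softplus_pos[OF assms, of s] assms
  by (auto intro!: derivative_eq_intros DERIV_softplus[OF assms])

text \<open>The divergence theorem for the logarithm times \<open>\<zeta>(x) (x - a)\<close> replaces a Poincare inequality: it turns the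
  gradient estimate into a bound on the logarithm itself. As \<open>\<zeta>\<close> increases along rays from \<open>a\<close>, the term
  with its gradient has a sign. The logarithm is normalized to vanish where \<open>u\<close> does.\<close>

lemma log_integral_estimate:
  obtains C where "C \<ge> 0" "\<And>\<epsilon>. \<epsilon> > 0 \<Longrightarrow> integrable N (\<lambda>x. \<zeta> x * ln (softplus \<epsilon> (u x) / (2 * \<epsilon>)))"
    "\<And>\<epsilon>. \<epsilon> > 0 \<Longrightarrow> (\<integral>x. \<zeta> x * ln (softplus \<epsilon> (u x) / (2 * \<epsilon>)) \<partial>N) \<le> C"
proof -
  obtain c C where C: "c > 0" "C > 0" "\<And>\<xi>. c * norm \<xi> \<le> H \<xi>" "\<And>\<xi>. H \<xi> \<le> C * norm \<xi>"
    by (rule H_bounds) (rule that)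
  obtain C6 where C6: "\<And>\<epsilon>. \<epsilon> > 0 \<Longrightarrow> integrable N (\<lambda>x. \<zeta> x * (H (g x) / softplus \<epsilon> (u x)) powr p)"
    "\<And>\<epsilon>. \<epsilon> > 0 \<Longrightarrow> (\<integral>x. \<zeta> x * (H (g x) / softplus \<epsilon> (u x)) powr p \<partial>N) \<le> C6"
    by (rule log_gradient_estimate) (rule that)
  define A where "A = 2 * radius / c"
  have A: "A > 0" using radius(1) C(1) by (simp add: A_def)
  have main: "integrable N (\<lambda>x. \<zeta> x * ln (softplus \<epsilon> (u x) / (2 * \<epsilon>))) \<and>
      real CARD('n) * (\<integral>x. \<zeta> x * ln (softplus \<epsilon> (u x) / (2 * \<epsilon>)) \<partial>N) \<le> A * (volume + C6)" if \<epsilon>: "\<epsilon> > 0" for \<epsilon>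
  proof -
    let ?\<sigma> = "\<lambda>x. softplus \<epsilon> (u x)" and ?\<sigma>' = "\<lambda>x. softplus_deriv \<epsilon> (u x)"
    let ?W = "\<lambda>x. ln (softplus \<epsilon> (u x) / (2 * \<epsilon>))"
    let ?Q = "\<lambda>x. \<zeta> x * ?W x"
    define D where "D x = \<zeta> x *\<^sub>R ((?\<sigma>' x / ?\<sigma> x) *\<^sub>R g x) + ?W x *\<^sub>R (bump_deriv (height x) *\<^sub>R w)" for x
    have \<sigma>_pos: "?\<sigma> x > 0" for x by (rule softplus_pos[OF \<epsilon>])
    have W_nonneg: "0 \<le> ?W x" if "x \<in> \<Omega>" for x
      using softplus_bounds(1)[OF \<epsilon> u_nonneg[OF that]] \<epsilon> by simp
    have W_le: "?W x \<le> u x / \<epsilon>" if "x \<in> \<Omega>" for x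
    proof -
      have "?W x \<le> ?\<sigma> x / (2 * \<epsilon>) - 1" using \<sigma>_pos[of x] \<epsilon> by (intro ln_le_minus_one) simp
      also have "\<dots> \<le> (2 * \<epsilon> + 2 * u x) / (2 * \<epsilon>) - 1"
        using softplus_bounds(3)[OF \<epsilon> u_nonneg[OF that]] \<epsilon> by (intro diff_right_mono divide_right_mono) auto
      also have "\<dots> = u x / \<epsilon>" using \<epsilon> by (simp add: field_simps)
      finally show ?thesis .
    qed
    have QD: "GDERIV ?Q x :> D x" if "x \<in> \<Omega>" for x
      unfolding D_def
      by (rule GDERIV_mult[OF \<zeta>_GDERIV GDERIV_DERIV_compose[OF u_deriv[OF that] DERIV_log_softplus[OF \<epsilon>]]])
    have s_le: "\<bar>?\<sigma>' x / ?\<sigma> x\<bar> \<le> 2 / \<epsilon>" for x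
      using softplus_deriv_bounds[OF \<epsilon>, of "u x"] softplus_gt[OF \<epsilon>, of "u x"] \<epsilon>
      by (simp add: abs_divide) (intro frac_le, auto)
    define B where "B = 2 / \<epsilon> * M + M / \<epsilon> * (2 * norm w)"
    have D_le: "norm (D x) \<le> B" if x: "x \<in> \<Omega>" for x
    proof -
      have "norm (D x) \<le> \<bar>\<zeta> x\<bar> * (\<bar>?\<sigma>' x / ?\<sigma> x\<bar> * norm (g x)) + \<bar>?W x\<bar> * (\<bar>bump_deriv (height x)\<bar> * norm w)"
        unfolding D_def by (rule order_trans[OF norm_triangle_ineq]) (simp add: abs_mult)
      also have "\<dots> \<le> 1 * (2 / \<epsilon> * M) + M / \<epsilon> * (2 * norm w)"
      proof (intro add_mono mult_mono s_le g_le[OF x] order_refl)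
        show "\<bar>\<zeta> x\<bar> \<le> 1" using \<zeta>_bounds[of x] by simp
        show "\<bar>?W x\<bar> \<le> M / \<epsilon>"
          using W_nonneg[OF x] W_le[OF x] divide_right_mono[OF u_le[OF x], of \<epsilon>] \<epsilon> by simp
        show "\<bar>bump_deriv (height x)\<bar> \<le> 2" using bump_bounds[of "height x"] bump_deriv_le_2[of "height x"] by simp
      qed (use \<epsilon> M_nonneg in auto)
      finally show ?thesis by (simp add: B_def)
    qed
    have sm: "softplus \<epsilon> \<in> borel_measurable borel" "softplus_deriv \<epsilon> \<in> borel_measurable borel"
      by (intro borel_measurable_continuous_onI continuous_at_imp_continuous_on ballI
          DERIV_isCont[OF DERIV_softplus[OF \<epsilon>]] DERIV_isCont[OF DERIV_softplus_deriv[OF \<epsilon>]])+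
    have [measurable]: "?\<sigma> \<in> borel_measurable N" "?\<sigma>' \<in> borel_measurable N"
      using measurable_compose[OF u_measurable sm(1)] measurable_compose[OF u_measurable sm(2)] by auto
    have [measurable]: "(\<lambda>x. bump_deriv (height x)) \<in> borel_measurable N"
    proof -
      have "continuous_on \<Omega> height" unfolding height_def by (intro continuous_intros)
      then have h: "height \<in> borel_measurable N" by (rule measurable_on_\<Omega>)
      have "bump_deriv \<in> borel_measurable borel" unfolding bump_deriv_def[abs_def] by measurable
      then show ?thesis by (rule measurable_compose[OF h])
    qed
    have Dm: "D \<in> borel_measurable N" unfolding D_def by measurable
    have Qm: "?Q \<in> borel_measurable N" by measurable
    have "continuous_on UNIV (\<lambda>x. x - a)" by (intro continuous_intros)
    then have xm [measurable]: "(\<lambda>x. x - a) \<in> borel_measurable N" by (rule borel_measurable_lebesgue_on_continuous)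
    have dm: "(\<lambda>x. D x \<bullet> (x - a)) \<in> borel_measurable N" using Dm by measurable
    have Q_le: "\<bar>?Q x\<bar> \<le> (1 / \<epsilon>) * u x" if "x \<in> \<Omega>" for x
    proof -
      have "\<bar>?Q x\<bar> = \<zeta> x * ?W x" using \<zeta>_bounds W_nonneg[OF that] by simp
      also have "\<dots> \<le> 1 * (u x / \<epsilon>)" by (intro mult_mono \<zeta>_bounds W_le[OF that] W_nonneg[OF that]) simp
      finally show ?thesis by simp
    qed
    have id: "real CARD('n) * (\<integral>x. ?Q x \<partial>N) + (\<integral>x. D x \<bullet> (x - a) \<partial>N) = 0"
    proof (rule Euler_identity[OF Qm Q_le dm])
      show "\<bar>?Q x - ?Q (dil t x)\<bar> \<le> B * radius * (1 - t)" if "x \<in> \<Omega>" "0 \<le> t" "t \<le> 1" for x t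
        using radial_Lipschitz[OF QD D_le that] by simp
      show "AE x in N. \<exists>D'. GDERIV ?Q x :> D' \<and> D x \<bullet> (x - a) = D' \<bullet> (x - a)"
        using QD by (intro AE_I2) auto
    qed
    have Qi: "integrable N ?Q"
    proof (rule integrable_bounded[OF Qm, of "(1 / \<epsilon>) * M"], rule AE_I2)
      fix x assume "x \<in> space N"
      then have x: "x \<in> \<Omega>" by simp
      show "\<bar>?Q x\<bar> \<le> (1 / \<epsilon>) * M"
        by (rule order_trans[OF Q_le[OF x] mult_left_mono[OF u_le[OF x]]]) (use \<epsilon> in simp)
    qed
    have di: "integrable N (\<lambda>x. - (D x \<bullet> (x - a)))"
    proof (rule integrable_bounded[of _ "B * radius"])
      show "(\<lambda>x. - (D x \<bullet> (x - a))) \<in> borel_measurable N" using dm by simp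
      show "AE x in N. \<bar>- (D x \<bullet> (x - a))\<bar> \<le> B * radius"
      proof (rule AE_I2)
        fix x assume "x \<in> space N"
        then have x: "x \<in> \<Omega>" by simp
        have "\<bar>D x \<bullet> (x - a)\<bar> \<le> norm (D x) * norm (x - a)" by (rule Cauchy_Schwarz_ineq2)
        also have "\<dots> \<le> B * radius"
          using D_le[OF x] radius(2)[OF x] order_trans[OF norm_ge_zero D_le[OF x]] by (intro mult_mono) auto
        finally show "\<bar>- (D x \<bullet> (x - a))\<bar> \<le> B * radius" by simp
      qed
    qed
    have "real CARD('n) * (\<integral>x. ?Q x \<partial>N) = (\<integral>x. - (D x \<bullet> (x - a)) \<partial>N)" using id by simp
    also have "\<dots> \<le> (\<integral>x. A * (1 + \<zeta> x * (H (g x) / ?\<sigma> x) powr p) \<partial>N)"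
    proof (rule integral_mono[OF di])
      show "integrable N (\<lambda>x. A * (1 + \<zeta> x * (H (g x) / ?\<sigma> x) powr p))" using C6(1)[OF \<epsilon>] by simp
      fix x assume "x \<in> space N"
      then have x: "x \<in> \<Omega>" by simp
      have Hs: "H (g x) / ?\<sigma> x \<ge> 0" using H_nonneg \<sigma>_pos[of x] by simp
      have sign: "0 \<le> ?W x * (bump_deriv (height x) * (w \<bullet> (x - a)))"
      proof (cases "height x > 0")
        case True
        then have "w \<bullet> (x - a) \<ge> 0" using m by (simp add: height_def inner_commute)
        then show ?thesis by (intro mult_nonneg_nonneg W_nonneg[OF x] bump_bounds)
      qed (simp add: bump_deriv_def)
      have "- (D x \<bullet> (x - a)) \<le> - (\<zeta> x * (?\<sigma>' x / ?\<sigma> x * (g x \<bullet> (x - a))))"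
        using sign by (simp add: D_def inner_add_left)
      also have "\<dots> \<le> \<bar>\<zeta> x * (?\<sigma>' x / ?\<sigma> x * (g x \<bullet> (x - a)))\<bar>" by (rule abs_ge_minus_self)
      also have "\<dots> = \<zeta> x * (?\<sigma>' x / ?\<sigma> x * \<bar>g x \<bullet> (x - a)\<bar>)"
        using \<zeta>_bounds(1)[of x] softplus_deriv_bounds(1)[OF \<epsilon>, of "u x"] \<sigma>_pos[of x] by (simp add: abs_mult)
      also have "\<dots> \<le> \<zeta> x * (2 / ?\<sigma> x * (H (g x) / c * radius))"
      proof (intro mult_left_mono mult_mono \<zeta>_bounds)
        show "?\<sigma>' x / ?\<sigma> x \<le> 2 / ?\<sigma> x"
          using softplus_deriv_bounds(2)[OF \<epsilon>] \<sigma>_pos[of x] by (intro divide_right_mono) auto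
        have "\<bar>g x \<bullet> (x - a)\<bar> \<le> norm (g x) * norm (x - a)" by (rule Cauchy_Schwarz_ineq2)
        also have "\<dots> \<le> H (g x) / c * radius"
          using C(1,3) radius(2)[OF x] H_nonneg by (intro mult_mono) (auto simp: field_simps)
        finally show "\<bar>g x \<bullet> (x - a)\<bar> \<le> H (g x) / c * radius" .
      qed (use \<sigma>_pos[of x] in auto)
      also have "\<dots> = A * (\<zeta> x * (H (g x) / ?\<sigma> x))" by (simp add: A_def ac_simps)
      also have "\<dots> \<le> A * (\<zeta> x * (1 + (H (g x) / ?\<sigma> x) powr p))"
        using le_eps_plus_powr[OF Hs zero_less_one, of p] p_gt_1 A by (intro mult_left_mono \<zeta>_bounds) auto
      also have "\<dots> \<le> A * (1 + \<zeta> x * (H (g x) / ?\<sigma> x) powr p)"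
        using A \<zeta>_bounds(2)[of x] by (intro mult_left_mono) (auto simp: distrib_left)
      finally show "- (D x \<bullet> (x - a)) \<le> A * (1 + \<zeta> x * (H (g x) / ?\<sigma> x) powr p)" .
    qed
    also have "\<dots> = A * (volume + (\<integral>x. \<zeta> x * (H (g x) / ?\<sigma> x) powr p \<partial>N))"
      using C6(1)[OF \<epsilon>] by (simp add: volume_def)
    also have "\<dots> \<le> A * (volume + C6)" using C6(2)[OF \<epsilon>] A by simp
    finally show ?thesis using Qi by blast
  qed
  show thesis
  proof (rule that[of "\<bar>A * (volume + C6)\<bar> / real CARD('n)"])
    show "integrable N (\<lambda>x. \<zeta> x * ln (softplus \<epsilon> (u x) / (2 * \<epsilon>)))" if "\<epsilon> > 0" for \<epsilon> using main[OF that] by blast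
    show "(\<integral>x. \<zeta> x * ln (softplus \<epsilon> (u x) / (2 * \<epsilon>)) \<partial>N) \<le> \<bar>A * (volume + C6)\<bar> / real CARD('n)" if "\<epsilon> > 0" for \<epsilon>
    proof -
      have "real CARD('n) * (\<integral>x. \<zeta> x * ln (softplus \<epsilon> (u x) / (2 * \<epsilon>)) \<partial>N) \<le> \<bar>A * (volume + C6)\<bar>"
        using main[OF that] by linarith
      then show ?thesis by (simp add: le_divide_eq mult.commute)
    qed
  qed simp
qed

text \<open>On a small open set in the cap both \<open>u\<close> and \<open>\<zeta>\<close> are bounded below by positive numbers, and there
  the logarithm tends to infinity as \<open>\<epsilon> \<rightarrow> 0\<close>.\<close>

lemma no_critical_solution: False
proof -
  obtain C where C: "C \<ge> 0" "\<And>\<epsilon>. \<epsilon> > 0 \<Longrightarrow> integrable N (\<lambda>x. \<zeta> x * ln (softplus \<epsilon> (u x) / (2 * \<epsilon>)))"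
    "\<And>\<epsilon>. \<epsilon> > 0 \<Longrightarrow> (\<integral>x. \<zeta> x * ln (softplus \<epsilon> (u x) / (2 * \<epsilon>)) \<partial>N) \<le> C"
    by (rule log_integral_estimate) (rule that)
  have "open (\<Omega> \<inter> \<zeta> -` {0<..})"
    by (rule continuous_open_preimage[OF \<zeta>_continuous open_\<Omega>]) simp
  moreover have "\<Omega> \<inter> \<zeta> -` {0<..} \<noteq> {}"
    using cap_nonempty \<zeta>_pos_iff by (auto simp: height_def)
  ultimately have "\<not> (AE x in N. x \<notin> \<Omega> \<inter> \<zeta> -` {0<..})"
    by (rule not_AE_outside_open) simp
  then obtain x0 where x0: "x0 \<in> \<Omega>" "\<zeta> x0 > 0" "u x0 > 0"
    using u_pos by (metis (mono_tags, lifting) AE_mp AE_I2 IntD1 IntD2 greaterThan_iff vimageD)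
  define V where "V = (\<Omega> \<inter> \<zeta> -` {\<zeta> x0 / 2<..}) \<inter> (\<Omega> \<inter> u -` {u x0 / 2<..})"
  have V_open: "open V" unfolding V_def
    by (intro open_Int continuous_open_preimage[OF \<zeta>_continuous open_\<Omega>] continuous_open_preimage[OF u_continuous open_\<Omega>]) auto
  have V_ne: "V \<noteq> {}" and V_sub: "V \<subseteq> \<Omega>" using x0 by (auto simp: V_def)
  have "V \<inter> \<Omega> \<in> sets N" using V_open \<Omega>_sets by (intro sets_restrict_space_iff[THEN iffD2]) auto
  then have V_sets: "V \<in> sets N" using V_sub by (simp add: Int_absorb2)
  have Vi: "integrable N (indicator V :: _ \<Rightarrow> real)"
    using V_sets by (intro integrable_real_indicator) (auto simp: N.emeasure_eq_measure)
  define v where "v = (\<integral>x. indicator V x \<partial>N :: real)"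
  have v: "v > 0"
  proof -
    have "v \<noteq> 0"
    proof
      assume "v = 0"
      then have "AE x in N. indicator V x = (0::real)"
        using integral_nonneg_eq_0_iff_AE[OF Vi] by (simp add: v_def)
      then have "AE x in N. x \<notin> V" by eventually_elim (simp add: indicator_def split: if_splits)
      then show False using not_AE_outside_open[OF V_open V_ne V_sub] by blast
    qed
    moreover have "v \<ge> 0" unfolding v_def by (intro integral_nonneg_AE) simp
    ultimately show ?thesis by simp
  qed
  \<comment> \<open>\<open>\<epsilon>\<close> is so small that the logarithm is at least \<open>K\<close> on \<open>V\<close>, and \<open>K\<close> so large that its integral exceeds \<open>C\<close>\<close>
  define K where "K = (C + 1) / (\<zeta> x0 / 2 * v)"
  have K: "K > 0" using C(1) x0 v by (simp add: K_def)
  define \<epsilon> where "\<epsilon> = u x0 / 4 * exp (- K)"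
  have \<epsilon>: "\<epsilon> > 0" using x0 by (simp add: \<epsilon>_def)
  have "C + 1 = \<zeta> x0 / 2 * K * v" using x0 v by (simp add: K_def)
  also have "\<dots> = (\<integral>x. \<zeta> x0 / 2 * K * indicator V x \<partial>N)" by (simp add: v_def)
  also have "\<dots> \<le> (\<integral>x. \<zeta> x * ln (softplus \<epsilon> (u x) / (2 * \<epsilon>)) \<partial>N)"
  proof (rule integral_mono)
    show "integrable N (\<lambda>x. \<zeta> x0 / 2 * K * indicator V x)" using Vi by simp
    show "integrable N (\<lambda>x. \<zeta> x * ln (softplus \<epsilon> (u x) / (2 * \<epsilon>)))" by (rule C(2)[OF \<epsilon>])
    fix x assume "x \<in> space N"
    then have x: "x \<in> \<Omega>" by simp
    have W0: "0 \<le> ln (softplus \<epsilon> (u x) / (2 * \<epsilon>))"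
      using softplus_bounds(1)[OF \<epsilon> u_nonneg[OF x]] \<epsilon> by simp
    show "\<zeta> x0 / 2 * K * indicator V x \<le> \<zeta> x * ln (softplus \<epsilon> (u x) / (2 * \<epsilon>))"
    proof (cases "x \<in> V")
      case True
      have "K = ln (exp K)" by simp
      also have "exp K = (u x0 / 2) / (2 * \<epsilon>)" using x0 by (simp add: \<epsilon>_def exp_minus inverse_eq_divide)
      also have "ln \<dots> \<le> ln (softplus \<epsilon> (u x) / (2 * \<epsilon>))"
      proof (rule ln_mono)
        have "u x0 / 2 \<le> softplus \<epsilon> (u x)"
          using True softplus_bounds(2)[OF \<epsilon> u_nonneg[OF x]] by (auto simp: V_def)
        then show "(u x0 / 2) / (2 * \<epsilon>) \<le> softplus \<epsilon> (u x) / (2 * \<epsilon>)" using \<epsilon> by (intro divide_right_mono) auto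
      qed (use x0 \<epsilon> in auto)
      finally have "K \<le> ln (softplus \<epsilon> (u x) / (2 * \<epsilon>))" .
      moreover have "\<zeta> x0 / 2 \<le> \<zeta> x" using True by (auto simp: V_def)
      ultimately have "\<zeta> x0 / 2 * K \<le> \<zeta> x * ln (softplus \<epsilon> (u x) / (2 * \<epsilon>))"
        using K by (intro mult_mono \<zeta>_bounds) auto
      then show ?thesis using True by simp
    next
      case False
      then show ?thesis using W0 \<zeta>_bounds by simp
    qed
  qed
  also have "\<dots> \<le> C" by (rule C(3)[OF \<epsilon>])
  finally show False by simp
qed

end

section \<open>Nonexistence\<close>

theorem theorem1p5:
  fixes H :: "real^'n \<Rightarrow> real" and \<Omega> :: "(real^'n) set" and p \<mu> :: real
  assumes "anisotropic_norm H"
    and "1 < p" and "p < real CARD('n)"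
    and "open \<Omega>" and "connected \<Omega>" and "\<Omega> \<noteq> {}" and "bounded \<Omega>"
    and "starlike \<Omega>" and "smooth_boundary \<Omega>"
    and "\<mu> \<le> 0"
  shows "\<not> (\<exists>u. C1_closure \<Omega> u \<and> weak_solution H p \<mu> \<Omega> u)"
proof
  assume "\<exists>u. C1_closure \<Omega> u \<and> weak_solution H p \<mu> \<Omega> u"
  then obtain u where C1: "C1_closure \<Omega> u" and sol: "weak_solution H p \<mu> \<Omega> u" by blast
  obtain a where a: "\<And>x. x \<in> \<Omega> \<Longrightarrow> closed_segment a x \<subseteq> \<Omega>"
    using assms(8) unfolding starlike_def by blast
  interpret star_shaped_set \<Omega> a
  proof
    show "open \<Omega>" "bounded \<Omega>" by (fact assms)+
    fix x and t :: real assume "x \<in> \<Omega>" "0 \<le> t" "t \<le> 1"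
    then show "(1 - t) *\<^sub>R a + t *\<^sub>R x \<in> \<Omega>" using a by (force simp: closed_segment_def)
  qed
  interpret anisotropic H p
    by unfold_locales (fact assms)+
  obtain g where u_cont: "continuous_on (closure \<Omega>) u" and g_cl: "continuous_on (closure \<Omega>) g"
    and u_deriv: "\<And>x. x \<in> \<Omega> \<Longrightarrow> GDERIV u x :> g x"
    using C1 unfolding C1_closure_def by blast
  have g_cont: "continuous_on \<Omega> g" and u_cont\<Omega>: "continuous_on \<Omega> u"
    using continuous_on_subset[OF g_cl closure_subset] continuous_on_subset[OF u_cont closure_subset] by auto
  have cc: "compact (closure \<Omega>)" using bounded_\<Omega> by (simp add: compact_closure)
  obtain M1 where M1: "\<And>x. x \<in> closure \<Omega> \<Longrightarrow> norm (u x) \<le> M1"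
    using compact_imp_bounded[OF compact_continuous_image[OF u_cont cc]] by (force simp: bounded_iff)
  obtain M2 where M2: "\<And>x. x \<in> closure \<Omega> \<Longrightarrow> norm (g x) \<le> M2"
    using compact_imp_bounded[OF compact_continuous_image[OF g_cl cc]] by (force simp: bounded_iff)
  define M where "M = max M1 M2"
  have uM: "\<bar>u x\<bar> \<le> M" and gM: "norm (g x) \<le> M" if "x \<in> \<Omega>" for x
    using M1[of x] M2[of x] closure_subset that by (auto simp: M_def le_max_iff_disj)
  obtain Du where W: "W1p0 \<Omega> p u Du" and pos: "AE x in N. u x > 0"
    and eq: "\<And>v Dv. W1p0 \<Omega> p v Dv \<Longrightarrow>
        (\<integral>x. flux (Du x) \<bullet> Dv x \<partial>N) - \<mu> * (\<integral>x. u x powr (p - 1) * v x \<partial>N)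
        - (\<integral>x. u x powr (sobolev_conjugate CARD('n) p - 1) * v x \<partial>N) = 0"
    using sol unfolding weak_solution_def by blast
  have gm: "g \<in> borel_measurable N" and um: "u \<in> borel_measurable N"
    using continuous_imp_measurable_on_sets_lebesgue[OF g_cont \<Omega>_sets]
      continuous_imp_measurable_on_sets_lebesgue[OF u_cont\<Omega> \<Omega>_sets] by auto
  have p1: "p \<ge> 1" using assms(2) by simp
  have Lg: "Lp_on \<Omega> p g" using gM assms(2) by (intro Lp_on_bounded[OF gm, of M] AE_I2) auto
  have LDu: "Lp_on \<Omega> p u" "Lp_on \<Omega> p Du" "weak_gradient \<Omega> u Du" using W unfolding W1p0_def W1p_def by auto
  have Du_g: "AE x in N. Du x = g x"
    by (rule weak_gradient_eq_classical[OF open_\<Omega> LDu(3) u_deriv g_cont Lp_integrable[OF LDu(1) p1]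
          Lp_component_integrable[OF LDu(2) p1] Lp_component_integrable[OF Lg p1]])
  have Dum: "Du \<in> borel_measurable N" using LDu(2) by (simp add: Lp_on_def)
  have nonneg: "0 \<le> u x" if x: "x \<in> \<Omega>" for x
  proof (rule ccontr)
    assume "\<not> 0 \<le> u x"
    then have "\<Omega> \<inter> u -` {..<0} \<noteq> {}" using x by auto
    moreover have "open (\<Omega> \<inter> u -` {..<0})" by (rule continuous_open_preimage[OF u_cont\<Omega> open_\<Omega>]) simp
    moreover have "AE x in N. x \<notin> \<Omega> \<inter> u -` {..<0}" using pos by eventually_elim simp
    ultimately show False using not_AE_outside_open[of "\<Omega> \<inter> u -` {..<0}"] by blast
  qed
  interpret bounded_C1_solution \<Omega> a H p u g M \<mu>
  proof unfold_locales
    show "W1p0 \<Omega> p u g" by (rule W1p0_cong_gradient[OF W p1 Du_g gm])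
    show "(\<integral>x. flux (g x) \<bullet> Dv x \<partial>N) - \<mu> * (\<integral>x. u x powr (p - 1) * v x \<partial>N)
        - (\<integral>x. u x powr (sobolev_conjugate CARD('n) p - 1) * v x \<partial>N) = 0" if v: "W1p0 \<Omega> p v Dv" for v Dv
    proof -
      have Dvm: "Dv \<in> borel_measurable N" using v unfolding W1p0_def W1p_def Lp_on_def by blast
      have "(\<integral>x. flux (g x) \<bullet> Dv x \<partial>N) = (\<integral>x. flux (Du x) \<bullet> Dv x \<partial>N)"
      proof (rule integral_cong_AE)
        show "(\<lambda>x. flux (g x) \<bullet> Dv x) \<in> borel_measurable N" "(\<lambda>x. flux (Du x) \<bullet> Dv x) \<in> borel_measurable N"
          using measurable_compose[OF gm flux_measurable] measurable_compose[OF Dum flux_measurable] Dvm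
          by (auto intro: borel_measurable_inner)
        show "AE x in N. flux (g x) \<bullet> Dv x = flux (Du x) \<bullet> Dv x" using Du_g by eventually_elim simp
      qed
      then show ?thesis using eq[OF v] by simp
    qed
    show "u x \<le> M" if "x \<in> \<Omega>" for x using uM[OF that] by linarith
  qed (use assms(3,6) u_deriv g_cont nonneg gM pos in auto)
  have \<mu>0: "\<mu> = 0" using Pohozaev_inequality assms(10) by linarith
  obtain w \<phi> U m c1 c2 where cap: "open U" "smooth_on \<phi> U" "\<Omega> \<inter> U = {y \<in> U. \<phi> y < 0}"
    "m > 0" "c1 > 0" "\<And>x. x \<in> \<Omega> \<Longrightarrow> norm (x - a) \<le> norm w"
    "{x. norm (x - a) \<le> norm w \<and> m \<le> (x - a) \<bullet> w} \<subseteq> U"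
    "\<exists>x\<in>\<Omega>. m < (x - a) \<bullet> w"
    "\<And>x y. norm (x - a) \<le> norm w \<Longrightarrow> m \<le> (x - a) \<bullet> w \<Longrightarrow> norm (y - a) \<le> norm w \<Longrightarrow> m \<le> (y - a) \<bullet> w
      \<Longrightarrow> c1 \<le> gradient \<phi> x \<bullet> (y - a)"
    "\<And>x. norm (x - a) \<le> norm w \<Longrightarrow> m \<le> (x - a) \<bullet> w \<Longrightarrow> norm (gradient \<phi> x) \<le> c2"
    by (rule boundary_cap[OF assms(9,6)]) (rule that)
  interpret critical_solution \<Omega> a H p u g M \<mu> w \<phi> U m c1 c2
    by unfold_locales (fact \<mu>0 cap)+
  show False by (rule no_critical_solution)
qed

end
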